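(* Let $k\ge1$ be a natural number and let $\alpha,\beta>0$ be real numbers with $\alpha\beta=\pi^2$. Then \begin{align*} &\alpha^k\sum_{n=1}^{\infty}n\,d_k(n)\Psi_{(2\alpha)^k,k}(n)+\beta^k\sum_{n=1}^{\infty}n\,d_k(n)\Psi_{(2\beta)^k,k}(n)\\ &=\frac{1}{(k-1)!}\frac{d^{k-1}}{ds^{k-1}}\left\{\zeta^k(s-1)\zeta^k(s)\Gamma^k(s+1)\cos^{k-1}\left(\frac{\pi s}{2}\right)2^{-ks}\left(\alpha^{-k(s-1)}+\beta^{-k(s-1)}\right)\right\}\bigg|_{s=0}-\left(\frac{\pi}{2}\right)^{k-1}2^{-2k}. \end{align*}
   Context: $\zeta$ is the (analytically continued) Riemann zeta function, $\Gamma$ the Gamma function, and $f^k(s)$ denotes $(f(s))^k$. $d_k(n)$ is the Piltz divisor function: the number of ordered $k$-tuples of positive integers with product $n$ (so $\sum_{n\ge1} d_k(n)n^{-s}=\zeta^k(s)$ for $\mathrm{Re}(s)>1$). For $\rho>0$, $x>0$ and a natural number $k$, $$\Psi_{\rho,k}(x):=\frac{\pi^{k/2-1}}{2^{k-1}}\sum_{j=1}^\infty d_k(j)\,G^{k+1,0}_{0,2k}\left(\begin{matrix}\text{---}\\ (0)_k,\tfrac12;(\tfrac12)_{k-1}\end{matrix}\ \bigg|\ \frac{\rho^2j^2x^2}{2^{2k}}\right),$$ where $(a)_r$ means the parameter $a$ repeated $r$ times and the Meijer $G$-function occurring here is, for $z>0$ and any $\mu<0$, $$G^{k+1,0}_{0,2k}\left(\begin{matrix}\text{---}\\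 (0)_k,\tfrac12;(\tfrac12)_{k-1}\end{matrix}\ \bigg|\ z\right)=\frac{1}{2\pi i}\int_{\mu-i\infty}^{\mu+i\infty}\frac{\Gamma(-s)^k\,\Gamma(\tfrac12-s)}{\Gamma(\tfrac12+s)^{k-1}}\,z^s\,ds.$$ *)

theory Defs
  imports "HOL-Complex_Analysis.Complex_Analysis"
begin

text \<open>
  The continuation is unique on \<open>-{1}\<close> because that set is connected; the clause \<open>f 1 = 0\<close> only
  fixes the value at the pole, so that the description determines a total function.
\<close>
definition zeta :: "complex \<Rightarrow> complex" where
  "zeta = (THE f. f holomorphic_on (-{1}) \<and> f 1 = 0 \<and>
     (\<forall>s. Re s > 1 \<longrightarrow> f s = (\<Sum>n. 1 / of_nat (Suc n) powr s)))"

definition piltz :: "nat \<Rightarrow> nat \<Rightarrow> nat" where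
  "piltz k n = card {xs :: nat list. length xs = k \<and> (\<forall>x\<in>set xs. x > 0) \<and> prod_list xs = n}"

text \<open>
  The Meijer function \<open>G\<close> of type \<open>(k+1, 0; 0, 2k)\<close> with lower parameters \<open>0\<close> (\<open>k\<close> times), \<open>1/2\<close>;
  \<open>1/2\<close> (\<open>k-1\<close> times), as a Mellin--Barnes integral along the line \<open>Re s = \<mu>\<close>.  Parametrising by
  \<open>s = \<mu> + i t\<close> turns \<open>1/(2 \<pi> i) ds\<close> into \<open>1/(2 \<pi>) dt\<close>.  The value does not depend on
  the choice of \<open>\<mu> < 0\<close>; the abscissa is kept as an argument.
\<close>
definition meijer_G :: "real \<Rightarrow> nat \<Rightarrow> real \<Rightarrow> complex" where
  "meijer_G \<mu> k z = 1 / (2 * of_real pi) *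
     (LBINT t. let s = Complex \<mu> t in
        Gamma (- s) ^ k * Gamma (1/2 - s) / Gamma (1/2 + s) ^ (k - 1) * of_real z powr s)"

definition Psi :: "real \<Rightarrow> real \<Rightarrow> nat \<Rightarrow> real \<Rightarrow> complex" where
  "Psi \<mu> \<rho> k x = of_real (pi powr (real k / 2 - 1) / 2 ^ (k - 1)) *
     (\<Sum>i. let j = Suc i in
        of_nat (piltz k j) * meijer_G \<mu> k (\<rho>\<^sup>2 * (real j)\<^sup>2 * x\<^sup>2 / 2 ^ (2 * k)))"

end

theory Submission
  imports Defs "HOL-Probability.Sinc_Integral"
begin

text \<open>
  Put \<open>E(w) = (\<Gamma>(w) 2\<^sup>-\<^sup>w)\<^sup>k cos(\<pi>w/2)\<^sup>k\<^sup>-\<^sup>1\<close> (\<open>mellin_kernel\<close>).  The duplication and reflection formulas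
  turn the integrand of the Meijer function at \<open>x\<^sup>2\<close>, with the constant in front of \<open>\<Psi>\<close>, into
  \<open>E(w) x\<^sup>-\<^sup>w\<close> with \<open>w = -2s\<close> (\<open>meijer_G_eq_vertical_integral\<close>).  As \<open>E\<close> decays exponentially along
  vertical lines and has no pole in \<open>Re w > 0\<close>, the line \<open>Re w = -2\<mu>\<close> may be moved to
  \<open>Re w = 5/2\<close>.  There the Dirichlet series \<open>\<Sum> d\<^sub>k(j) j\<^sup>-\<^sup>w = \<zeta>(w)\<^sup>k\<close> and
  \<open>\<Sum> n d\<^sub>k(n) n\<^sup>-\<^sup>w = \<zeta>(w-1)\<^sup>k\<close> converge absolutely, so both summations go under the integral, and
  \<open>\<gamma>\<^sup>k \<Sum> n d\<^sub>k(n) \<Psi>(n)\<close> is the integral of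
    \<open>H\<^sub>\<gamma>(w) = (\<zeta>(w) \<zeta>(w-1))\<^sup>k E(w) \<gamma>\<^bsup>-k(w-1)\<^esup>\<close>
  over that line (\<open>sums_Psi_contour\<close>).

  The functional equation of \<open>\<zeta>\<close>, used at \<open>w\<close> and at \<open>w - 1\<close>, gives \<open>H\<^sub>\<beta>(w) = -H\<^sub>\<alpha>(2-w)\<close> because
  \<open>\<alpha>\<beta> = \<pi>\<^sup>2\<close> (\<open>contour_integrand_reflect\<close>).  Hence the second sum is minus the integral of \<open>H\<^sub>\<alpha>\<close> over
  \<open>Re w = -1/2\<close>, and the two sums together are the residues of \<open>H\<^sub>\<alpha>\<close> between the two lines.  The pole at
  \<open>0\<close> comes from \<open>\<Gamma>\<^sup>k\<close> and contributes the derivative with \<open>\<alpha>\<close>; reflection carries the pole of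
  \<open>H\<^sub>\<alpha>\<close> at \<open>2\<close> to that of \<open>H\<^sub>\<beta>\<close> at \<open>0\<close>, which is the derivative with \<open>\<beta>\<close>; at \<open>1\<close> the zero of order
  \<open>k-1\<close> of the cosine power leaves a simple pole of \<open>\<zeta>\<^sup>k\<close>, and its residue is the remaining constant.

  What this needs about \<open>\<zeta>\<close> is proved from the Dirichlet series.  Comparing the series with an
  integral continues it to \<open>Re s > 0\<close>.  On \<open>0 < s < 1\<close> the functional equation comes from computing
  the Mellin transform of \<open>1/x - 1/(e\<^sup>x-1)\<close> twice: this function is the amount by which an integral
  exceeds its Riemann sum both for \<open>u \<mapsto> e\<^sup>-\<^sup>u\<^sup>x\<close> and, by the partial fractions of the
  cotangent, for \<open>u \<mapsto> 2x/(x\<^sup>2+4\<pi>\<^sup>2u\<^sup>2)\<close>.  Everything is nonnegative there, so Tonelli's theorem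
  suffices.  The functional equation then continues \<open>\<zeta>\<close> to the plane and, with the decay of \<open>\<Gamma>\<close>,
  bounds it polynomially in vertical strips.
\<close>

section \<open>Growth in vertical strips\<close>

lemma nonpos_Ints_complexD:
  assumes "z \<in> \<int>\<^sub>\<le>\<^sub>0"
  shows "Re z \<le> 0" "Im z = 0"
  using assms by (auto elim!: nonpos_Ints_cases)

text \<open>
  Only the exponential rate \<open>r\<close> decides whether an integral along a vertical line converges, so the
  power of \<open>\<bar>Im s\<bar>\<close> is left unspecified.  The condition \<open>\<bar>Im s\<bar> \<ge> 1\<close> keeps away from the poles, which
  are all real in the applications.
\<close>
definition strip_growth :: "real \<Rightarrow> real \<Rightarrow> real \<Rightarrow> (complex \<Rightarrow> complex) \<Rightarrow> bool" where
  "strip_growth a b r f \<longleftrightarrow> (\<exists>C N. \<forall>s. a \<le> Re s \<longrightarrow> Re s \<le> b \<longrightarrow> 1 \<le> \<bar>Im s\<bar> \<longrightarrow>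
     norm (f s) \<le> C * \<bar>Im s\<bar> ^ N * exp (r * \<bar>Im s\<bar>))"

lemma strip_growthI:
  assumes "\<And>s. a \<le> Re s \<Longrightarrow> Re s \<le> b \<Longrightarrow> 1 \<le> \<bar>Im s\<bar> \<Longrightarrow>
             norm (f s) \<le> C * \<bar>Im s\<bar> ^ N * exp (r * \<bar>Im s\<bar>)"
  shows "strip_growth a b r f"
  unfolding strip_growth_def using assms by blast

lemma strip_growthE:
  assumes "strip_growth a b r f"
  obtains C N where "C \<ge> 0"
    "\<And>s. a \<le> Re s \<Longrightarrow> Re s \<le> b \<Longrightarrow> 1 \<le> \<bar>Im s\<bar> \<Longrightarrow>
       norm (f s) \<le> C * \<bar>Im s\<bar> ^ N * exp (r * \<bar>Im s\<bar>)"
proof -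
  from assms obtain C N where CN: "\<And>s. a \<le> Re s \<Longrightarrow> Re s \<le> b \<Longrightarrow> 1 \<le> \<bar>Im s\<bar> \<Longrightarrow>
       norm (f s) \<le> C * \<bar>Im s\<bar> ^ N * exp (r * \<bar>Im s\<bar>)"
    unfolding strip_growth_def by blast
  have "norm (f s) \<le> \<bar>C\<bar> * \<bar>Im s\<bar> ^ N * exp (r * \<bar>Im s\<bar>)"
    if "a \<le> Re s" "Re s \<le> b" "1 \<le> \<bar>Im s\<bar>" for s
    by (rule order.trans[OF CN[OF that]]) (intro mult_right_mono, auto)
  then show ?thesis by (intro that[of "\<bar>C\<bar>" N]) auto
qed

lemma strip_growth_bounded:
  assumes "\<And>s. a \<le> Re s \<Longrightarrow> Re s \<le> b \<Longrightarrow> norm (f s) \<le> C"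
  shows "strip_growth a b 0 f"
  by (rule strip_growthI[where N = 0 and C = C]) (use assms in auto)

lemma strip_growth_Un:
  assumes "strip_growth a c r f" "strip_growth c b r f"
  shows "strip_growth a b r f"
proof -
  obtain C N where f: "C \<ge> 0" "\<And>s. a \<le> Re s \<Longrightarrow> Re s \<le> c \<Longrightarrow> 1 \<le> \<bar>Im s\<bar> \<Longrightarrow>
       norm (f s) \<le> C * \<bar>Im s\<bar> ^ N * exp (r * \<bar>Im s\<bar>)"
    using strip_growthE[OF assms(1)] by blast
  obtain D M where g: "D \<ge> 0" "\<And>s. c \<le> Re s \<Longrightarrow> Re s \<le> b \<Longrightarrow> 1 \<le> \<bar>Im s\<bar> \<Longrightarrow>
       norm (f s) \<le> D * \<bar>Im s\<bar> ^ M * exp (r * \<bar>Im s\<bar>)"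
    using strip_growthE[OF assms(2)] by blast
  show ?thesis
  proof (rule strip_growthI[where C = "C + D" and N = "N + M"])
    fix s assume s: "a \<le> Re s" "Re s \<le> b" "1 \<le> \<bar>Im s\<bar>"
    have "C * \<bar>Im s\<bar> ^ N * exp (r * \<bar>Im s\<bar>) \<le> (C + D) * \<bar>Im s\<bar> ^ (N + M) * exp (r * \<bar>Im s\<bar>)"
         "D * \<bar>Im s\<bar> ^ M * exp (r * \<bar>Im s\<bar>) \<le> (C + D) * \<bar>Im s\<bar> ^ (N + M) * exp (r * \<bar>Im s\<bar>)"
      using s f(1) g(1) by (auto intro!: mult_right_mono mult_mono power_increasing)
    moreover have "norm (f s) \<le> C * \<bar>Im s\<bar> ^ N * exp (r * \<bar>Im s\<bar>) \<or>
                   norm (f s) \<le> D * \<bar>Im s\<bar> ^ M * exp (r * \<bar>Im s\<bar>)"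
      using f(2)[of s] g(2)[of s] s by (cases "Re s \<le> c") auto
    ultimately show "norm (f s) \<le> (C + D) * \<bar>Im s\<bar> ^ (N + M) * exp (r * \<bar>Im s\<bar>)"
      by linarith
  qed
qed

lemma strip_growth_mult:
  assumes "strip_growth a b r f" "strip_growth a b q g"
  shows "strip_growth a b (r + q) (\<lambda>s. f s * g s)"
proof -
  obtain C N where f: "C \<ge> 0" "\<And>s. a \<le> Re s \<Longrightarrow> Re s \<le> b \<Longrightarrow> 1 \<le> \<bar>Im s\<bar> \<Longrightarrow>
       norm (f s) \<le> C * \<bar>Im s\<bar> ^ N * exp (r * \<bar>Im s\<bar>)"
    using strip_growthE[OF assms(1)] by blast
  obtain D M where g: "D \<ge> 0" "\<And>s. a \<le> Re s \<Longrightarrow> Re s \<le> b \<Longrightarrow> 1 \<le> \<bar>Im s\<bar> \<Longrightarrow>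
       norm (g s) \<le> D * \<bar>Im s\<bar> ^ M * exp (q * \<bar>Im s\<bar>)"
    using strip_growthE[OF assms(2)] by blast
  show ?thesis
  proof (rule strip_growthI[where C = "C * D" and N = "N + M"])
    fix s assume s: "a \<le> Re s" "Re s \<le> b" "1 \<le> \<bar>Im s\<bar>"
    have "norm (f s * g s) \<le> (C * \<bar>Im s\<bar> ^ N * exp (r * \<bar>Im s\<bar>)) * (D * \<bar>Im s\<bar> ^ M * exp (q * \<bar>Im s\<bar>))"
      unfolding norm_mult using f(1) by (intro mult_mono f(2) g(2) s) auto
    also have "\<dots> = C * D * \<bar>Im s\<bar> ^ (N + M) * exp ((r + q) * \<bar>Im s\<bar>)"
      by (simp add: power_add ring_distribs exp_add mult_ac)
    finally show "norm (f s * g s) \<le> C * D * \<bar>Im s\<bar> ^ (N + M) * exp ((r + q) * \<bar>Im s\<bar>)" .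
  qed
qed

lemma strip_growth_power:
  assumes "strip_growth a b r f"
  shows "strip_growth a b (of_nat n * r) (\<lambda>s. f s ^ n)"
proof (induction n)
  case 0
  show ?case using strip_growth_bounded[of a b "\<lambda>_. 1" 1] by simp
next
  case (Suc n)
  show ?case using strip_growth_mult[OF assms Suc.IH] by (simp add: algebra_simps)
qed

lemma strip_growth_compose:
  assumes "strip_growth a b r f"
    and "\<And>s. a' \<le> Re s \<Longrightarrow> Re s \<le> b' \<Longrightarrow> a \<le> Re (g s) \<and> Re (g s) \<le> b"
    and "\<And>s. \<bar>Im (g s)\<bar> = \<bar>Im s\<bar>"
  shows "strip_growth a' b' r (\<lambda>s. f (g s))"
  using assms unfolding strip_growth_def by metis

lemma strip_growth_powr:
  assumes "x > 0"
  shows "strip_growth a b 0 (\<lambda>s. of_real x powr (of_real c * s + d))"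
proof -
  define C where "C = exp ((\<bar>c\<bar> * (\<bar>a\<bar> + \<bar>b\<bar>) + \<bar>Re d\<bar>) * \<bar>ln x\<bar>)"
  show ?thesis
  proof (rule strip_growth_bounded[where C = C])
    fix s assume s: "a \<le> Re s" "Re s \<le> b"
    have "\<bar>c\<bar> * \<bar>Re s\<bar> \<le> \<bar>c\<bar> * (\<bar>a\<bar> + \<bar>b\<bar>)"
      using s by (intro mult_left_mono) linarith+
    then have "\<bar>c * Re s + Re d\<bar> \<le> \<bar>c\<bar> * (\<bar>a\<bar> + \<bar>b\<bar>) + \<bar>Re d\<bar>"
      using abs_triangle_ineq[of "c * Re s" "Re d"] unfolding abs_mult by linarith
    then have "(c * Re s + Re d) * ln x \<le> (\<bar>c\<bar> * (\<bar>a\<bar> + \<bar>b\<bar>) + \<bar>Re d\<bar>) * \<bar>ln x\<bar>"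
      using abs_ge_self[of "(c * Re s + Re d) * ln x"]
        mult_right_mono[of "\<bar>c * Re s + Re d\<bar>" _ "\<bar>ln x\<bar>"] unfolding abs_mult by fastforce
    then show "norm (of_real x powr (of_real c * s + d)) \<le> C"
      using assms unfolding C_def
      by (subst norm_powr_real_powr) (auto simp: powr_def)
  qed
qed

lemma strip_growth_cos:
  "strip_growth a b (pi / 2) (\<lambda>s. cos (of_real pi * s / 2))"
proof (rule strip_growthI[where C = 1 and N = 0])
  fix s :: complex
  have "norm (cos (of_real pi * s / 2)) \<le> exp \<bar>Im (of_real pi * s / 2)\<bar>"
  proof -
    have "norm (exp (\<i> * z) + exp (- (\<i> * z))) \<le> exp \<bar>Im z\<bar> + exp \<bar>Im z\<bar>" for z
      by (rule order.trans[OF norm_triangle_ineq]) (intro add_mono; simp)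
    from this[of "of_real pi * s / 2"] show ?thesis
      unfolding cos_exp_eq norm_divide by simp
  qed
  then show "norm (cos (of_real pi * s / 2)) \<le> 1 * \<bar>Im s\<bar> ^ 0 * exp (pi / 2 * \<bar>Im s\<bar>)"
    by (simp add: abs_mult)
qed

text \<open>
  The form in which decay is used: \<open>1/(1+t\<^sup>2)\<close> is integrable and tends to \<open>0\<close>.
\<close>
lemma strip_growth_quadratic_decay:
  assumes "strip_growth a b r f" "r < 0"
  obtains C where "\<And>s. a \<le> Re s \<Longrightarrow> Re s \<le> b \<Longrightarrow> 1 \<le> \<bar>Im s\<bar> \<Longrightarrow>
                     norm (f s) \<le> C / (1 + (Im s)\<^sup>2)"
proof -
  obtain C N where f: "C \<ge> 0" "\<And>s. a \<le> Re s \<Longrightarrow> Re s \<le> b \<Longrightarrow> 1 \<le> \<bar>Im s\<bar> \<Longrightarrow>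
       norm (f s) \<le> C * \<bar>Im s\<bar> ^ N * exp (r * \<bar>Im s\<bar>)"
    using strip_growthE[OF assms(1)] by blast
  \<comment> \<open>\<open>e\<^sup>x \<ge> (x/n)\<^sup>n\<close> with \<open>n = N + 2\<close> beats \<open>t\<^sup>N (1 + t\<^sup>2)\<close>.\<close>
  define M where "M = (real (N + 2) / (-r)) ^ (N + 2)"
  have M: "t ^ N * exp (r * t) \<le> 2 * M / (1 + t\<^sup>2)" if "t \<ge> 1" for t :: real
  proof -
    have nn: "0 \<le> - r * t" using that assms(2) by (simp add: mult_nonpos_nonneg)
    have "(-r * t / real (N + 2)) ^ (N + 2) \<le> (1 + (-r * t) / real (N + 2)) ^ (N + 2)"
      using nn by (intro power_mono divide_nonneg_nonneg) auto
    also have "\<dots> \<le> exp (-r * t)"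
      using nn by (intro exp_ge_one_plus_x_over_n_power_n) auto
    finally have "M * (-r * t / real (N + 2)) ^ (N + 2) \<le> M * exp (- r * t)"
      using assms(2) unfolding M_def by (intro mult_left_mono zero_le_power divide_nonneg_pos) auto
    moreover have "M * (-r * t / real (N + 2)) ^ (N + 2) = t ^ (N + 2)"
      unfolding M_def power_mult_distrib[symmetric] using assms(2) by simp
    ultimately have "t ^ (N + 2) \<le> M * exp (- r * t)" by simp
    then have "t ^ N * exp (r * t) * t\<^sup>2 \<le> M"
      by (simp add: power_add exp_minus field_simps power2_eq_square)
    moreover have "t ^ N * exp (r * t) * 1 \<le> t ^ N * exp (r * t) * t\<^sup>2"
      using that by (intro mult_left_mono) (auto simp: one_le_power)
    ultimately have "t ^ N * exp (r * t) * (1 + t\<^sup>2) \<le> 2 * M"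
      by (simp add: algebra_simps)
    moreover have "1 + t\<^sup>2 > 0" by (simp add: add_pos_nonneg)
    ultimately show ?thesis by (subst pos_le_divide_eq)
  qed
  show ?thesis
  proof (rule that[of "C * (2 * M)"])
    fix s assume s: "a \<le> Re s" "Re s \<le> b" "1 \<le> \<bar>Im s\<bar>"
    have "norm (f s) \<le> C * (\<bar>Im s\<bar> ^ N * exp (r * \<bar>Im s\<bar>))"
      using f(2)[OF s] by (simp add: mult_ac)
    also have "\<dots> \<le> C * (2 * M / (1 + \<bar>Im s\<bar>\<^sup>2))"
      using f(1) s by (intro mult_left_mono M) auto
    finally show "norm (f s) \<le> C * (2 * M) / (1 + (Im s)\<^sup>2)" by simp
  qed
qed

section \<open>Decay of the Gamma function\<close>

text \<open>
  In the product \<open>\<bar>\<Gamma>(x+iy)\<bar>/\<Gamma>(x) = \<Prod> (x+n)/\<bar>x+n+iy\<bar>\<close> every factor increases with \<open>x\<close>.  This carries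
  the bound on one vertical line to the whole strip to its left, uniformly, and so replaces
  Stirling's formula.
\<close>
lemma norm_Gamma_ratio_mono:
  assumes "0 < x" "x \<le> m"
  shows "norm (Gamma (Complex x y)) * norm (Gamma (of_real m :: complex)) \<le>
         norm (Gamma (Complex m y)) * norm (Gamma (of_real x :: complex))"
proof (rule LIMSEQ_le)
  define G where "G = (Gamma_series :: complex \<Rightarrow> _)"
  show "(\<lambda>n. norm (G (Complex x y) n) * norm (G (of_real m) n)) \<longlonglongrightarrow>
          norm (Gamma (Complex x y)) * norm (Gamma (of_real m :: complex))"
    and "(\<lambda>n. norm (G (Complex m y) n) * norm (G (of_real x) n)) \<longlonglongrightarrow>
          norm (Gamma (Complex m y)) * norm (Gamma (of_real x :: complex))"
    unfolding G_def by (intro tendsto_intros)+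
  have poch: "norm (pochhammer (Complex m y) n) * norm (pochhammer (of_real x :: complex) n) \<le>
      norm (pochhammer (Complex x y) n) * norm (pochhammer (of_real m :: complex) n)" for n
  proof -
    have *: "cmod (Complex m y + of_nat k) * cmod (of_real x + of_nat k) \<le>
          cmod (Complex x y + of_nat k) * cmod (of_real m + of_nat k)" for k
    proof -
      define u v where "u = x + real k" and "v = m + real k"
      have uv: "0 < u" "u \<le> v" using assms by (auto simp: u_def v_def)
      have "(v\<^sup>2 + y\<^sup>2) * u\<^sup>2 \<le> (u\<^sup>2 + y\<^sup>2) * v\<^sup>2"
        using mult_left_mono[of "u\<^sup>2" "v\<^sup>2" "y\<^sup>2"] uv by (simp add: algebra_simps power_mono)
      then have "sqrt ((v\<^sup>2 + y\<^sup>2) * u\<^sup>2) \<le> sqrt ((u\<^sup>2 + y\<^sup>2) * v\<^sup>2)" by (rule real_sqrt_le_mono)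
      then have "sqrt (v\<^sup>2 + y\<^sup>2) * u \<le> sqrt (u\<^sup>2 + y\<^sup>2) * v"
        using uv by (simp add: real_sqrt_mult)
      moreover have "cmod (of_real x + of_nat k) = u" "cmod (of_real m + of_nat k) = v"
        using uv norm_of_real[of u, where 'a = complex] norm_of_real[of v, where 'a = complex]
        by (simp_all add: u_def v_def)
      ultimately show ?thesis
        by (simp add: cmod_def u_def v_def)
    qed
    show ?thesis
      unfolding pochhammer_prod prod_norm[symmetric] prod.distrib[symmetric]
      by (intro prod_mono conjI * mult_nonneg_nonneg norm_ge_zero)
  qed
  have pos: "pochhammer (Complex a b) n \<noteq> 0" "pochhammer (of_real a :: complex) n \<noteq> 0" if "a > 0" for a b n
    using that unfolding pochhammer_eq_0_iff by (auto simp: complex_eq_iff)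
  show "\<exists>N. \<forall>n\<ge>N. norm (G (Complex x y) n) * norm (G (of_real m) n) \<le>
                   norm (G (Complex m y) n) * norm (G (of_real x) n)"
  proof (intro exI allI impI)
    fix n :: nat
    define A where "A = fact n * exp (x * ln (real n)) * (fact n * exp (m * ln (real n)))"
    have "A / (norm (pochhammer (Complex x y) (Suc n)) * norm (pochhammer (of_real m :: complex) (Suc n))) \<le>
          A / (norm (pochhammer (Complex m y) (Suc n)) * norm (pochhammer (of_real x :: complex) (Suc n)))"
      using pos assms poch by (intro divide_left_mono) (auto simp: A_def)
    then show "norm (G (Complex x y) n) * norm (G (of_real m) n) \<le>
               norm (G (Complex m y) n) * norm (G (of_real x) n)"
      by (simp add: G_def Gamma_series_def norm_divide norm_mult A_def mult_ac)
  qed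
qed

text \<open>
  On this line \<open>\<Gamma>(z) \<Gamma>(1-z) = \<bar>\<Gamma>(z)\<bar>\<^sup>2\<close>, so the reflection formula gives the exact value
  \<open>\<pi>/cosh(\<pi>y)\<close>.
\<close>
lemma norm_Gamma_half_line:
  "norm (Gamma (Complex (1/2) y)) \<le> sqrt (2 * pi) * exp (- (pi / 2) * \<bar>y\<bar>)"
proof -
  define z where "z = Complex (1/2) y"
  have cz: "cnj z = 1 - z" by (simp add: z_def complex_eq_iff)
  have sin: "sin (of_real pi * z) = of_real (cosh (pi * y))"
  proof -
    have "of_real pi * z = of_real (pi / 2) + \<i> * of_real (pi * y)"
      by (simp add: z_def complex_eq_iff)
    then have "sin (of_real pi * z) = cos (\<i> * of_real (pi * y))"
      by (simp add: sin_add flip: sin_of_real cos_of_real)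
    also have "\<dots> = of_real (cosh (pi * y))"
      by (simp add: cos_exp_eq cosh_field_def exp_of_real[symmetric] add_ac)
    finally show ?thesis .
  qed
  have "of_real ((norm (Gamma z))\<^sup>2) = Gamma z * cnj (Gamma z)"
    by (rule complex_norm_square)
  also have "\<dots> = of_real pi / sin (of_real pi * z)"
    by (simp add: cnj_Gamma cz Gamma_reflection_complex)
  also have "\<dots> = of_real (pi / cosh (pi * y))"
    by (simp add: sin)
  finally have sq: "(norm (Gamma z))\<^sup>2 = pi / cosh (pi * y)"
    using of_real_eq_iff by blast
  have "exp (pi * \<bar>y\<bar>) / 2 \<le> cosh (pi * \<bar>y\<bar>)"
    by (simp add: cosh_field_def)
  also have "cosh (pi * \<bar>y\<bar>) = cosh (pi * y)"
    by (cases "y \<ge> 0") auto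
  finally have "pi / cosh (pi * y) \<le> pi / (exp (pi * \<bar>y\<bar>) / 2)"
    by (intro divide_left_mono) auto
  also have "\<dots> = (sqrt (2 * pi) * exp (- (pi / 2) * \<bar>y\<bar>))\<^sup>2"
  proof -
    have "(exp (- (pi / 2) * \<bar>y\<bar>))\<^sup>2 = exp (- (pi * \<bar>y\<bar>))"
      by (subst exp_double[symmetric]) simp
    then have "(sqrt (2 * pi) * exp (- (pi / 2) * \<bar>y\<bar>))\<^sup>2 = 2 * pi * exp (- (pi * \<bar>y\<bar>))"
      by (simp only: power_mult_distrib) simp
    then show ?thesis by (simp only: exp_minus) (simp add: field_simps)
  qed
  finally show ?thesis
    unfolding sq[symmetric] z_def[symmetric] by (rule power2_le_imp_le) auto
qed

lemma norm_Gamma_le_shift: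
  assumes "1 \<le> \<bar>Im s\<bar>"
  shows "norm (Gamma s) \<le> norm (Gamma (s + of_nat n))"
proof (induction n)
  case (Suc n)
  let ?z = "s + of_nat n"
  have z: "1 \<le> norm ?z" using assms abs_Im_le_cmod[of ?z] by simp
  have nz: "?z \<notin> \<int>\<^sub>\<le>\<^sub>0"
  proof
    assume "?z \<in> \<int>\<^sub>\<le>\<^sub>0"
    from nonpos_Ints_complexD(2)[OF this] assms show False by simp
  qed
  have "Gamma (s + of_nat (Suc n)) = ?z * Gamma ?z"
    using Gamma_plus1[of ?z] nz by (simp add: add_ac)
  then have "norm (Gamma (s + of_nat (Suc n))) \<ge> 1 * norm (Gamma ?z)"
    unfolding norm_mult using z by (simp only: norm_mult) (intro mult_right_mono, auto)
  with Suc.IH show ?case by linarith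
qed auto

lemma norm_Gamma_half_line_shift:
  assumes "1 \<le> \<bar>y\<bar>"
  shows "norm (Gamma (Complex (1/2 + real n) y)) \<le>
           sqrt (2 * pi) * (real n + 1) ^ n * \<bar>y\<bar> ^ n * exp (- (pi / 2) * \<bar>y\<bar>)"
proof -
  define z where "z = Complex (1/2) y"
  have z: "z \<notin> \<int>\<^sub>\<le>\<^sub>0" using assms nonpos_Ints_complexD(2)[of z] by (auto simp: z_def)
  have "z + of_nat n = Complex (1/2 + real n) y" by (simp add: z_def complex_eq_iff)
  then have "Gamma (Complex (1/2 + real n) y) = pochhammer z n * Gamma z"
    using pochhammer_Gamma[OF z, of n] Gamma_eq_zero_iff[of z] z by (simp add: field_simps)
  moreover have "norm (pochhammer z n) \<le> ((real n + 1) * \<bar>y\<bar>) ^ n"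
  proof -
    have "norm (z + of_nat k) \<le> (real n + 1) * \<bar>y\<bar>" if "k < n" for k
    proof -
      have "norm (z + of_nat k) \<le> \<bar>1/2 + real k\<bar> + \<bar>y\<bar>"
        using cmod_le[of "z + of_nat k"] by (simp add: z_def)
      also have "\<dots> \<le> real n * 1 + \<bar>y\<bar>" using that by simp
      also have "\<dots> \<le> real n * \<bar>y\<bar> + \<bar>y\<bar>" using assms by (intro add_mono mult_left_mono) auto
      finally show ?thesis by (simp add: algebra_simps)
    qed
    then have "(\<Prod>k = 0..<n. norm (z + of_nat k)) \<le> (\<Prod>k = 0..<n. (real n + 1) * \<bar>y\<bar>)"
      by (intro prod_mono) auto
    then show ?thesis by (simp add: pochhammer_prod flip: prod_norm)
  qed
  ultimately have "norm (Gamma (Complex (1/2 + real n) y)) \<le>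
      ((real n + 1) * \<bar>y\<bar>) ^ n * (sqrt (2 * pi) * exp (- (pi / 2) * \<bar>y\<bar>))"
    using norm_Gamma_half_line[of y] by (auto simp: norm_mult z_def intro!: mult_mono)
  then show ?thesis by (simp add: power_mult_distrib mult_ac)
qed

text \<open>
  The strip is first shifted into \<open>Re s \<ge> 1\<close> by the recurrence, which only increases the modulus, and
  then compared with a line \<open>Re s = m + 1/2\<close> to its right.
\<close>
lemma strip_growth_Gamma: "strip_growth a b (- (pi / 2)) Gamma"
proof -
  obtain n where n: "a + real n \<ge> 1"
    using real_arch_simple[of "1 - a"] by (auto simp: algebra_simps)
  obtain m where m: "b + real n \<le> 1/2 + real m"
    using real_arch_simple[of "b + real n - 1/2"] by (auto simp: algebra_simps)
  let ?m = "1/2 + real m"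
  have "bounded ((\<lambda>x. Gamma (of_real x :: complex)) ` {1..b + real n})"
  proof (intro compact_imp_bounded compact_continuous_image)
    have "{s. Re s > 0} \<inter> \<int>\<^sub>\<le>\<^sub>0 = {}"
      using nonpos_Ints_complexD(1) by fastforce
    then show "continuous_on {1..b + real n} (\<lambda>x. Gamma (of_real x :: complex))"
      by (intro continuous_on_compose2[OF continuous_on_Gamma] continuous_intros) auto
  qed auto
  then obtain B where "\<forall>x\<in>{1..b + real n}. norm (Gamma (of_real x :: complex)) \<le> B"
    unfolding bounded_iff by auto
  then have B: "norm (Gamma (of_real x :: complex)) \<le> B" if "1 \<le> x" "x \<le> b + real n" for x
    using that by simp
  define g where "g = norm (Gamma (of_real ?m :: complex))"
  have g: "g > 0"
    using nonpos_Ints_complexD(1)[of "of_real ?m"] by (auto simp: g_def Gamma_eq_zero_iff)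
  show ?thesis
  proof (rule strip_growthI[where C = "B / g * (sqrt (2 * pi) * (real m + 1) ^ m)" and N = m])
    fix s assume s: "a \<le> Re s" "Re s \<le> b" "1 \<le> \<bar>Im s\<bar>"
    define x where "x = Re s + real n"
    have x: "1 \<le> x" "x \<le> b + real n" "x \<le> ?m" using s n m by (auto simp: x_def)
    have "norm (Gamma s) \<le> norm (Gamma (s + of_nat n))"
      by (rule norm_Gamma_le_shift) fact
    also have "s + of_nat n = Complex x (Im s)" by (simp add: x_def complex_eq_iff)
    also have "norm (Gamma (Complex x (Im s))) \<le>
        norm (Gamma (Complex ?m (Im s))) * norm (Gamma (of_real x :: complex)) / g"
      using norm_Gamma_ratio_mono[of x ?m "Im s"] x g by (simp add: g_def field_simps)
    also have "\<dots> \<le> (sqrt (2 * pi) * (real m + 1) ^ m * \<bar>Im s\<bar> ^ m * exp (- (pi / 2) * \<bar>Im s\<bar>)) * B / g"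
      using s x g by (intro divide_right_mono mult_mono B norm_Gamma_half_line_shift) auto
    finally show "norm (Gamma s) \<le> B / g * (sqrt (2 * pi) * (real m + 1) ^ m) * \<bar>Im s\<bar> ^ m *
        exp (- (pi / 2) * \<bar>Im s\<bar>)" by (simp add: mult_ac)
  qed
qed

section \<open>The zeta function in the right half-plane\<close>

text \<open>
  This is \<open>(s-1)\<close> times the error of approximating \<open>\<integral> x\<^sup>-\<^sup>s dx\<close> over \<open>[n+1, n+2]\<close> by the value of the
  integrand at \<open>n+1\<close>.  The factor \<open>s-1\<close> removes the division by \<open>1-s\<close>, so that the sum, which is
  \<open>(s-1) \<zeta>(s) - 1\<close>, is holomorphic at \<open>1\<close> too.
\<close>
definition zeta_term :: "complex \<Rightarrow> nat \<Rightarrow> complex" where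
  "zeta_term s n = (s - 1) * of_nat (Suc n) powr (-s) + of_nat (Suc (Suc n)) powr (1 - s)
                    - of_nat (Suc n) powr (1 - s)"

definition zeta_numer :: "complex \<Rightarrow> complex" where
  "zeta_numer s = 1 + (\<Sum>n. zeta_term s n)"

text \<open>
  Two applications of the mean value inequality: the term is the increment over \<open>[m, m+1]\<close> of
  \<open>z \<mapsto> z\<^bsup>1-s\<^esup> + (s-1) z m\<^sup>-\<^sup>s\<close>, whose derivative is \<open>(1-s)(z\<^sup>-\<^sup>s - m\<^sup>-\<^sup>s)\<close>.
\<close>
lemma norm_zeta_term_le:
  assumes "Re s > 0"
  shows "norm (zeta_term s n) \<le> norm (s - 1) * norm s * real (Suc n) powr (- Re s - 1)"
proof -
  define m where "m = real (Suc n)"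
  have m: "m > 0" by (simp add: m_def)
  let ?I = "closed_segment (of_real m) (of_real (m + 1)) :: complex set"
  have I: "\<exists>t. z = of_real t \<and> m \<le> t \<and> t \<le> m + 1" if "z \<in> ?I" for z
    using that m unfolding closed_segment_of_real
    by (auto simp: closed_segment_eq_real_ivl simp del: of_real_add)
  have nz: "z \<notin> \<real>\<^sub>\<le>\<^sub>0" "z \<noteq> 0" if "z \<in> ?I" for z
    using I[OF that] m by (auto simp: complex_nonpos_Reals_iff)
  have d1: "norm (z powr (-s) - of_real m powr (-s)) \<le> norm s * m powr (- Re s - 1)" if z: "z \<in> ?I" for z
  proof -
    have "norm (z powr (-s) - of_real m powr (-s)) \<le> (norm s * m powr (- Re s - 1)) * norm (z - of_real m)"
    proof (rule field_differentiable_bound[where S = ?I])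
      show "((\<lambda>w. w powr (-s)) has_field_derivative (-s * w powr (-s - 1))) (at w within ?I)" if "w \<in> ?I" for w
        using nz[OF that] by (auto intro!: derivative_eq_intros)
      show "norm (-s * w powr (-s - 1)) \<le> norm s * m powr (- Re s - 1)" if w: "w \<in> ?I" for w
      proof -
        from I[OF w] obtain t where t: "w = of_real t" "m \<le> t" by auto
        then have "norm (w powr (-s - 1)) = t powr (- Re s - 1)"
          using m by (simp add: norm_powr_real_powr)
        also have "\<dots> \<le> m powr (- Re s - 1)"
          using t m assms by (intro powr_mono2') auto
        finally show ?thesis by (simp add: norm_mult mult_left_mono)
      qed
    qed (use z in auto)
    also have "\<dots> \<le> (norm s * m powr (- Re s - 1)) * 1"
    proof (intro mult_left_mono)
      from I[OF z] obtain t where t: "z = of_real t" "m \<le> t" "t \<le> m + 1" by auto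
      then have "z - of_real m = of_real (t - m)" by simp
      then show "norm (z - of_real m) \<le> 1" using t by (simp only: norm_of_real)
    qed auto
    finally show ?thesis by simp
  qed
  define g where "g = (\<lambda>z. z powr (1 - s) + (s - 1) * z * of_real m powr (-s))"
  have "norm (g (of_real (m + 1)) - g (of_real m)) \<le>
          (norm (s - 1) * (norm s * m powr (- Re s - 1))) * norm (of_real (m + 1) - of_real m :: complex)"
  proof (rule field_differentiable_bound[where S = ?I])
    show "(g has_field_derivative ((1 - s) * (z powr (-s) - of_real m powr (-s)))) (at z within ?I)"
      if "z \<in> ?I" for z
      using nz[OF that] unfolding g_def by (auto intro!: derivative_eq_intros simp: algebra_simps)
    show "norm ((1 - s) * (z powr (-s) - of_real m powr (-s))) \<le> norm (s - 1) * (norm s * m powr (- Re s - 1))"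
      if "z \<in> ?I" for z
      using d1[OF that] by (simp add: norm_mult norm_minus_commute mult_left_mono)
  qed auto
  also have "g (of_real (m + 1)) - g (of_real m) = zeta_term s n"
    by (simp add: g_def zeta_term_def m_def add_ac ring_distribs)
  finally show ?thesis by (simp add: m_def mult_ac)
qed

lemma summable_Suc_powr: "r < -1 \<Longrightarrow> summable (\<lambda>n. real (Suc n) powr r)"
  using summable_Suc_iff[of "\<lambda>n. real n powr r"] by (simp add: summable_real_powr_iff)

lemma summable_zeta_term:
  assumes "Re s > 0"
  shows "summable (zeta_term s)"
proof (rule summable_comparison_test')
  show "summable (\<lambda>n. norm (s - 1) * norm s * real (Suc n) powr (- Re s - 1))"
    using assms by (intro summable_mult summable_Suc_powr) auto
qed (use norm_zeta_term_le[OF assms] in blast)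

lemma holomorphic_zeta_numer: "zeta_numer holomorphic_on {s. Re s > 0}"
proof -
  define S where "S = {s. Re s > 0}"
  have "open S" unfolding S_def by (rule open_halfspace_Re_gt)
  have "(\<lambda>s. \<Sum>n. zeta_term s n) holomorphic_on S"
  proof (rule holomorphic_uniform_sequence[OF \<open>open S\<close>])
    show "(\<lambda>s. \<Sum>n<k. zeta_term s n) holomorphic_on S" for k
      unfolding zeta_term_def
      by (intro holomorphic_on_sum holomorphic_on_add holomorphic_on_diff holomorphic_on_mult
            holomorphic_on_powr_right holomorphic_on_minus holomorphic_on_ident holomorphic_on_const)
    fix z assume "z \<in> S"
    then have z: "Re z > 0" by (simp add: S_def)
    define d where "d = Re z / 2"
    have d: "d > 0" using z by (simp add: d_def)
    have cb: "d \<le> Re s \<and> norm s \<le> norm z + d" if "s \<in> cball z d" for s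
    proof -
      have "norm (z - s) \<le> d" using that by (simp add: dist_norm)
      moreover have "Re z - Re s \<le> norm (z - s)" using complex_Re_le_cmod[of "z - s"] by simp
      moreover have "norm s \<le> norm z + norm (z - s)" by (metis norm_triangle_sub norm_minus_commute)
      ultimately show ?thesis by (simp add: d_def)
    qed
    have "uniform_limit (cball z d) (\<lambda>k s. \<Sum>n<k. zeta_term s n) (\<lambda>s. \<Sum>n. zeta_term s n) sequentially"
    proof (rule Weierstrass_m_test)
      fix n s assume s: "s \<in> cball z d"
      have "norm (zeta_term s n) \<le> norm (s - 1) * norm s * real (Suc n) powr (- Re s - 1)"
        using cb[OF s] d by (intro norm_zeta_term_le) auto
      also have "\<dots> \<le> (norm z + d + 1) * (norm z + d) * real (Suc n) powr (- d - 1)"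
      proof (intro mult_mono powr_mono)
        show "norm (s - 1) \<le> norm z + d + 1"
          using cb[OF s] norm_triangle_ineq4[of s 1] by simp
      qed (use cb[OF s] d in \<open>auto intro!: add_nonneg_nonneg mult_nonneg_nonneg\<close>)
      finally show "norm (zeta_term s n) \<le> (norm z + d + 1) * (norm z + d) * real (Suc n) powr (- d - 1)" .
    qed (use d in \<open>auto intro!: summable_mult summable_Suc_powr simp del: of_nat_Suc\<close>)
    moreover have "cball z d \<subseteq> S" using cb d by (fastforce simp: S_def)
    ultimately show "\<exists>d>0. cball z d \<subseteq> S \<and> uniform_limit (cball z d)
        (\<lambda>k s. \<Sum>n<k. zeta_term s n) (\<lambda>s. \<Sum>n. zeta_term s n) sequentially"
      using d by blast
  qed
  then show ?thesis unfolding zeta_numer_def S_def by (intro holomorphic_intros)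
qed

lemma zeta_numer_1: "zeta_numer 1 = 1"
proof -
  have "zeta_term 1 n = 0" for n
    unfolding zeta_term_def using of_nat_neq_0[where 'a = complex] by (simp del: of_nat_Suc)
  then show ?thesis by (simp add: zeta_numer_def)
qed

lemma sum_zeta_term:
  "(\<Sum>n<N. zeta_term s n) = (s - 1) * (\<Sum>n<N. of_nat (Suc n) powr (-s)) + of_nat (Suc N) powr (1 - s) - 1"
proof (induction N)
  case (Suc N)
  then show ?case by (simp add: zeta_term_def ring_distribs del: of_nat_Suc)
qed simp

lemma powr_nat_tendsto_0:
  assumes "Re s < 0"
  shows "(\<lambda>n. of_nat (Suc n) powr s :: complex) \<longlonglongrightarrow> 0"
proof (rule tendsto_norm_zero_cancel)
  have "(\<lambda>n. real (Suc n) powr Re s) \<longlonglongrightarrow> 0"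
    using assms by real_asymp
  then show "(\<lambda>n. norm (of_nat (Suc n) powr s :: complex)) \<longlonglongrightarrow> 0"
    by (simp add: norm_powr_real_powr del: of_nat_Suc)
qed

lemma summable_dirichlet:
  assumes "Re s > 1"
  shows "summable (\<lambda>n. norm (of_nat (Suc n) powr (-s) :: complex))"
proof -
  have "norm (of_nat (Suc n) powr (-s) :: complex) = real (Suc n) powr (- Re s)" for n
    by (subst norm_powr_real_powr) auto
  then show ?thesis using summable_Suc_powr[of "- Re s"] assms by (simp only:)
qed

lemma zeta_numer_dirichlet:
  assumes "Re s > 1"
  shows "zeta_numer s = (s - 1) * (\<Sum>n. of_nat (Suc n) powr (-s))"
proof -
  have "(\<lambda>N. \<Sum>n<N. zeta_term s n) \<longlonglongrightarrow> (s - 1) * (\<Sum>n. of_nat (Suc n) powr (-s)) + 0 - 1"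
    unfolding sum_zeta_term using assms
    by (intro tendsto_add tendsto_diff tendsto_mult tendsto_const powr_nat_tendsto_0 summable_LIMSEQ
          summable_norm_cancel[OF summable_dirichlet]) auto
  then have "(\<Sum>n. zeta_term s n) = (s - 1) * (\<Sum>n. of_nat (Suc n) powr (-s)) + 0 - 1"
    using summable_LIMSEQ[OF summable_zeta_term, of s] assms by (intro LIMSEQ_unique) auto
  then show ?thesis by (simp add: zeta_numer_def)
qed

lemma norm_zeta_numer_le:
  assumes "Re s \<ge> 1/2"
  shows "norm (zeta_numer s) \<le> 1 + norm (s - 1) * norm s * (\<Sum>n. real (Suc n) powr (- 3/2))"
proof -
  have *: "norm (zeta_term s n) \<le> norm (s - 1) * norm s * real (Suc n) powr (- 3/2)" for n
  proof -
    have "norm (zeta_term s n) \<le> norm (s - 1) * norm s * real (Suc n) powr (- Re s - 1)"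
      using assms by (intro norm_zeta_term_le) auto
    also have "\<dots> \<le> norm (s - 1) * norm s * real (Suc n) powr (- 3/2)"
      using assms by (intro mult_left_mono powr_mono) auto
    finally show ?thesis .
  qed
  have sm: "summable (\<lambda>n. real (Suc n) powr (- 3/2))" by (rule summable_Suc_powr) auto
  have "norm (\<Sum>n. zeta_term s n) \<le> (\<Sum>n. norm (s - 1) * norm s * real (Suc n) powr (- 3/2))"
    by (rule norm_suminf_le[OF * summable_mult[OF sm]])
  then have "norm (\<Sum>n. zeta_term s n) \<le> norm (s - 1) * norm s * (\<Sum>n. real (Suc n) powr (- 3/2))"
    unfolding suminf_mult[OF sm] .
  then show ?thesis
    unfolding zeta_numer_def using norm_triangle_ineq[of 1 "\<Sum>n. zeta_term s n"]
    unfolding norm_one by linarith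
qed

section \<open>Riemann sums and Mellin transforms\<close>

text \<open>
  For decreasing \<open>f\<close> with antiderivative \<open>P\<close> the nonnegative function \<open>f(u) - f(\<lceil>u\<rceil>)\<close> integrates, over
  \<open>(n, n+1]\<close>, to the integral of \<open>f\<close> minus the value \<open>f(n+1)\<close>.  The sum of these differences may
  converge although neither the integral nor the series of the values does.
\<close>
lemma nn_integral_ceiling_defect:
  fixes f P :: "real \<Rightarrow> real"
  assumes anti: "\<And>u v. 0 < u \<Longrightarrow> u \<le> v \<Longrightarrow> f v \<le> f u"
    and f [measurable]: "f \<in> borel_measurable borel"
    and P: "continuous_on {0..} P" "\<And>u. 0 < u \<Longrightarrow> (P has_real_derivative f u) (at u)"
    and L: "(\<lambda>n. P (real (Suc n)) - P (real n) - f (real (Suc n))) sums L"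
  shows "(\<integral>\<^sup>+u\<in>{0<..}. ennreal (f u - f (of_int \<lceil>u\<rceil>)) \<partial>lborel) = ennreal L" and "0 \<le> L"
proof -
  define B where "B = (\<lambda>n. {real n <.. real (Suc n)})"
  have ceil: "of_int \<lceil>u\<rceil> = real (Suc n)" if "u \<in> B n" for u n
  proof -
    have "\<lceil>u\<rceil> = int (Suc n)" using that by (intro ceiling_unique) (auto simp: B_def)
    then show ?thesis by simp
  qed
  have U: "{0<..} = (\<Union>n. B n)"
  proof (intro equalityI subsetI)
    fix u :: real assume u: "u \<in> {0<..}"
    define n where "n = nat (\<lceil>u\<rceil> - 1)"
    have "real n = of_int \<lceil>u\<rceil> - 1"
      using u by (simp add: n_def)
    then have "u \<in> B n" by (simp add: B_def) linarith
    then show "u \<in> (\<Union>n. B n)" by blast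
  next
    fix u :: real assume "u \<in> (\<Union>n. B n)"
    then obtain n where "u \<in> B n" by blast
    then show "u \<in> {0<..}" unfolding B_def
      by (metis greaterThanAtMost_iff greaterThan_iff of_nat_0_le_iff order_le_less_trans)
  qed
  have disj: "disjoint_family B"
  proof (unfold disjoint_family_on_def, intro ballI impI equals0I)
    fix m n u assume "m \<noteq> n" "u \<in> B m \<inter> B n"
    then show False using ceil[of u m] ceil[of u n] by simp
  qed
  have piece: "((\<lambda>u. f u - f (real (Suc n))) has_integral
                 (P (real (Suc n)) - P (real n) - f (real (Suc n)))) (B n)" for n
  proof -
    have "(f has_integral (P (real (Suc n)) - P (real n))) {real n..real (Suc n)}"
    proof (rule fundamental_theorem_of_calculus_interior)
      show "continuous_on {real n..real (Suc n)} P"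
        by (rule continuous_on_subset[OF P(1)]) auto
      show "(P has_vector_derivative f x) (at x)" if "x \<in> {real n<..<real (Suc n)}" for x
        using that P(2)[of x] by (auto simp: has_real_derivative_iff_has_vector_derivative)
    qed auto
    from has_integral_diff[OF this has_integral_const_real[of "f (real (Suc n))" "real n" "real (Suc n)"]]
    have "((\<lambda>u. f u - f (real (Suc n))) has_integral
             (P (real (Suc n)) - P (real n) - f (real (Suc n)))) {real n..real (Suc n)}"
      by simp
    then show ?thesis
      unfolding B_def by (rule has_integral_spike_set_eq[THEN iffD1, rotated 2])
        (auto intro!: negligible_subset[OF negligible_sing[of "real n"]])
  qed
  have nonneg: "0 \<le> f u - f (real (Suc n))" if "u \<in> B n" for u n
    using anti[of u "real (Suc n)"] that by (auto simp: B_def)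
  have "(\<integral>\<^sup>+u\<in>{0<..}. ennreal (f u - f (of_int \<lceil>u\<rceil>)) \<partial>lborel) =
        (\<Sum>n. \<integral>\<^sup>+u\<in>B n. ennreal (f u - f (of_int \<lceil>u\<rceil>)) \<partial>lborel)"
    unfolding U by (intro nn_integral_disjoint_family disj) (auto simp: B_def)
  also have "\<dots> = (\<Sum>n. ennreal (P (real (Suc n)) - P (real n) - f (real (Suc n))))"
  proof (intro suminf_cong)
    fix n
    have "(\<integral>\<^sup>+u\<in>B n. ennreal (f u - f (of_int \<lceil>u\<rceil>)) \<partial>lborel) =
          (\<integral>\<^sup>+u. ennreal (f u - f (real (Suc n))) * indicator (B n) u \<partial>lborel)"
      using ceil[of _ n] by (intro nn_integral_cong) (auto simp: indicator_def)
    also have "\<dots> = ennreal (P (real (Suc n)) - P (real n) - f (real (Suc n)))"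
      by (rule nn_integral_has_integral_lebesgue'[OF nonneg piece])
    finally show "(\<integral>\<^sup>+u\<in>B n. ennreal (f u - f (of_int \<lceil>u\<rceil>)) \<partial>lborel) =
        ennreal (P (real (Suc n)) - P (real n) - f (real (Suc n)))" .
  qed
  also have "\<dots> = ennreal L"
    by (intro suminf_ennreal_eq L has_integral_nonneg[OF piece nonneg])
  finally show "(\<integral>\<^sup>+u\<in>{0<..}. ennreal (f u - f (of_int \<lceil>u\<rceil>)) \<partial>lborel) = ennreal L" .
  show "0 \<le> L"
    by (rule sums_le[OF _ sums_zero L]) (rule has_integral_nonneg[OF piece nonneg])
qed

text \<open>
  Tonelli's theorem for \<open>x\<^bsup>s-1\<^esup> (h(u,x) - h(\<lceil>u\<rceil>,x)) \<ge> 0\<close>.  Integrating over \<open>u\<close> first yields \<open>K\<close>;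
  integrating over \<open>x\<close> first turns \<open>h(u,x)\<close> into a multiple of \<open>u\<^sup>-\<^sup>r\<close>, whose own defect \<open>\<phi>\<close> is
  \<open>-\<zeta>(r)\<close> if \<open>r < 1\<close>.  Used for two functions \<open>h\<close> with the same \<open>K\<close>, this is the functional equation.
\<close>
lemma mellin_ceiling_defect:
  fixes h :: "real \<Rightarrow> real \<Rightarrow> real"
  assumes h [measurable]: "(\<lambda>(u, x). h u x) \<in> borel_measurable (borel \<Otimes>\<^sub>M borel)"
    and nonneg: "\<And>u x. 0 < u \<Longrightarrow> 0 < x \<Longrightarrow> 0 \<le> h u x"
    and anti: "\<And>u v x. 0 < u \<Longrightarrow> u \<le> v \<Longrightarrow> 0 < x \<Longrightarrow> h v x \<le> h u x"
    and mellin: "\<And>u. 0 < u \<Longrightarrow>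
      (\<integral>\<^sup>+x\<in>{0<..}. ennreal (x powr (s - 1) * h u x) \<partial>lborel) = ennreal (A * u powr (- r))"
    and "A \<ge> 0" "r > 0"
    and K: "\<And>x. 0 < x \<Longrightarrow>
      (\<integral>\<^sup>+u\<in>{0<..}. ennreal (h u x - h (of_int \<lceil>u\<rceil>) x) \<partial>lborel) = ennreal (K x)"
    and \<phi>: "(\<integral>\<^sup>+u\<in>{0<..}. ennreal (u powr (- r) - of_int \<lceil>u\<rceil> powr (- r)) \<partial>lborel) = ennreal \<phi>"
  shows "(\<integral>\<^sup>+x\<in>{0<..}. ennreal (x powr (s - 1)) * ennreal (K x) \<partial>lborel) = ennreal A * ennreal \<phi>"
proof -
  define w where "w = (\<lambda>u x. ennreal (x powr (s - 1) * (h u x - h (of_int \<lceil>u\<rceil>) x))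
                        * indicator {0<..} x * indicator {0<..} u)"
  have [measurable]: "(\<lambda>(u, x). w u x) \<in> borel_measurable (lborel \<Otimes>\<^sub>M lborel)"
    unfolding w_def by measurable
  have hm [measurable]: "h u \<in> borel_measurable borel" "(\<lambda>u. h u x) \<in> borel_measurable borel" for u x
    by measurable
  have "(\<integral>\<^sup>+x\<in>{0<..}. ennreal (x powr (s - 1)) * ennreal (K x) \<partial>lborel) =
        (\<integral>\<^sup>+x. \<integral>\<^sup>+u. w u x \<partial>lborel \<partial>lborel)"
  proof (intro nn_integral_cong)
    fix x :: real
    show "ennreal (x powr (s - 1)) * ennreal (K x) * indicator {0<..} x = (\<integral>\<^sup>+u. w u x \<partial>lborel)"
    proof (cases "x > 0")
      case True
      have "(\<integral>\<^sup>+u. w u x \<partial>lborel) = (\<integral>\<^sup>+u. ennreal (x powr (s - 1)) *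
              (ennreal (h u x - h (of_int \<lceil>u\<rceil>) x) * indicator {0<..} u) \<partial>lborel)"
        using True by (intro nn_integral_cong) (auto simp: w_def indicator_def ennreal_mult')
      also have "\<dots> = ennreal (x powr (s - 1)) * ennreal (K x)"
        using True by (subst nn_integral_cmult) (auto simp: K)
      finally show ?thesis using True by simp
    qed (simp add: w_def)
  qed
  also have "\<dots> = (\<integral>\<^sup>+u. \<integral>\<^sup>+x. w u x \<partial>lborel \<partial>lborel)"
    by (rule lborel_pair.Fubini') measurable
  also have "\<dots> = (\<integral>\<^sup>+u. ennreal A * (ennreal (u powr (- r) - of_int \<lceil>u\<rceil> powr (- r)) * indicator {0<..} u) \<partial>lborel)"
  proof (intro nn_integral_cong)
    fix u :: real
    show "(\<integral>\<^sup>+x. w u x \<partial>lborel) =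
            ennreal A * (ennreal (u powr (- r) - of_int \<lceil>u\<rceil> powr (- r)) * indicator {0<..} u)"
    proof (cases "u > 0")
      case True
      define v where "v = (of_int \<lceil>u\<rceil> :: real)"
      have v: "0 < v" "u \<le> v" using True by (auto simp: v_def)
      have "(\<integral>\<^sup>+x. w u x \<partial>lborel) =
          (\<integral>\<^sup>+x. (ennreal (x powr (s - 1) * h u x) * indicator {0<..} x
                 - ennreal (x powr (s - 1) * h v x) * indicator {0<..} x) \<partial>lborel)"
        using True v nonneg[of v]
        by (intro nn_integral_cong) (auto simp: w_def v_def[symmetric] indicator_def ennreal_minus algebra_simps)
      also have "\<dots> = ennreal (A * u powr (- r)) - ennreal (A * v powr (- r))"
        unfolding mellin[OF True, symmetric] mellin[OF v(1), symmetric]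
      proof (rule nn_integral_diff)
        show "(\<integral>\<^sup>+x. ennreal (x powr (s - 1) * h v x) * indicator {0<..} x \<partial>lborel) \<noteq> \<infinity>"
          using mellin[OF v(1)] by simp
        show "AE x in lborel. ennreal (x powr (s - 1) * h v x) * indicator {0<..} x
                \<le> ennreal (x powr (s - 1) * h u x) * indicator {0<..} x"
          using anti[OF True v(2)]
          by (intro always_eventually allI) (auto simp: indicator_def intro!: ennreal_leI mult_left_mono)
      qed auto
      also have "\<dots> = ennreal A * ennreal (u powr (- r) - v powr (- r))"
        using \<open>A \<ge> 0\<close> by (simp add: ennreal_minus ennreal_mult'[symmetric] right_diff_distrib)
      finally show ?thesis using True by (simp add: v_def)
    qed (simp add: w_def)
  qed
  also have "\<dots> = ennreal A * ennreal \<phi>"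
    by (subst nn_integral_cmult) (auto simp: \<phi>)
  finally show ?thesis .
qed

text \<open>
  Euler's integral under the substitution \<open>t = v x\<^sup>p\<close>; the cases \<open>p = 1\<close> and \<open>p = 2\<close> are needed.
\<close>
lemma nn_integral_Gamma_powr:
  fixes p b v :: real
  assumes "p > 0" "b > 0" "v > 0"
  shows "(\<integral>\<^sup>+x\<in>{0<..}. ennreal (p * x powr (p * b - 1) * exp (- (v * x powr p))) \<partial>lborel)
           = ennreal (Gamma b * v powr (- b))"
proof -
  define f where "f = (\<lambda>t. t powr (b - 1) / exp t)"
  define g where "g = (\<lambda>x. v * x powr p)"
  have g: "g ` {0<..} = {0<..}"
  proof (intro equalityI subsetI)
    fix y :: real assume y: "y \<in> {0<..}"
    then have "g ((y / v) powr (1 / p)) = y" using assms by (simp add: g_def powr_powr)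
    then show "y \<in> g ` {0<..}" using y assms by (intro image_eqI[of _ _ "(y / v) powr (1 / p)"]) auto
  qed (use assms in \<open>auto simp: g_def\<close>)
  have inj: "inj_on g {0<..}"
  proof (rule inj_onI)
    fix x y :: real assume *: "x \<in> {0<..}" "y \<in> {0<..}" "g x = g y"
    then have "x powr p = y powr p" using assms by (simp add: g_def)
    then have "(x powr p) powr (1 / p) = (y powr p) powr (1 / p)" by simp
    then show "x = y" using * assms by (simp add: powr_powr)
  qed
  have "(f has_integral Gamma b) {0<..}"
    using Gamma_integral_real[OF assms(2)] unfolding f_def
    by (rule has_integral_spike_set_eq[THEN iffD1, rotated 2])
       (auto intro!: negligible_subset[OF negligible_sing[of "0::real"]])
  then have "f absolutely_integrable_on g ` {0<..} \<and> integral (g ` {0<..}) f = Gamma b"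
    unfolding g by (auto simp: integral_unique has_integral_integrable f_def
        intro!: nonnegative_absolutely_integrable_1)
  then have *: "(\<lambda>x. \<bar>v * (p * x powr (p - 1))\<bar> * f (g x)) absolutely_integrable_on {0<..} \<and>
             integral {0<..} (\<lambda>x. \<bar>v * (p * x powr (p - 1))\<bar> * f (g x)) = Gamma b"
    by (subst has_absolute_integral_change_of_variables_1'[OF _ _ inj, where g' = "\<lambda>x. v * (p * x powr (p - 1))"])
       (auto simp: g_def intro!: derivative_eq_intros)
  have **: "((\<lambda>x. v powr (-b) * (\<bar>v * (p * x powr (p - 1))\<bar> * f (g x))) has_integral v powr (-b) * Gamma b) {0<..}"
    using * by (intro has_integral_mult_right) (auto simp: absolutely_integrable_on_def has_integral_iff)
  have eq: "v powr (-b) * (\<bar>v * (p * x powr (p - 1))\<bar> * f (g x)) = p * x powr (p * b - 1) * exp (- (v * x powr p))"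
    if "x > 0" for x
  proof -
    have "v * v powr (b - 1) * v powr (- b) = 1"
      using assms by (simp add: powr_diff powr_minus field_simps)
    moreover have "x powr (p - 1) * (x powr p) powr (b - 1) = x powr (p * b - 1)"
      using that by (simp add: powr_powr powr_add[symmetric] algebra_simps)
    moreover have "v powr (-b) * (\<bar>v * (p * x powr (p - 1))\<bar> * f (g x)) =
       p * (v * v powr (b - 1) * v powr (- b)) * (x powr (p - 1) * (x powr p) powr (b - 1)) * exp (- (v * x powr p))"
      using assms that by (simp add: f_def g_def powr_mult exp_minus divide_inverse)
    ultimately show ?thesis by simp
  qed
  have "((\<lambda>x. p * x powr (p * b - 1) * exp (- (v * x powr p))) has_integral v powr (-b) * Gamma b) {0<..}"
    by (rule has_integral_eq[OF _ **]) (simp add: eq)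
  then show ?thesis
    using assms by (subst nn_integral_has_integral_lebesgue') (auto simp: mult.commute)
qed

text \<open>
  Write \<open>1/(x\<^sup>2+a\<^sup>2)\<close> as \<open>\<integral> exp(-(x\<^sup>2+a\<^sup>2)v) dv\<close> and integrate over \<open>x\<close> first: two Euler integrals
  remain, whose product \<open>\<Gamma>(b) \<Gamma>(1-b)\<close> with \<open>b = (s+1)/2\<close> is evaluated by reflection.
\<close>
lemma nn_integral_powr_rational:
  fixes a s :: real
  assumes "0 < s" "s < 1" "a > 0"
  shows "(\<integral>\<^sup>+x\<in>{0<..}. ennreal (x powr (s - 1) * (2 * x / (x\<^sup>2 + a\<^sup>2))) \<partial>lborel)
           = ennreal (pi / cos (pi * s / 2) * a powr (s - 1))"
proof -
  \<comment> \<open>chosen so that \<open>x\<^sup>s = x\<^bsup>2b-1\<^esup>\<close> fits the case \<open>p = 2\<close> of Euler's integral\<close>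
  define b where "b = (s + 1) / 2"
  have b: "0 < b" "b < 1" using assms by (auto simp: b_def)
  define w where "w = (\<lambda>x v. ennreal (2 * x powr (2 * b - 1) * exp (- (v * x powr 2)) * exp (- (a\<^sup>2 * v)))
                         * indicator {0<..} v * indicator {0<..} x)"
  have [measurable]: "(\<lambda>(x, v). w x v) \<in> borel_measurable (lborel \<Otimes>\<^sub>M lborel)"
    unfolding w_def by measurable
  have "(\<integral>\<^sup>+x\<in>{0<..}. ennreal (x powr (s - 1) * (2 * x / (x\<^sup>2 + a\<^sup>2))) \<partial>lborel) =
        (\<integral>\<^sup>+x. \<integral>\<^sup>+v. w x v \<partial>lborel \<partial>lborel)"
  proof (intro nn_integral_cong)
    fix x :: real
    show "ennreal (x powr (s - 1) * (2 * x / (x\<^sup>2 + a\<^sup>2))) * indicator {0<..} x = (\<integral>\<^sup>+v. w x v \<partial>lborel)"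
    proof (cases "x > 0")
      case True
      have pos: "x\<^sup>2 + a\<^sup>2 > 0" using True by (simp add: add_pos_nonneg)
      have "(\<integral>\<^sup>+v. w x v \<partial>lborel) = (\<integral>\<^sup>+v. ennreal (2 * x powr s) *
              (ennreal (1 * v powr (1 * 1 - 1) * exp (- ((x\<^sup>2 + a\<^sup>2) * v powr 1))) * indicator {0<..} v) \<partial>lborel)"
      proof (intro nn_integral_cong)
        fix v :: real
        have "exp (- (v * x powr 2)) * exp (- (a\<^sup>2 * v)) = exp (- ((x\<^sup>2 + a\<^sup>2) * v))"
          using True by (simp add: exp_add[symmetric] algebra_simps)
        moreover have "2 * b - 1 = s" by (simp add: b_def field_simps)
        ultimately show "w x v = ennreal (2 * x powr s) *
            (ennreal (1 * v powr (1 * 1 - 1) * exp (- ((x\<^sup>2 + a\<^sup>2) * v powr 1))) * indicator {0<..} v)"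
          using True by (auto simp: w_def indicator_def ennreal_mult'[symmetric] mult.assoc)
      qed
      also have "\<dots> = ennreal (2 * x powr s) * ennreal (Gamma 1 * (x\<^sup>2 + a\<^sup>2) powr (- 1))"
        using nn_integral_Gamma_powr[of 1 1 "x\<^sup>2 + a\<^sup>2"] pos
        by (subst nn_integral_cmult) auto
      also have "\<dots> = ennreal (x powr (s - 1) * (2 * x / (x\<^sup>2 + a\<^sup>2)))"
        using True pos by (simp add: ennreal_mult'[symmetric] powr_minus powr_diff field_simps)
      finally show ?thesis using True by simp
    qed (simp add: w_def)
  qed
  also have "\<dots> = (\<integral>\<^sup>+v. \<integral>\<^sup>+x. w x v \<partial>lborel \<partial>lborel)"
    by (rule lborel_pair.Fubini'[symmetric]) measurable
  also have "\<dots> = (\<integral>\<^sup>+v. ennreal (Gamma b) *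
              (ennreal (1 * v powr (1 * (1 - b) - 1) * exp (- (a\<^sup>2 * v powr 1))) * indicator {0<..} v) \<partial>lborel)"
  proof (intro nn_integral_cong)
    fix v :: real
    show "(\<integral>\<^sup>+x. w x v \<partial>lborel) = ennreal (Gamma b) *
              (ennreal (1 * v powr (1 * (1 - b) - 1) * exp (- (a\<^sup>2 * v powr 1))) * indicator {0<..} v)"
    proof (cases "v > 0")
      case True
      have "(\<integral>\<^sup>+x. w x v \<partial>lborel) = (\<integral>\<^sup>+x. ennreal (exp (- (a\<^sup>2 * v))) *
              (ennreal (2 * x powr (2 * b - 1) * exp (- (v * x powr 2))) * indicator {0<..} x) \<partial>lborel)"
        using True by (intro nn_integral_cong)
          (auto simp: w_def indicator_def ennreal_mult'[symmetric] mult_ac)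
      also have "\<dots> = ennreal (exp (- (a\<^sup>2 * v))) * ennreal (Gamma b * v powr (- b))"
        using nn_integral_Gamma_powr[of 2 b v] b True by (subst nn_integral_cmult) auto
      finally show ?thesis using True b by (simp add: ennreal_mult'[symmetric] mult_ac)
    qed (simp add: w_def)
  qed
  also have "\<dots> = ennreal (Gamma b) * ennreal (Gamma (1 - b) * (a\<^sup>2) powr (- (1 - b)))"
    using nn_integral_Gamma_powr[of 1 "1 - b" "a\<^sup>2"] b assms by (subst nn_integral_cmult) auto
  also have "\<dots> = ennreal ((Gamma b * Gamma (1 - b)) * (a\<^sup>2) powr (- (1 - b)))"
    using b by (simp add: ennreal_mult'[symmetric] mult_ac)
  also have "(a\<^sup>2) powr (- (1 - b)) = a powr (s - 1)"
  proof -
    have "(a\<^sup>2) powr (- (1 - b)) = a powr (2 * (- (1 - b)))"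
      using assms by (simp add: powr_powr flip: powr_numeral)
    also have "2 * (- (1 - b)) = s - 1" by (simp add: b_def field_simps)
    finally show ?thesis .
  qed
  also have "Gamma b * Gamma (1 - b) = pi / cos (pi * s / 2)"
  proof -
    have "complex_of_real (Gamma b * Gamma (1 - b)) = of_real pi / sin (of_real pi * of_real b)"
      using Gamma_reflection_complex[of "of_real b"]
      by (simp flip: Gamma_complex_of_real)
    also have "\<dots> = of_real (pi / sin (pi * b))"
      by (simp flip: sin_of_real)
    finally have "Gamma b * Gamma (1 - b) = pi / sin (pi * b)"
      by (simp only: of_real_eq_iff)
    also have "pi * b = pi * s / 2 + pi / 2" by (simp add: b_def field_simps)
    also have "sin (pi * s / 2 + pi / 2) = cos (pi * s / 2)" by (simp add: sin_add)
    finally show ?thesis .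
  qed
  finally show ?thesis .
qed

section \<open>Partial fractions\<close>

text \<open>
  The logarithmic derivative of \<open>\<Gamma>(1+z) \<Gamma>(1-z) sin(\<pi>z) = \<pi>z\<close>, multiplied by \<open>sin(\<pi>z)\<close>.
\<close>
lemma Digamma_reflection:
  fixes z :: complex
  assumes "z \<notin> \<int>"
  shows "(Digamma (1 + z) - Digamma (1 - z)) * sin (of_real pi * z) =
           sin (of_real pi * z) / z - of_real pi * cos (of_real pi * z)"
proof -
  have nonint: "1 + w \<notin> \<int>\<^sub>\<le>\<^sub>0" "1 - w \<notin> \<int>\<^sub>\<le>\<^sub>0" "w \<notin> \<int>\<^sub>\<le>\<^sub>0" "w \<noteq> 0" if "w \<notin> \<int>" for w :: complex
    using that nonpos_Ints_Int Ints_diff[of "1 + w" 1] Ints_diff[of 1 "1 - w"] by fastforce+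
  have refl: "Gamma (1 + w) * Gamma (1 - w) * sin (of_real pi * w) = of_real pi * w" if "w \<notin> \<int>" for w :: complex
  proof -
    note n = nonint[OF that]
    have "sin (of_real pi * w) = of_real pi * (rGamma w * rGamma (1 - w))"
      by (simp add: rGamma_reflection_complex)
    moreover have "Gamma (1 + w) = w * Gamma w"
      using Gamma_plus1[of w] n by (simp add: add_ac)
    ultimately have "Gamma (1 + w) * Gamma (1 - w) * sin (of_real pi * w) =
        of_real pi * w * (Gamma w * rGamma w) * (Gamma (1 - w) * rGamma (1 - w))"
      by (simp only: mult_ac)
    moreover have "Gamma w * rGamma w = 1" "Gamma (1 - w) * rGamma (1 - w) = 1"
      using n by (simp_all add: Gamma_def rGamma_eq_zero_iff)
    ultimately show ?thesis by simp
  qed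
  note n = nonint[OF assms]
  let ?G = "\<lambda>w. Gamma (1 + w) * Gamma (1 - w) * sin (of_real pi * w)"
  let ?D = "Gamma (1 + z) * Gamma (1 - z) * ((Digamma (1 + z) - Digamma (1 - z)) * sin (of_real pi * z)
              + of_real pi * cos (of_real pi * z))"
  have "(?G has_field_derivative ?D) (at z)"
    using n by (auto intro!: derivative_eq_intros simp: algebra_simps)
  moreover have "(?G has_field_derivative of_real pi) (at z)"
  proof (rule has_field_derivative_transform_within_open)
    show "((\<lambda>w. of_real pi * w) has_field_derivative of_real pi) (at z)"
      by (auto intro!: derivative_eq_intros)
    show "open (- \<int> :: complex set)" using closed_Ints by (simp add: open_Compl)
  qed (use assms refl in auto)
  ultimately have "?D = of_real pi" by (rule DERIV_unique)
  then have "?D * sin (of_real pi * z) = of_real pi * sin (of_real pi * z)" by simp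
  moreover define X where "X = (Digamma (1 + z) - Digamma (1 - z)) * sin (of_real pi * z)
              + of_real pi * cos (of_real pi * z)"
  then have "?D * sin (of_real pi * z) = ?G z * X" by (simp only: mult_ac)
  ultimately have "of_real pi * (z * X) = of_real pi * sin (of_real pi * z)"
    unfolding refl[OF assms] by (simp only: mult.assoc)
  then have "X = sin (of_real pi * z) / z" using n by (simp add: field_simps)
  then show ?thesis unfolding X_def by (simp add: eq_diff_eq)
qed

text \<open>
  The limit formula for the digamma function turns \<open>\<psi>(1-z) - \<psi>(1+z)\<close> into a series of simple
  fractions; on the imaginary axis the cotangent becomes a hyperbolic one.
\<close>
lemma sums_partial_fractions_exp:
  fixes x :: real
  assumes "x > 0"
  shows "(\<lambda>n. 2 * x / (x\<^sup>2 + (2 * pi * real (Suc n))\<^sup>2)) sums (1 / (exp x - 1) - 1 / x + 1 / 2)"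
proof -
  \<comment> \<open>\<open>n\<^sup>2 - z\<^sup>2\<close> is then proportional to \<open>x\<^sup>2 + (2\<pi>n)\<^sup>2\<close>.\<close>
  define z where "z = \<i> * of_real (x / (2 * pi))"
  have z: "z \<notin> \<int>" "z \<noteq> 0"
    using assms by (auto simp: z_def complex_eq_iff elim!: Ints_cases)
  have "(\<lambda>m. (of_real (ln (real m)) - (\<Sum>n<m. inverse (1 - z + of_nat n))) -
             (of_real (ln (real m)) - (\<Sum>n<m. inverse (1 + z + of_nat n)))) \<longlonglongrightarrow>
        Digamma (1 - z) - Digamma (1 + z)"
    by (intro tendsto_diff Digamma_LIMSEQ) (use z in \<open>auto simp: z_def complex_eq_iff\<close>)
  then have "(\<lambda>n. inverse (1 + z + of_nat n) - inverse (1 - z + of_nat n)) sums (Digamma (1 - z) - Digamma (1 + z))"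
    unfolding sums_def by (simp add: sum_subtractf)
  then have "(\<lambda>n. \<i> / (2 * of_real pi) * (inverse (1 + z + of_nat n) - inverse (1 - z + of_nat n))) sums
      (\<i> / (2 * of_real pi) * (Digamma (1 - z) - Digamma (1 + z)))"
    by (rule sums_mult)
  also have "(\<lambda>n. \<i> / (2 * of_real pi) * (inverse (1 + z + of_nat n) - inverse (1 - z + of_nat n))) =
             (\<lambda>n. of_real (2 * x / (x\<^sup>2 + (2 * pi * real (Suc n))\<^sup>2)))"
  proof
    fix n
    define m where "m = real (Suc n)"
    define y where "y = x / (2 * pi)"
    have m: "m > 0" by (simp add: m_def)
    have nz: "of_real m + z \<noteq> 0" "of_real m - z \<noteq> 0"
      using m by (auto simp: z_def complex_eq_iff)
    have "1 + z + of_nat n = of_real m + z" "1 - z + of_nat n = of_real m - z" by (simp_all add: m_def)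
    then have "inverse (1 + z + of_nat n) - inverse (1 - z + of_nat n) = - 2 * z / ((of_real m + z) * (of_real m - z))"
      using nz by (simp only:) (simp add: field_simps)
    also have "(of_real m + z) * (of_real m - z) = of_real (m\<^sup>2 + y\<^sup>2)"
      by (simp add: z_def y_def algebra_simps power2_eq_square)
    finally have "\<i> / (2 * of_real pi) * (inverse (1 + z + of_nat n) - inverse (1 - z + of_nat n)) =
        of_real (2 * y / (2 * pi * (m\<^sup>2 + y\<^sup>2)))"
      by (simp add: z_def y_def)
    also have "2 * y / (2 * pi * (m\<^sup>2 + y\<^sup>2)) = 2 * x / (x\<^sup>2 + (2 * pi * m)\<^sup>2)"
    proof -
      have "m\<^sup>2 + y\<^sup>2 > 0" using m by (simp add: add_pos_nonneg)
      moreover have "x\<^sup>2 + (2 * pi * m)\<^sup>2 = (2 * pi)\<^sup>2 * (m\<^sup>2 + y\<^sup>2)"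
        by (simp add: y_def field_simps)
      ultimately show ?thesis
        unfolding \<open>x\<^sup>2 + (2 * pi * m)\<^sup>2 = _\<close> by (simp add: y_def power2_eq_square)
    qed
    finally show "\<i> / (2 * of_real pi) * (inverse (1 + z + of_nat n) - inverse (1 - z + of_nat n)) =
        of_real (2 * x / (x\<^sup>2 + (2 * pi * real (Suc n))\<^sup>2))" by (simp add: m_def)
  qed
  also have "\<i> / (2 * of_real pi) * (Digamma (1 - z) - Digamma (1 + z)) =
             of_real (1 / (exp x - 1) - 1 / x + 1 / 2)"
  proof -
    define q where "q = exp (x / 2)"
    have q: "q > 1" using assms by (simp add: q_def)
    have qq: "exp x = q\<^sup>2" by (simp add: q_def power2_eq_square flip: exp_add)
    have piz: "\<i> * (of_real pi * z) = of_real (- x / 2)"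
      by (simp add: z_def)
    have e: "exp (\<i> * (of_real pi * z)) = of_real (inverse q)" "exp (- (\<i> * (of_real pi * z))) = of_real q"
      unfolding piz q_def exp_of_real minus_equation_iff[of "of_real _"]
      by (simp_all add: exp_minus flip: of_real_minus exp_of_real of_real_inverse)
    have s: "sin (of_real pi * z) = \<i> * of_real (q - inverse q) / 2"
      unfolding sin_exp_eq e by (simp add: field_simps)
    have c: "cos (of_real pi * z) = of_real (q + inverse q) / 2"
      unfolding cos_exp_eq e by simp
    have "q - inverse q > 0" using q by (simp add: field_simps less_1_mult)
    then have s0: "sin (of_real pi * z) \<noteq> 0" unfolding s by (simp flip: of_real_diff of_real_inverse)
    have "Digamma (1 + z) - Digamma (1 - z) = 1 / z - of_real pi * (cos (of_real pi * z) / sin (of_real pi * z))"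
      using Digamma_reflection[OF z(1)] s0 z(2) by (simp add: field_simps)
    then have D: "Digamma (1 - z) - Digamma (1 + z) = - (1 / z - of_real pi * (cos (of_real pi * z) / sin (of_real pi * z)))"
      by (metis minus_diff_eq)
    have "\<i> / (2 * of_real pi) * (Digamma (1 - z) - Digamma (1 + z)) =
        - (\<i> / (2 * of_real pi)) / z + \<i> / 2 * (cos (of_real pi * z) / sin (of_real pi * z))"
      unfolding D by (simp add: ring_distribs)
    also have "- (\<i> / (2 * of_real pi)) / z = of_real (- 1 / x)"
      using assms by (simp add: z_def)
    also have "\<i> / 2 * (cos (of_real pi * z) / sin (of_real pi * z)) = of_real ((q + inverse q) / (q - inverse q) / 2)"
    proof -
      have "\<i> / 2 * ((of_real A / 2) / (\<i> * of_real B / 2)) = of_real (A / B / 2)" for A B :: real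
        by simp
      then show ?thesis unfolding s c by blast
    qed
    also have "(q + inverse q) / (q - inverse q) / 2 = 1 / (q\<^sup>2 - 1) + 1 / 2"
      using q \<open>q - inverse q > 0\<close> by (simp add: field_simps power2_eq_square)
    finally show ?thesis by (simp add: qq)
  qed
  finally show ?thesis by (simp only: sums_of_real_iff)
qed

section \<open>The functional equation between 0 and 1\<close>

text \<open>
  The Riemann sum for \<open>\<integral> u\<^sup>-\<^sup>s du\<close> now uses right end points and starts at \<open>0\<close>, which is possible
  only for \<open>s < 1\<close>; its defect is \<open>-\<zeta>(s)\<close>.  Multiplied by \<open>1-s\<close>, its terms differ from those of
  \<^const>\<open>zeta_numer\<close> by second differences of \<open>n\<^bsup>1-s\<^esup>\<close>, which telescope.
\<close>
lemma zeta_numer_real_sums: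
  assumes "0 < s" "s < 1"
  defines "\<phi> \<equiv> Re (zeta_numer (of_real s) / (1 - of_real s))"
  shows "(\<lambda>n. real (Suc n) powr (1 - s) / (1 - s) - real n powr (1 - s) / (1 - s) - real (Suc n) powr (- s)) sums \<phi>"
    and "of_real \<phi> = zeta_numer (of_real s) / (1 - of_real s)"
proof -
  \<comment> \<open>At \<open>n = 0\<close> this is \<open>1\<close>, since \<open>0 powr (1 - s) = 0\<close>.\<close>
  define d where "d = (\<lambda>n. real (Suc n) powr (1 - s) - real n powr (1 - s))"
  define t where "t = (\<lambda>n. real (Suc n) powr (1 - s) / (1 - s) - real n powr (1 - s) / (1 - s) - real (Suc n) powr (- s))"
  have "d \<longlonglongrightarrow> 0" unfolding d_def using assms(1,2) by real_asymp
  from telescope_sums[OF this] have "(\<lambda>n. d (Suc n) - d n) sums (0 - d 0)" .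
  moreover have "d 0 = 1" using assms by (simp add: d_def)
  ultimately have "(\<lambda>n. complex_of_real (d (Suc n) - d n)) sums of_real (- 1)"
    by (subst sums_of_real_iff) simp
  moreover have "zeta_term (of_real s) sums (zeta_numer (of_real s) - 1)"
    using summable_sums[OF summable_zeta_term[of "of_real s"]] assms by (simp add: zeta_numer_def)
  ultimately have "(\<lambda>n. zeta_term (of_real s) n - of_real (d (Suc n) - d n)) sums (zeta_numer (of_real s) - 1 - of_real (- 1))"
    by (intro sums_diff)
  then have "(\<lambda>n. (zeta_term (of_real s) n - of_real (d (Suc n) - d n)) / (1 - of_real s)) sums
      ((zeta_numer (of_real s) - 1 - of_real (- 1)) / (1 - of_real s))"
    by (rule sums_divide)
  also have "(\<lambda>n. (zeta_term (of_real s) n - of_real (d (Suc n) - d n)) / (1 - of_real s)) = (\<lambda>n. of_real (t n))"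
  proof
    fix n
    have "zeta_term (of_real s) n = of_real ((s - 1) * real (Suc n) powr (- s)
            + real (Suc (Suc n)) powr (1 - s) - real (Suc n) powr (1 - s))"
    proof -
      have "(of_nat m :: complex) powr of_real a = of_real (real m powr a)" for m a
        using powr_of_real[of "real m" a] by simp
      from this[of "Suc n" "- s"] this[of "Suc n" "1 - s"] this[of "Suc (Suc n)" "1 - s"] show ?thesis
        by (simp add: zeta_term_def del: of_nat_Suc)
    qed
    then have "(zeta_term (of_real s) n - of_real (d (Suc n) - d n)) / (1 - of_real s) =
        of_real (((s - 1) * real (Suc n) powr (- s)
            + real (Suc (Suc n)) powr (1 - s) - real (Suc n) powr (1 - s) - (d (Suc n) - d n)) / (1 - s))"
      by (simp only: of_real_diff of_real_divide of_real_1)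
    also have "((s - 1) * real (Suc n) powr (- s)
            + real (Suc (Suc n)) powr (1 - s) - real (Suc n) powr (1 - s) - (d (Suc n) - d n)) / (1 - s) = t n"
      using assms(2) by (simp add: t_def d_def divide_simps del: of_nat_Suc) (simp add: algebra_simps)
    finally show "(zeta_term (of_real s) n - of_real (d (Suc n) - d n)) / (1 - of_real s) = of_real (t n)" .
  qed
  finally have *: "(\<lambda>n. of_real (t n)) sums (zeta_numer (of_real s) / (1 - of_real s))" by simp
  from sums_Re[OF this] show **: "t sums \<phi>"
    unfolding \<phi>_def by simp
  then have "(\<lambda>n. complex_of_real (t n)) sums of_real \<phi>" by (simp only: sums_of_real_iff)
  with * show "of_real \<phi> = zeta_numer (of_real s) / (1 - of_real s)" by (rule sums_unique2[symmetric])
qed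

lemma nn_integral_powr_ceiling_defect:
  assumes "0 < s" "s < 1"
  shows "(\<integral>\<^sup>+u\<in>{0<..}. ennreal (u powr (- s) - of_int \<lceil>u\<rceil> powr (- s)) \<partial>lborel)
           = ennreal (Re (zeta_numer (of_real s) / (1 - of_real s)))"
    and "0 \<le> Re (zeta_numer (of_real s) / (1 - of_real s))"
proof -
  have anti: "v powr (- s) \<le> u powr (- s)" if "0 < u" "u \<le> v" for u v :: real
    using assms that by (intro powr_mono2') auto
  have P: "continuous_on {0..} (\<lambda>u. u powr (1 - s) / (1 - s))"
    using assms by (intro continuous_intros continuous_on_powr') auto
  have P': "((\<lambda>u. u powr (1 - s) / (1 - s)) has_real_derivative u powr (- s)) (at u)" if "0 < u" for u
    using assms that by (auto intro!: derivative_eq_intros)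
  note * = nn_integral_ceiling_defect[OF anti _ P P' zeta_numer_real_sums(1)[OF assms]]
  show "(\<integral>\<^sup>+u\<in>{0<..}. ennreal (u powr (- s) - of_int \<lceil>u\<rceil> powr (- s)) \<partial>lborel)
           = ennreal (Re (zeta_numer (of_real s) / (1 - of_real s)))"
    by (rule *(1)) auto
  show "0 \<le> Re (zeta_numer (of_real s) / (1 - of_real s))"
    by (rule *(2)) auto
qed

lemma nn_integral_exp_ceiling_defect:
  fixes x :: real
  assumes "x > 0"
  shows "(\<integral>\<^sup>+u\<in>{0<..}. ennreal (exp (- (u * x)) - exp (- (of_int \<lceil>u\<rceil> * x))) \<partial>lborel)
           = ennreal (1 / x - 1 / (exp x - 1))"
proof (rule nn_integral_ceiling_defect[where P = "\<lambda>u. - exp (- (u * x)) / x"])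
  define q where "q = exp (- x)"
  have q: "0 < q" "q < 1" using assms by (auto simp: q_def)
  have "(\<lambda>n. ((1 - q) / x - q) * q ^ n) sums (((1 - q) / x - q) * (1 / (1 - q)))"
    using q by (intro sums_mult geometric_sums) auto
  also have "((1 - q) / x - q) * (1 / (1 - q)) = 1 / x - 1 / (exp x - 1)"
  proof -
    have "exp x = 1 / q" by (simp add: q_def exp_minus field_simps)
    moreover have "((1 - q) / x - q) * (1 / (1 - q)) = 1 / x - 1 / (1 / q - 1)"
      using q assms by (simp add: field_simps)
    ultimately show ?thesis by simp
  qed
  also have "(\<lambda>n. ((1 - q) / x - q) * q ^ n) =
     (\<lambda>n. - exp (- (real (Suc n) * x)) / x - - exp (- (real n * x)) / x - exp (- (real (Suc n) * x)))"
  proof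
    fix n
    have "exp (- (real n * x)) = q ^ n" for n
      using exp_of_nat_mult[of n "-x"] by (simp add: q_def)
    from this[of n] this[of "Suc n"]
    show "((1 - q) / x - q) * q ^ n =
        - exp (- (real (Suc n) * x)) / x - - exp (- (real n * x)) / x - exp (- (real (Suc n) * x))"
      by (simp add: diff_divide_distrib algebra_simps del: of_nat_Suc)
  qed
  finally show "(\<lambda>n. - exp (- (real (Suc n) * x)) / x - - exp (- (real n * x)) / x - exp (- (real (Suc n) * x)))
     sums (1 / x - 1 / (exp x - 1))" .
  show "((\<lambda>u. - exp (- (u * x)) / x) has_real_derivative exp (- (u * x))) (at u)" for u
    using assms by (auto intro!: derivative_eq_intros)
qed (use assms in \<open>auto intro!: continuous_intros\<close>)

lemma nn_integral_rational_ceiling_defect: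
  fixes x :: real
  assumes "x > 0"
  shows "(\<integral>\<^sup>+u\<in>{0<..}. ennreal (2 * x / (x\<^sup>2 + (2 * pi * u)\<^sup>2) - 2 * x / (x\<^sup>2 + (2 * pi * of_int \<lceil>u\<rceil>)\<^sup>2)) \<partial>lborel)
           = ennreal (1 / x - 1 / (exp x - 1))"
proof (rule nn_integral_ceiling_defect[where P = "\<lambda>u. arctan (2 * pi * u / x) / pi"])
  have "(\<lambda>n. arctan (2 * pi * real n / x) / pi) \<longlonglongrightarrow> (pi / 2) / pi"
    using assms by (intro tendsto_divide tendsto_const filterlim_compose[OF tendsto_arctan_at_top]) (real_asymp, simp)
  from telescope_sums[OF this]
  have "(\<lambda>n. arctan (2 * pi * real (Suc n) / x) / pi - arctan (2 * pi * real n / x) / pi) sums (1 / 2)" by simp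
  from sums_diff[OF this sums_partial_fractions_exp[OF assms]]
  show "(\<lambda>n. arctan (2 * pi * real (Suc n) / x) / pi - arctan (2 * pi * real n / x) / pi -
          2 * x / (x\<^sup>2 + (2 * pi * real (Suc n))\<^sup>2)) sums (1 / x - 1 / (exp x - 1))" by simp
  show "((\<lambda>u. arctan (2 * pi * u / x) / pi) has_real_derivative 2 * x / (x\<^sup>2 + (2 * pi * u)\<^sup>2)) (at u)" for u
  proof -
    have "1 + (2 * pi * u / x)\<^sup>2 > 0" "x\<^sup>2 + (2 * pi * u)\<^sup>2 > 0"
      using assms by (auto simp: add_pos_nonneg)
    then have "2 * pi / x / (1 + (2 * pi * u / x)\<^sup>2) / pi = 2 * x / (x\<^sup>2 + (2 * pi * u)\<^sup>2)"
      using assms by (simp add: divide_simps) (simp add: algebra_simps power2_eq_square)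
    moreover have "((\<lambda>u. arctan (2 * pi * u / x) / pi) has_real_derivative
        2 * pi / x / (1 + (2 * pi * u / x)\<^sup>2) / pi) (at u)"
      using assms by (auto intro!: derivative_eq_intros simp: divide_inverse mult_ac)
    ultimately show ?thesis by simp
  qed
  show "2 * x / (x\<^sup>2 + (2 * pi * v)\<^sup>2) \<le> 2 * x / (x\<^sup>2 + (2 * pi * u)\<^sup>2)" if "0 < u" "u \<le> v" for u v
    using assms that by (intro divide_left_mono add_left_mono power_mono mult_left_mono) (auto intro!: add_pos_nonneg mult_pos_pos)
qed (use assms in \<open>auto intro!: continuous_intros\<close>)

lemma zeta_numer_functional_equation_real:
  assumes "0 < s" "s < 1"
  shows "Gamma (of_real s) * zeta_numer (of_real s) / (1 - of_real s) =
         of_real ((2 * pi) powr (s - 1) * pi / cos (pi * s / 2)) * zeta_numer (1 - of_real s) / of_real s"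
proof -
  define \<phi> where "\<phi> = (\<lambda>s. Re (zeta_numer (of_real s) / (1 - of_real s)))"
  define A where "A = (2 * pi) powr (s - 1) * pi / cos (pi * s / 2)"
  have cos: "cos (pi * s / 2) > 0" using assms by (intro cos_gt_zero) auto
  then have A: "A \<ge> 0" by (simp add: A_def)
  have "ennreal (Gamma s) * ennreal (\<phi> s) =
    (\<integral>\<^sup>+x\<in>{0<..}. ennreal (x powr (s - 1)) * ennreal (1 / x - 1 / (exp x - 1)) \<partial>lborel)"
  proof (rule mellin_ceiling_defect[symmetric, where h = "\<lambda>u x. exp (- (u * x))" and r = s])
    show "(\<integral>\<^sup>+x\<in>{0<..}. ennreal (x powr (s - 1) * exp (- (u * x))) \<partial>lborel) = ennreal (Gamma s * u powr (- s))"
      if "0 < u" for u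
    proof -
      have "(\<integral>\<^sup>+x\<in>{0<..}. ennreal (x powr (s - 1) * exp (- (u * x))) \<partial>lborel) =
            (\<integral>\<^sup>+x\<in>{0<..}. ennreal (1 * x powr (1 * s - 1) * exp (- (u * x powr 1))) \<partial>lborel)"
        by (intro nn_integral_cong) (auto simp: indicator_def)
      then show ?thesis using nn_integral_Gamma_powr[of 1 s u] assms that by simp
    qed
  qed (use assms nn_integral_powr_ceiling_defect nn_integral_exp_ceiling_defect in
        \<open>auto simp: \<phi>_def intro!: mult_right_mono\<close>)
  moreover have "ennreal A * ennreal (\<phi> (1 - s)) =
    (\<integral>\<^sup>+x\<in>{0<..}. ennreal (x powr (s - 1)) * ennreal (1 / x - 1 / (exp x - 1)) \<partial>lborel)"
  proof (rule mellin_ceiling_defect[symmetric, where h = "\<lambda>u x. 2 * x / (x\<^sup>2 + (2 * pi * u)\<^sup>2)" and r = "1 - s"])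
    show "(\<integral>\<^sup>+x\<in>{0<..}. ennreal (x powr (s - 1) * (2 * x / (x\<^sup>2 + (2 * pi * u)\<^sup>2))) \<partial>lborel) =
            ennreal (A * u powr (- (1 - s)))" if "0 < u" for u
      using nn_integral_powr_rational[of s "2 * pi * u"] assms that
      by (simp add: A_def powr_mult mult_ac)
    show "2 * x / (x\<^sup>2 + (2 * pi * v)\<^sup>2) \<le> 2 * x / (x\<^sup>2 + (2 * pi * u)\<^sup>2)" if "0 < u" "u \<le> v" "0 < x" for u v x :: real
      using that by (intro divide_left_mono add_left_mono power_mono mult_left_mono) (auto intro!: add_pos_nonneg mult_pos_pos)
    show "(\<integral>\<^sup>+u\<in>{0<..}. ennreal (u powr (- (1 - s)) - of_int \<lceil>u\<rceil> powr (- (1 - s))) \<partial>lborel) = ennreal (\<phi> (1 - s))"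
      unfolding \<phi>_def using assms by (intro nn_integral_powr_ceiling_defect) auto
  qed (use assms A nn_integral_rational_ceiling_defect in auto)
  ultimately have eq: "ennreal (Gamma s * \<phi> s) = ennreal (A * \<phi> (1 - s))"
    using A assms by (simp add: ennreal_mult')
  have nonneg: "\<phi> r \<ge> 0" if "0 < r" "r < 1" for r
    unfolding \<phi>_def by (rule nn_integral_powr_ceiling_defect(2)[OF that])
  have "Gamma s * \<phi> s = A * \<phi> (1 - s)"
    using eq A assms nonneg[of s] nonneg[of "1 - s"] by (subst (asm) ennreal_inj) auto
  then have "complex_of_real (Gamma s) * of_real (\<phi> s) = of_real A * of_real (\<phi> (1 - s))"
    by (simp flip: of_real_mult)
  then show ?thesis
    using zeta_numer_real_sums(2)[OF assms] zeta_numer_real_sums(2)[of "1 - s"] assms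
    by (simp add: \<phi>_def A_def Gamma_complex_of_real)
qed

section \<open>Analytic continuation\<close>

text \<open>
  The right-hand side of the functional equation, with \<open>sin(\<pi>s/2)/s\<close> written as
  \<open>(\<pi>/2) / (\<Gamma>(1+s/2) \<Gamma>(1-s/2))\<close> so that there is no exceptional point at \<open>s = 0\<close>.
\<close>
definition zeta_reflected :: "complex \<Rightarrow> complex" where
  "zeta_reflected s = - of_real pi * (2 * of_real pi) powr (s - 1) * rGamma (1 + s / 2) * rGamma (1 - s / 2)
                        * Gamma (1 - s) * zeta_numer (1 - s)"

lemma zeta_reflected_eq:
  assumes "s \<noteq> 0"
  shows "zeta_reflected s =
    - 2 * (2 * of_real pi) powr (s - 1) * sin (of_real pi * s / 2) * Gamma (1 - s) * zeta_numer (1 - s) / s"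
proof -
  have "rGamma (s / 2) = s / 2 * rGamma (1 + s / 2)"
    using rGamma_plus1[of "s / 2"] by (simp add: add_ac)
  moreover have "sin (of_real pi * s / 2) = of_real pi * (rGamma (s / 2) * rGamma (1 - s / 2))"
    using rGamma_reflection_complex[of "s / 2"] by simp
  ultimately have S: "sin (of_real pi * s / 2) = of_real pi * (s / 2) * rGamma (1 + s / 2) * rGamma (1 - s / 2)"
    by (simp only: mult.assoc)
  show ?thesis unfolding zeta_reflected_def S using assms by simp
qed

lemma holomorphic_zeta_reflected: "zeta_reflected holomorphic_on {s. Re s < 1}"
proof -
  have n: "1 - z \<notin> \<int>\<^sub>\<le>\<^sub>0" if "Re z < 1" for z
    using nonpos_Ints_complexD(1)[of "1 - z"] that by auto
  have "zeta_numer \<circ> (\<lambda>s. 1 - s) holomorphic_on {s. Re s < 1}"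
    by (intro holomorphic_on_compose holomorphic_intros holomorphic_on_subset[OF holomorphic_zeta_numer]) auto
  moreover have "Gamma \<circ> (\<lambda>s. 1 - s) holomorphic_on {s. Re s < 1}"
    by (intro holomorphic_on_compose holomorphic_intros) (auto simp: n)
  ultimately show ?thesis
    unfolding zeta_reflected_def o_def by (intro holomorphic_intros) (auto simp: n)
qed

text \<open>
  The real functional equation extends from the interval to the strip by the identity theorem.
\<close>
lemma zeta_numer_eq_reflected:
  assumes "0 < Re s" "Re s < 1"
  shows "zeta_numer s / (s - 1) = zeta_reflected s"
proof -
  define S where "S = {s. 0 < Re s \<and> Re s < 1}"
  define f where "f = (\<lambda>s. zeta_numer s / (s - 1) - zeta_reflected s)"
  have "S = {s. Re s > 0} \<inter> {s. Re s < 1}" by (auto simp: S_def)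
  then have S: "open S" "connected S"
    by (auto intro!: open_Int open_halfspace_Re_gt open_halfspace_Re_lt convex_connected convex_Int
        convex_halfspace_Re_gt convex_halfspace_Re_lt)
  have "f s = 0"
  proof -
    let ?U = "of_real ` {0<..<1::real} :: complex set"
    show ?thesis
  proof (rule analytic_continuation[of f S ?U "1 / 2" s, OF _ S])
    show "f holomorphic_on S"
      unfolding f_def S_def
      by (intro holomorphic_intros holomorphic_on_subset[OF holomorphic_zeta_numer]
          holomorphic_on_subset[OF holomorphic_zeta_reflected]) auto
    show "?U \<subseteq> S" by (auto simp: S_def)
    show "(1 / 2 :: complex) islimpt ?U"
    proof -
      have "(1 / 2 :: real) islimpt {0<..<1}" by (rule open_imp_islimpt) auto
      then have "(of_real (1 / 2) :: complex) islimpt ?U"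
      proof (rule islimpt_isCont_image)
        show "\<forall>\<^sub>F y in at (1 / 2). complex_of_real y \<noteq> of_real (1 / 2)"
          by (simp only: of_real_eq_iff) (simp add: eventually_at_filter)
      qed auto
      then show ?thesis by simp
    qed
    show "(1 / 2 :: complex) \<in> S" "s \<in> S" using assms by (auto simp: S_def)
    show "f z = 0" if "z \<in> ?U" for z
    proof -
      from that obtain x where x: "z = of_real x" "0 < x" "x < 1" by auto
      define c where "c = cos (pi * x / 2)"
      have c: "c > 0" unfolding c_def using x by (intro cos_gt_zero) auto
      have sx: "sin (pi * x / 2) > 0" using x by (intro sin_gt_zero) auto
      have g: "Gamma z * Gamma (1 - z) = of_real (pi / (2 * sin (pi * x / 2) * c))"
      proof -
        have "Gamma z * Gamma (1 - z) = of_real (pi / sin (pi * x))"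
          using Gamma_reflection_complex[of z] x by (simp flip: sin_of_real)
        also have "sin (pi * x) = 2 * sin (pi * x / 2) * c"
          using sin_double[of "pi * x / 2"] by (simp add: c_def)
        finally show ?thesis .
      qed
      have p: "(2 * of_real pi) powr (z - 1) = (of_real ((2 * pi) powr (x - 1)) :: complex)"
        using powr_of_real[of "2 * pi" "x - 1"] x by simp
      have Gz: "Gamma z \<noteq> 0"
        using x by (auto simp: Gamma_eq_zero_iff dest: nonpos_Ints_complexD(1))
      have "zeta_reflected z = - 2 * of_real ((2 * pi) powr (x - 1)) * of_real (sin (pi * x / 2)) *
          (Gamma z * Gamma (1 - z)) * zeta_numer (1 - z) / z / Gamma z"
      proof -
        have "z \<noteq> 0" using x by simp
        moreover have "sin (of_real pi * z / 2) = of_real (sin (pi * x / 2))"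
          using x by (simp flip: sin_of_real)
        ultimately show ?thesis using Gz by (simp add: zeta_reflected_eq p)
      qed
      also have "\<dots> = - (of_real ((2 * pi) powr (x - 1) * pi / c) * zeta_numer (1 - z) / z) / Gamma z"
        unfolding g using c sx by (simp add: field_simps)
      also have "of_real ((2 * pi) powr (x - 1) * pi / c) * zeta_numer (1 - z) / z = Gamma z * zeta_numer z / (1 - z)"
        unfolding c_def x(1) by (rule zeta_numer_functional_equation_real[symmetric]) (use x in auto)
      also have "- (Gamma z * zeta_numer z / (1 - z)) / Gamma z = zeta_numer z / (z - 1)"
        using Gz minus_divide_right[of "zeta_numer z" "1 - z"] by simp
      finally show "f z = 0" by (simp add: f_def)
    qed
  qed
  qed
  then show ?thesis by (simp add: f_def)
qed

lemma zeta_conditions_unique: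
  assumes "f holomorphic_on -{1}" "f 1 = 0" "\<And>s. Re s > 1 \<Longrightarrow> f s = (\<Sum>n. 1 / of_nat (Suc n) powr s)"
    and "g holomorphic_on -{1}" "g 1 = 0" "\<And>s. Re s > 1 \<Longrightarrow> g s = (\<Sum>n. 1 / of_nat (Suc n) powr s)"
  shows "f = g"
proof
  fix z
  show "f z = g z"
  proof (cases "z = 1")
    case False
    show ?thesis
    proof (rule analytic_continuation_open[of "{s. Re s > 1}" "-{1}" f g])
      show "open {s. Re s > 1}" by (rule open_halfspace_Re_gt)
      show "connected (- {1::complex})" by (rule connected_punctured_universe) auto
      have "(2::complex) \<in> {s. Re s > 1}" by simp
      then show "{s. Re s > 1} \<noteq> {}" by blast
    qed (use assms False in auto)
  qed (use assms in auto)
qed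

text \<open>
  The two half-plane formulas agree on the strip where both are valid, so gluing them gives the
  function that the definition of \<^const>\<open>zeta\<close> describes.
\<close>
lemma zeta_conditions:
  "zeta holomorphic_on -{1}" "zeta 1 = 0" "\<And>s. Re s > 1 \<Longrightarrow> zeta s = (\<Sum>n. 1 / of_nat (Suc n) powr s)"
  and zeta_eq: "\<And>s. Re s > 0 \<Longrightarrow> zeta s = zeta_numer s / (s - 1)"
  and zeta_eq_reflected: "\<And>s. Re s < 1 \<Longrightarrow> zeta s = zeta_reflected s"
proof -
  define A where "A = {s. Re s > 0} - {1}"
  define f where "f = (\<lambda>s. if s \<in> A then zeta_numer s / (s - 1) else zeta_reflected s)"
  define h where "h = (\<lambda>s. if s = 1 then 0 else f s)"
  have "f holomorphic_on A \<union> {s. Re s < 1}"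
    unfolding f_def
  proof (rule holomorphic_on_If_Un)
    show "(\<lambda>s. zeta_numer s / (s - 1)) holomorphic_on A"
      unfolding A_def by (intro holomorphic_intros holomorphic_on_subset[OF holomorphic_zeta_numer]) auto
    show "open A" unfolding A_def by (intro open_Diff open_halfspace_Re_gt closed_singleton)
  qed (auto simp: A_def zeta_numer_eq_reflected holomorphic_zeta_reflected open_halfspace_Re_lt)
  also have "A \<union> {s. Re s < 1} = -{1}" by (auto simp: A_def)
  finally have "h holomorphic_on -{1}"
    by (rule holomorphic_transform) (auto simp: h_def)
  moreover have "h 1 = 0" by (simp add: h_def)
  moreover have "h s = (\<Sum>n. 1 / of_nat (Suc n) powr s)" if "Re s > 1" for s
  proof -
    have "s \<noteq> 1" "Re s > 0" using that by auto
    then have "h s = zeta_numer s / (s - 1)" by (simp add: h_def f_def A_def)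
    also have "\<dots> = (\<Sum>n. of_nat (Suc n) powr (- s))"
      using zeta_numer_dirichlet[OF that] \<open>s \<noteq> 1\<close> by simp
    finally show ?thesis by (simp add: powr_minus_divide)
  qed
  ultimately have h: "h holomorphic_on -{1}" "h 1 = 0" "\<And>s. Re s > 1 \<Longrightarrow> h s = (\<Sum>n. 1 / of_nat (Suc n) powr s)"
    by blast+
  have "zeta = h"
    unfolding zeta_def using h zeta_conditions_unique[of _ h] by (intro the_equality) blast+
  with h show "zeta holomorphic_on -{1}" "zeta 1 = 0" "\<And>s. Re s > 1 \<Longrightarrow> zeta s = (\<Sum>n. 1 / of_nat (Suc n) powr s)"
    by blast+
  show "zeta s = zeta_numer s / (s - 1)" if "Re s > 0" for s
    unfolding \<open>zeta = h\<close> h_def f_def A_def using that by auto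
  show "zeta s = zeta_reflected s" if "Re s < 1" for s
    unfolding \<open>zeta = h\<close> h_def f_def A_def using that zeta_numer_eq_reflected[of s] by auto
qed

lemma zeta_functional_equation:
  assumes "Re s > 0" "s \<noteq> 1"
  shows "zeta (1 - s) = 2 * (2 * of_real pi) powr (- s) * cos (of_real pi * s / 2) * Gamma s * zeta s"
proof -
  have "of_real pi * (1 - s) / 2 = of_real pi / 2 - of_real pi * s / 2"
    by (simp add: algebra_simps diff_divide_distrib)
  then have "sin (of_real pi * (1 - s) / 2) = cos (of_real pi * s / 2)"
    by (simp only: sin_diff) simp
  moreover have "zeta s = - zeta_numer s / (1 - s)"
    using assms minus_divide_right[of "zeta_numer s" "1 - s"] by (simp add: zeta_eq)
  ultimately show ?thesis
    using assms by (simp add: zeta_eq_reflected zeta_reflected_eq)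
qed

text \<open>
  At \<open>0\<close> the functional equation refers to the pole at \<open>1\<close>; its regularised form
  \<^const>\<open>zeta_reflected\<close> expresses the value through the residue there, \<open>zeta_numer 1 = 1\<close>.
\<close>
lemma zeta_0: "zeta 0 = - 1 / 2"
proof -
  have "zeta 0 = - of_real pi * (2 * of_real pi) powr (- 1) * (rGamma 1 * rGamma 1 * Gamma 1 * zeta_numer 1)"
    by (simp add: zeta_eq_reflected zeta_reflected_def)
  also have "\<dots> = - of_real pi * (2 * of_real pi) powr (- 1)" by (simp add: zeta_numer_1)
  also have "(2 * of_real pi :: complex) powr (- 1) = inverse (2 * of_real pi)" by (simp add: powr_minus)
  finally show ?thesis by simp
qed

text \<open>
  To the right of \<open>1/2\<close> the defining series gives linear growth.  To the left the functional equation
  applies, where the growth of the cosine and the decay of \<open>\<Gamma>\<close> cancel.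
\<close>
lemma strip_growth_zeta: "strip_growth a b 0 zeta"
proof -
  define M where "M = (\<Sum>n. real (Suc n) powr (- 3/2))"
  have M0: "M \<ge> 0" unfolding M_def by (intro suminf_nonneg summable_Suc_powr) auto
  have right: "strip_growth (1/2) c 0 zeta" for c
  proof (rule strip_growthI[where C = "1 + (\<bar>c\<bar> + 1) * \<bar>M\<bar>" and N = 1])
    fix s assume s: "1 / 2 \<le> Re s" "Re s \<le> c" "1 \<le> \<bar>Im s\<bar>"
    have ge: "1 \<le> norm (s - 1)" using s abs_Im_le_cmod[of "s - 1"] by simp
    have "norm (zeta s) = norm (zeta_numer s) / norm (s - 1)"
      using s by (simp add: zeta_eq norm_divide)
    also have "\<dots> \<le> (1 + norm (s - 1) * norm s * M) / norm (s - 1)"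
      using norm_zeta_numer_le[OF s(1)] ge unfolding M_def by (intro divide_right_mono) auto
    also have "\<dots> = 1 / norm (s - 1) + norm s * M"
      using ge by (subst add_divide_distrib) auto
    also have "\<dots> \<le> \<bar>Im s\<bar> + ((\<bar>c\<bar> + 1) * \<bar>Im s\<bar>) * \<bar>M\<bar>"
    proof (intro add_mono mult_mono)
      have "1 / norm (s - 1) \<le> 1" using ge by (intro divide_le_eq_1_pos[THEN iffD2]) auto
      then show "1 / norm (s - 1) \<le> \<bar>Im s\<bar>" using s(3) by linarith
      have "norm s \<le> \<bar>Re s\<bar> + \<bar>Im s\<bar>" by (rule cmod_le)
      also have "\<dots> \<le> \<bar>c\<bar> * 1 + \<bar>Im s\<bar>" using s by simp
      also have "\<dots> \<le> \<bar>c\<bar> * \<bar>Im s\<bar> + \<bar>Im s\<bar>" using s by (intro add_mono mult_left_mono) auto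
      finally show "norm s \<le> (\<bar>c\<bar> + 1) * \<bar>Im s\<bar>" by (simp add: algebra_simps)
    qed (auto simp: M0)
    finally show "norm (zeta s) \<le> (1 + (\<bar>c\<bar> + 1) * \<bar>M\<bar>) * \<bar>Im s\<bar> ^ 1 * exp (0 * \<bar>Im s\<bar>)"
      by (simp add: algebra_simps)
  qed
  have left: "strip_growth c (1/2) 0 zeta" for c
  proof -
    have p: "strip_growth (1/2) (1 - c) 0 (\<lambda>s. 2 * (2 * of_real pi) powr (- s))"
      using strip_growth_mult[OF strip_growth_bounded[of _ _ "\<lambda>_. 2" 2] strip_growth_powr[of "2 * pi" _ _ "-1" 0]] by simp
    have "strip_growth (1/2) (1 - c) (0 + pi / 2 + - (pi / 2) + 0)
            (\<lambda>s. 2 * (2 * of_real pi) powr (- s) * cos (of_real pi * s / 2) * Gamma s * zeta s)"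
      by (intro strip_growth_mult p strip_growth_cos strip_growth_Gamma right)
    then have "strip_growth c (1/2) 0
            (\<lambda>s. 2 * (2 * of_real pi) powr (- (1 - s)) * cos (of_real pi * (1 - s) / 2) * Gamma (1 - s) * zeta (1 - s))"
      by (intro strip_growth_compose[where g = "\<lambda>s. 1 - s"]) auto
    then obtain C N where "\<And>s. c \<le> Re s \<Longrightarrow> Re s \<le> 1/2 \<Longrightarrow> 1 \<le> \<bar>Im s\<bar> \<Longrightarrow>
       norm (2 * (2 * of_real pi) powr (- (1 - s)) * cos (of_real pi * (1 - s) / 2) * Gamma (1 - s) * zeta (1 - s))
         \<le> C * \<bar>Im s\<bar> ^ N * exp (0 * \<bar>Im s\<bar>)"
      using strip_growthE by blast
    then show ?thesis
    proof (intro strip_growthI[of _ _ _ C N])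
      fix s assume s: "c \<le> Re s" "Re s \<le> 1/2" "1 \<le> \<bar>Im s\<bar>"
      assume *: "\<And>s. c \<le> Re s \<Longrightarrow> Re s \<le> 1/2 \<Longrightarrow> 1 \<le> \<bar>Im s\<bar> \<Longrightarrow>
       norm (2 * (2 * of_real pi) powr (- (1 - s)) * cos (of_real pi * (1 - s) / 2) * Gamma (1 - s) * zeta (1 - s))
         \<le> C * \<bar>Im s\<bar> ^ N * exp (0 * \<bar>Im s\<bar>)"
      have "zeta s = 2 * (2 * of_real pi) powr (- (1 - s)) * cos (of_real pi * (1 - s) / 2) * Gamma (1 - s) * zeta (1 - s)"
      proof -
        have "s \<noteq> 0" using s by auto
        then show ?thesis using zeta_functional_equation[of "1 - s"] s by simp
      qed
      then show "norm (zeta s) \<le> C * \<bar>Im s\<bar> ^ N * exp (0 * \<bar>Im s\<bar>)" using *[OF s] by simp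
    qed
  qed
  show ?thesis by (rule strip_growth_Un[OF left[of a] right[of b]])
qed

section \<open>Integrals along vertical lines\<close>

text \<open>
  With \<open>s = c + it\<close> this is \<open>1/(2\<pi>i)\<close> times the contour integral of \<open>f\<close> upwards along \<open>Re s = c\<close>.
\<close>
definition vertical_integral :: "(complex \<Rightarrow> complex) \<Rightarrow> real \<Rightarrow> complex" where
  "vertical_integral f c = 1 / (2 * of_real pi) * (LBINT t. f (Complex c t))"

lemma integrable_vertical_line:
  fixes f :: "complex \<Rightarrow> complex"
  assumes cont: "continuous_on {s. Re s = c} f"
    and bound: "\<And>t. 1 \<le> \<bar>t\<bar> \<Longrightarrow> norm (f (Complex c t)) \<le> C / (1 + t\<^sup>2)"
  shows "integrable lborel (\<lambda>t. f (Complex c t))"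
proof -
  have cont': "continuous_on A (\<lambda>t. f (Complex c t))" for A
    by (rule continuous_on_compose2[OF cont]) (auto simp: Complex_eq intro!: continuous_intros)
  have "bounded ((\<lambda>t. f (Complex c t)) ` {-1..1})"
    by (intro compact_imp_bounded compact_continuous_image cont') auto
  then obtain B where B: "\<forall>t\<in>{-1..1}. norm (f (Complex c t)) \<le> B"
    unfolding bounded_iff by auto
  define K where "K = 2 * \<bar>B\<bar> + \<bar>C\<bar>"
  have int: "integrable lborel (\<lambda>t::real. K * inverse (1 + t\<^sup>2))"
    using integrable_inverse_1_plus_square unfolding set_integrable_def
    by (intro integrable_mult_right) simp
  show ?thesis
  proof (rule Bochner_Integration.integrable_bound[OF int])
    show "(\<lambda>t. f (Complex c t)) \<in> borel_measurable lborel"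
      using borel_measurable_continuous_onI[OF cont'] by simp
    show "AE t in lborel. norm (f (Complex c t)) \<le> norm (K * inverse (1 + t\<^sup>2))"
    proof (intro always_eventually allI)
      fix t :: real
      have pos: "0 < 1 + t\<^sup>2" by (simp add: add_pos_nonneg)
      have "norm (f (Complex c t)) \<le> K / (1 + t\<^sup>2)"
      proof (cases "1 \<le> \<bar>t\<bar>")
        case True
        have "C / (1 + t\<^sup>2) \<le> K / (1 + t\<^sup>2)"
          using pos by (intro divide_right_mono) (auto simp: K_def)
        with bound[OF True] show ?thesis by linarith
      next
        case False
        then have "t \<in> {-1..1}" by (simp add: abs_le_iff) linarith
        then have "norm (f (Complex c t)) \<le> B" using B by blast
        moreover have "t\<^sup>2 \<le> 1" using False by (simp add: abs_square_le_1)
        then have "B * (1 + t\<^sup>2) \<le> \<bar>B\<bar> * 2"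
          using pos by (intro mult_mono) auto
        then have "B * (1 + t\<^sup>2) \<le> K" by (simp add: K_def)
        then have "B \<le> K / (1 + t\<^sup>2)" using pos by (simp add: pos_le_divide_eq)
        ultimately show ?thesis by linarith
      qed
      then show "norm (f (Complex c t)) \<le> norm (K * inverse (1 + t\<^sup>2))"
        by (simp add: divide_inverse)
    qed
  qed
qed

lemma integral_symmetric_interval_LIMSEQ:
  fixes g :: "real \<Rightarrow> complex"
  assumes g: "integrable lborel g"
  shows "(\<lambda>n. integral {- real (Suc n)..real (Suc n)} g) \<longlonglongrightarrow> (LBINT t. g t)"
proof -
  have [measurable]: "g \<in> borel_measurable borel" using borel_measurable_integrable[OF g] by simp
  have "(\<lambda>n. LBINT t. indicator {- real (Suc n)..real (Suc n)} t *\<^sub>R g t) \<longlonglongrightarrow> (LBINT t. g t)"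
  proof (rule integral_dominated_convergence)
    show "integrable lborel (\<lambda>t. norm (g t))" using g by simp
    show "AE t in lborel. (\<lambda>n. indicator {- real (Suc n)..real (Suc n)} t *\<^sub>R g t) \<longlonglongrightarrow> g t"
    proof (intro always_eventually allI)
      fix t :: real
      obtain N where N: "\<bar>t\<bar> \<le> real N" using real_arch_simple by blast
      show "(\<lambda>n. indicator {- real (Suc n)..real (Suc n)} t *\<^sub>R g t) \<longlonglongrightarrow> g t"
        by (rule tendsto_eventually, rule eventually_sequentiallyI[of N]) (use N in \<open>auto simp: indicator_def\<close>)
    qed
  qed (auto simp: indicator_def)
  moreover have "(LBINT t. indicator {- real (Suc n)..real (Suc n)} t *\<^sub>R g t) =
                 integral {- real (Suc n)..real (Suc n)} g" for n
  proof -
    have "set_integrable lborel {- real (Suc n)..real (Suc n)} g"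
      unfolding set_integrable_def by (rule integrable_mult_indicator[OF _ g]) auto
    from set_borel_integral_eq_integral(2)[OF this] show ?thesis
      by (simp add: set_lebesgue_integral_def)
  qed
  ultimately show ?thesis by simp
qed

text \<open>
  The residue theorem on the rectangles \<open>[a,b] \<times> [-R,R]\<close>: the horizontal sides vanish as \<open>R\<close> grows.
  With no poles it says that the integral does not depend on the line.
\<close>
lemma vertical_integral_diff_residues:
  fixes a b a' b' C :: real
  assumes ab: "a' < a" "a < b" "b < b'"
    and pts: "finite pts" "\<And>p. p \<in> pts \<Longrightarrow> a < Re p \<and> Re p < b \<and> Im p = 0"
    and holo: "f holomorphic_on {s. a' < Re s \<and> Re s < b'} - pts"
    and bound: "\<And>s. a \<le> Re s \<Longrightarrow> Re s \<le> b \<Longrightarrow> 1 \<le> \<bar>Im s\<bar> \<Longrightarrow> norm (f s) \<le> C / (1 + (Im s)\<^sup>2)"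
  shows "vertical_integral f b - vertical_integral f a = (\<Sum>p\<in>pts. residue f p)"
proof -
  define S where "S = {s. a' < Re s \<and> Re s < b'}"
  have "S = {s. Re s > a'} \<inter> {s. Re s < b'}" by (auto simp: S_def)
  then have S: "open S" "connected S" "convex S"
    by (auto intro!: open_Int open_halfspace_Re_gt open_halfspace_Re_lt convex_connected convex_Int
        convex_halfspace_Re_gt convex_halfspace_Re_lt)
  have cont: "continuous_on A f" if "A \<subseteq> S - pts" for A
    using holomorphic_on_imp_continuous_on[OF holomorphic_on_subset[OF holo]] that by (auto simp: S_def)
  have integrable: "integrable lborel (\<lambda>t. f (Complex c t))" if c: "c = a \<or> c = b" for c
  proof (rule integrable_vertical_line)
    show "continuous_on {s. Re s = c} f"
      by (rule cont) (use c ab pts(2) in \<open>fastforce simp: S_def\<close>)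
    show "norm (f (Complex c t)) \<le> C / (1 + t\<^sup>2)" if "1 \<le> \<bar>t\<bar>" for t
      using bound[of "Complex c t"] that c ab by auto
  qed
  define \<Sigma> where "\<Sigma> = (\<Sum>p\<in>pts. residue f p)"
  define V where "V = (\<lambda>c n. integral {- real (Suc n)..real (Suc n)} (\<lambda>t. f (Complex c t)))"
  \<comment> \<open>The left-hand side is the contribution of the two horizontal sides.\<close>
  have est: "norm (V b n - V a n - 2 * of_real pi * \<Sigma>) \<le> 2 * (b - a) * \<bar>C\<bar> / (1 + (real (Suc n))\<^sup>2)" for n
  proof -
    define R where "R = real (Suc n)"
    have R: "R \<ge> 1" by (simp add: R_def)
    define a1 a2 a3 a4 where "a1 = Complex a (-R)" and "a2 = Complex b (-R)"
      and "a3 = Complex b R" and "a4 = Complex a R"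
    note adefs = a1_def a2_def a3_def a4_def
    have g: "rectpath a1 a3 = linepath a1 a2 +++ linepath a2 a3 +++ linepath a3 a4 +++ linepath a4 a1"
      by (simp add: rectpath_def Let_def adefs)
    have cbox: "path_image (rectpath a1 a3) \<subseteq> cbox a1 a3"
      using ab R by (intro path_image_rectpath_subset_cbox) (auto simp: adefs)
    have cboxS: "cbox a1 a3 \<subseteq> S"
      using ab by (auto simp: S_def in_cbox_complex_iff adefs)
    have avoid: "path_image (rectpath a1 a3) \<subseteq> S - pts"
    proof -
      have "path_image (rectpath a1 a3) \<inter> pts = {}"
        using pts(2) ab R by (subst path_image_rectpath) (fastforce simp: adefs)+
      with cbox cboxS show ?thesis by blast
    qed
    have "contour_integral (rectpath a1 a3) f =
        2 * pi * \<i> * (\<Sum>p\<in>pts. winding_number (rectpath a1 a3) p * residue f p)"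
    proof (rule Residue_theorem[OF S(1,2) pts(1) holo[folded S_def] _ _ avoid])
      show "\<forall>z. z \<notin> S \<longrightarrow> winding_number (rectpath a1 a3) z = 0"
        using cbox cboxS by (auto intro!: winding_number_zero_outside[where s = "cbox a1 a3"])
    qed auto
    also have "(\<Sum>p\<in>pts. winding_number (rectpath a1 a3) p * residue f p) = \<Sigma>"
      unfolding \<Sigma>_def
    proof (intro sum.cong refl)
      fix p assume "p \<in> pts"
      then have "p \<in> box a1 a3" using pts(2)[of p] R by (auto simp: in_box_complex_iff adefs)
      then show "winding_number (rectpath a1 a3) p * residue f p = residue f p"
        by (simp add: winding_number_rectpath)
    qed
    finally have total: "contour_integral (rectpath a1 a3) f = 2 * pi * \<i> * \<Sigma>" .
    have segs: "closed_segment a1 a2 \<subseteq> S - pts" "closed_segment a2 a3 \<subseteq> S - pts"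
               "closed_segment a3 a4 \<subseteq> S - pts" "closed_segment a4 a1 \<subseteq> S - pts"
      using avoid by (auto simp: g path_image_join)
    note ints = segs[THEN cont, THEN contour_integrable_continuous_linepath]
    have split: "contour_integral (rectpath a1 a3) f = contour_integral (linepath a1 a2) f +
        (contour_integral (linepath a2 a3) f + (contour_integral (linepath a3 a4) f + contour_integral (linepath a4 a1) f))"
      unfolding g using ints by (simp add: contour_integrable_join)
    have right: "contour_integral (linepath a2 a3) f = \<i> * V b n"
      unfolding V_def R_def[symmetric] using R by (intro contour_integral_linepath_same_Re) (auto simp: adefs)
    have "contour_integral (linepath a4 a1) f = - contour_integral (linepath a1 a4) f"
      using cont[OF segs(4)] by (metis contour_integral_reverse_linepath closed_segment_commute)
    also have "contour_integral (linepath a1 a4) f = \<i> * V a n"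
      unfolding V_def R_def[symmetric] using R by (intro contour_integral_linepath_same_Re) (auto simp: adefs)
    finally have left: "contour_integral (linepath a4 a1) f = - (\<i> * V a n)" .
    have b12: "norm (contour_integral (linepath a1 a2) f) \<le> \<bar>C\<bar> / (1 + R\<^sup>2) * norm (a2 - a1)"
    proof (rule contour_integral_bound_linepath[OF ints(1)])
      fix x assume "x \<in> closed_segment a1 a2"
      then have x: "a \<le> Re x" "Re x \<le> b" "Im x = - R"
        using ab by (auto simp: adefs closed_segment_same_Im closed_segment_eq_real_ivl)
      have "norm (f x) \<le> C / (1 + R\<^sup>2)" using bound[of x] x R by simp
      also have "\<dots> \<le> \<bar>C\<bar> / (1 + R\<^sup>2)" by (intro divide_right_mono) (auto simp: add_nonneg_nonneg)
      finally show "norm (f x) \<le> \<bar>C\<bar> / (1 + R\<^sup>2)" .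
    qed (auto simp: add_nonneg_nonneg)
    have b34: "norm (contour_integral (linepath a3 a4) f) \<le> \<bar>C\<bar> / (1 + R\<^sup>2) * norm (a4 - a3)"
    proof (rule contour_integral_bound_linepath[OF ints(3)])
      fix x assume "x \<in> closed_segment a3 a4"
      then have x: "a \<le> Re x" "Re x \<le> b" "Im x = R"
        using ab by (auto simp: adefs closed_segment_same_Im closed_segment_eq_real_ivl)
      have "norm (f x) \<le> C / (1 + R\<^sup>2)" using bound[of x] x R by simp
      also have "\<dots> \<le> \<bar>C\<bar> / (1 + R\<^sup>2)" by (intro divide_right_mono) (auto simp: add_nonneg_nonneg)
      finally show "norm (f x) \<le> \<bar>C\<bar> / (1 + R\<^sup>2)" .
    qed (auto simp: add_nonneg_nonneg)
    have len: "a2 - a1 = of_real (b - a)" "a4 - a3 = of_real (a - b)"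
      by (auto simp: adefs complex_eq_iff)
    have eq: "\<i> * (V b n - V a n - 2 * of_real pi * \<Sigma>) =
        - (contour_integral (linepath a1 a2) f + contour_integral (linepath a3 a4) f)"
      using total unfolding split right left by (simp add: algebra_simps)
    have "norm (V b n - V a n - 2 * of_real pi * \<Sigma>) = norm (\<i> * (V b n - V a n - 2 * of_real pi * \<Sigma>))"
      by (simp add: norm_mult)
    also have "\<dots> \<le> norm (contour_integral (linepath a1 a2) f) + norm (contour_integral (linepath a3 a4) f)"
      unfolding eq norm_minus_cancel by (rule norm_triangle_ineq)
    also have "\<dots> \<le> \<bar>C\<bar> / (1 + R\<^sup>2) * (b - a) + \<bar>C\<bar> / (1 + R\<^sup>2) * (b - a)"
      using b12 b34 ab unfolding len norm_of_real by (intro add_mono) auto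
    finally show ?thesis by (simp add: R_def algebra_simps)
  qed
  have "(\<lambda>n. V b n - V a n - 2 * of_real pi * \<Sigma>) \<longlonglongrightarrow> 0"
  proof (rule Lim_null_comparison)
    show "\<forall>\<^sub>F n in sequentially. norm (V b n - V a n - 2 * of_real pi * \<Sigma>) \<le> 2 * (b - a) * \<bar>C\<bar> / (1 + (real (Suc n))\<^sup>2)"
      using est by simp
    show "(\<lambda>n. 2 * (b - a) * \<bar>C\<bar> / (1 + (real (Suc n))\<^sup>2)) \<longlonglongrightarrow> 0" by real_asymp
  qed
  moreover have "(\<lambda>n. V b n - V a n - 2 * of_real pi * \<Sigma>) \<longlonglongrightarrow>
      (LBINT t. f (Complex b t)) - (LBINT t. f (Complex a t)) - 2 * of_real pi * \<Sigma>"
    unfolding V_def by (intro tendsto_diff tendsto_const integral_symmetric_interval_LIMSEQ integrable) auto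
  ultimately have "(LBINT t. f (Complex b t)) - (LBINT t. f (Complex a t)) - 2 * of_real pi * \<Sigma> = 0"
    using LIMSEQ_unique by blast
  then have "(LBINT t. f (Complex b t)) - (LBINT t. f (Complex a t)) = 2 * of_real pi * \<Sigma>" by simp
  then show ?thesis
    unfolding vertical_integral_def right_diff_distrib[symmetric] \<Sigma>_def by simp
qed

lemma vertical_integral_reflect:
  "vertical_integral (\<lambda>s. f (2 - s)) c = vertical_integral f (2 - c)"
proof -
  have "(LBINT t. f (Complex (2 - c) t)) = (LBINT t. f (Complex (2 - c) (- t)))"
    using lborel_integral_real_affine[of "-1" "\<lambda>t. f (Complex (2 - c) t)" 0] by simp
  moreover have "2 - Complex c t = Complex (2 - c) (- t)" for t by (simp add: complex_eq_iff)
  ultimately show ?thesis unfolding vertical_integral_def by simp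
qed

text \<open>
  Interchange of a Dirichlet series, absolutely convergent on the line, with the integral.
\<close>
lemma sums_vertical_integral:
  fixes y :: "nat \<Rightarrow> real" and b :: "nat \<Rightarrow> complex"
  assumes g: "integrable lborel (\<lambda>t. g (Complex c t))"
    and y: "\<And>j. y j > 0"
    and sm: "summable (\<lambda>j. norm (b j) * y j powr (- c))"
  shows "(\<lambda>j. b j * vertical_integral (\<lambda>w. g w * of_real (y j) powr (- w)) c) sums
           vertical_integral (\<lambda>w. g w * (\<Sum>j. b j * of_real (y j) powr (- w))) c"
proof -
  define f where "f = (\<lambda>j t. g (Complex c t) * (b j * of_real (y j) powr (- Complex c t)))"
  have nf: "norm (f j t) = norm (b j) * y j powr (- c) * norm (g (Complex c t))" for j t
    using y[of j] by (simp add: f_def norm_mult norm_powr_real_powr)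
  have [measurable]: "(\<lambda>t. g (Complex c t)) \<in> borel_measurable borel"
    using borel_measurable_integrable[OF g] by simp
  have pm [measurable]: "(\<lambda>t. of_real (y j) powr (- Complex c t) :: complex) \<in> borel_measurable borel" for j
    using y[of j] by (intro borel_measurable_continuous_onI) (auto simp: Complex_eq intro!: continuous_intros)
  have int: "integrable lborel (f j)" for j
  proof (rule Bochner_Integration.integrable_bound)
    show "integrable lborel (\<lambda>t. norm (b j) * y j powr (- c) * norm (g (Complex c t)))"
      using g by (intro integrable_mult_right integrable_norm)
    show "f j \<in> borel_measurable lborel" unfolding f_def by measurable
  qed (auto simp: nf abs_mult)
  have sm_pt: "summable (\<lambda>j. norm (f j t))" for t
    unfolding nf by (rule summable_mult2[OF sm])
  have "(\<lambda>j. LBINT t. f j t) sums (LBINT t. (\<Sum>j. f j t))"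
  proof (rule sums_integral[OF int])
    show "summable (\<lambda>j. LBINT t. norm (f j t))"
      unfolding nf by (simp add: summable_mult2[OF sm])
  qed (use sm_pt in auto)
  then have "(\<lambda>j. 1 / (2 * of_real pi) * (LBINT t. f j t)) sums (1 / (2 * of_real pi) * (LBINT t. (\<Sum>j. f j t)))"
    by (rule sums_mult)
  moreover have "b j * vertical_integral (\<lambda>w. g w * of_real (y j) powr (- w)) c = 1 / (2 * of_real pi) * (LBINT t. f j t)" for j
  proof -
    have "f j = (\<lambda>t. b j * (g (Complex c t) * of_real (y j) powr (- Complex c t)))"
      by (simp add: f_def mult_ac fun_eq_iff)
    then show ?thesis by (simp add: vertical_integral_def)
  qed
  moreover have "(\<Sum>j. f j t) = g (Complex c t) * (\<Sum>j. b j * of_real (y j) powr (- Complex c t))" for t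
  proof (cases "g (Complex c t) = 0")
    case False
    have "summable (f_pt)" if "f_pt = (\<lambda>j. b j * of_real (y j) powr (- Complex c t))" for f_pt
    proof (rule summable_norm_cancel)
      show "summable (\<lambda>j. norm (f_pt j))"
        unfolding that using sm y by (simp add: norm_mult norm_powr_real_powr less_imp_le)
    qed
    then show ?thesis unfolding f_def by (subst suminf_mult) auto
  qed (simp add: f_def)
  ultimately show ?thesis unfolding vertical_integral_def by simp
qed

section \<open>The Meijer function as an inverse Mellin transform\<close>

definition mellin_kernel :: "nat \<Rightarrow> complex \<Rightarrow> complex" where
  "mellin_kernel k w = (Gamma w * 2 powr (- w)) ^ k * cos (of_real pi * w / 2) ^ (k - 1)"

lemma holomorphic_mellin_kernel: "mellin_kernel k holomorphic_on {w. Re w > 0}"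
proof -
  have n: "w \<notin> \<int>\<^sub>\<le>\<^sub>0" if "Re w > 0" for w
    using nonpos_Ints_complexD(1)[of w] that by auto
  show ?thesis
    unfolding mellin_kernel_def by (intro holomorphic_intros) (auto simp: n)
qed

text \<open>
  The rates add up to \<open>-k\<pi>/2 + (k-1)\<pi>/2\<close>: one factor \<open>\<Gamma>\<close> is left over to enforce convergence.
\<close>
lemma strip_growth_mellin_kernel:
  assumes "k \<ge> 1"
  shows "strip_growth a b (- (pi / 2)) (mellin_kernel k)"
proof -
  have p: "strip_growth a b 0 (\<lambda>w. 2 powr (- w))"
    using strip_growth_powr[of 2 a b "-1" 0] by simp
  have "strip_growth a b (real k * (- (pi / 2) + 0) + real (k - 1) * (pi / 2)) (mellin_kernel k)"
    unfolding mellin_kernel_def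
    by (intro strip_growth_mult strip_growth_power strip_growth_Gamma strip_growth_cos p)
  moreover have "real k * (- (pi / 2) + 0) + real (k - 1) * (pi / 2) = - (pi / 2)"
    using assms by (simp add: of_nat_diff field_simps)
  ultimately show ?thesis by simp
qed

lemma mellin_kernel_integral_indep:
  assumes "k \<ge> 1" "x > 0" "0 < a" "0 < b"
  defines "f \<equiv> \<lambda>w. mellin_kernel k w * of_real x powr (- w)"
  shows "vertical_integral f a = vertical_integral f b"
proof -
  have le: "vertical_integral f a = vertical_integral f b" if "0 < a" "a < b" for a b
  proof -
    have "strip_growth a b (- (pi / 2) + 0) f"
      unfolding f_def using assms(1,2) strip_growth_powr[of x a b "-1" 0]
      by (intro strip_growth_mult strip_growth_mellin_kernel) auto
    then obtain C where C: "\<And>s. a \<le> Re s \<Longrightarrow> Re s \<le> b \<Longrightarrow> 1 \<le> \<bar>Im s\<bar> \<Longrightarrow> norm (f s) \<le> C / (1 + (Im s)\<^sup>2)"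
      by (rule strip_growth_quadratic_decay) auto
    have "vertical_integral f b - vertical_integral f a = (\<Sum>p\<in>{}. residue f p)"
    proof (rule vertical_integral_diff_residues[where a' = 0 and b' = "b + 1"])
      show "f holomorphic_on {s. 0 < Re s \<and> Re s < b + 1} - {}"
        unfolding f_def using assms(2)
        by (intro holomorphic_intros holomorphic_on_subset[OF holomorphic_mellin_kernel]) auto
    qed (use that C in auto)
    then show ?thesis by simp
  qed
  consider "a < b" | "a = b" | "b < a" by linarith
  then show ?thesis
  proof cases
    case 1
    then show ?thesis by (rule le[OF assms(3)])
  next
    case 2
    then show ?thesis by simp
  next
    case 3
    then show ?thesis by (rule le[OF assms(4), symmetric])
  qed
qed

text \<open>
  The duplication formula combines \<open>\<Gamma>(-s) \<Gamma>(1/2-s)\<close> into \<open>\<Gamma>(-2s)\<close>.  Reflection turns each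
  \<open>1/\<Gamma>(1/2+s)\<close> into \<open>\<Gamma>(1/2-s) cos(\<pi>s)/\<pi>\<close>, which supplies the \<open>k-1\<close> factors \<open>\<Gamma>(1/2-s)\<close> that are
  missing for \<open>k\<close> such pairs, and the cosines.
\<close>
lemma meijer_G_integrand:
  assumes "k \<ge> 1" "x > 0" "Re s < 0"
  shows "Gamma (- s) ^ k * Gamma (1/2 - s) / Gamma (1/2 + s) ^ (k - 1) * of_real (x\<^sup>2) powr s =
    2 ^ k * of_real (sqrt pi) ^ k / of_real pi ^ (k - 1) * (mellin_kernel k (- 2 * s) * of_real x powr (2 * s))"
proof -
  define c where "c = cos (of_real pi * (- 2 * s) / 2)"
  have G: "Gamma (- s) * Gamma (1/2 - s) = 2 * of_real (sqrt pi) * (Gamma (- 2 * s) * 2 powr (2 * s))"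
  proof -
    have n: "- s \<notin> \<int>\<^sub>\<le>\<^sub>0" "- s + 1/2 \<notin> \<int>\<^sub>\<le>\<^sub>0"
      using nonpos_Ints_complexD(1)[of "- s"] nonpos_Ints_complexD(1)[of "- s + 1/2"] assms(3) by auto
    have "- s + 1/2 = 1/2 - s" "1 - 2 * (- s) = 1 + 2 * s" "2 * (- s) = - 2 * s" by simp_all
    then have "Gamma (- s) * Gamma (1/2 - s) = exp ((1 + 2 * s) * of_real (ln 2)) * of_real (sqrt pi) * Gamma (- 2 * s)"
      using Gamma_legendre_duplication[OF n] by (simp only:)
    also have "exp ((1 + 2 * s) * of_real (ln 2)) = 2 powr (1 + 2 * s)"
    proof -
      have "ln (2 :: complex) = of_real (ln 2)" using Ln_of_real[of 2] by simp
      then show ?thesis by (simp add: powr_def)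
    qed
    also have "\<dots> = 2 * 2 powr (2 * s)" by (simp add: powr_add)
    finally show ?thesis by (simp add: mult_ac)
  qed
  have R: "1 / Gamma (1/2 + s) = Gamma (1/2 - s) * c / of_real pi"
  proof -
    have "1/2 - s \<notin> \<int>\<^sub>\<le>\<^sub>0"
      using nonpos_Ints_complexD(1)[of "1/2 - s"] assms(3) by auto
    then have nz: "Gamma (1/2 - s) * rGamma (1/2 - s) = 1"
      by (simp add: Gamma_def rGamma_eq_zero_iff)
    have "rGamma (1/2 - s) * rGamma (1/2 + s) = sin (of_real pi * (1/2 - s)) / of_real pi"
    proof -
      have "1 - (1/2 - s) = 1/2 + s" by simp
      then show ?thesis using rGamma_reflection_complex[of "1/2 - s"] by (simp only:)
    qed
    also have "of_real pi * (1/2 - s) = of_real pi / 2 - of_real pi * s" by (simp add: algebra_simps)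
    also have "sin (of_real pi / 2 - of_real pi * s) = c"
      by (simp add: sin_diff c_def)
    finally have "rGamma (1/2 - s) * rGamma (1/2 + s) = c / of_real pi" .
    then have "Gamma (1/2 - s) * rGamma (1/2 - s) * rGamma (1/2 + s) = Gamma (1/2 - s) * c / of_real pi"
      by (simp only: mult.assoc times_divide_eq_right)
    then have "rGamma (1/2 + s) = Gamma (1/2 - s) * c / of_real pi"
      unfolding nz by (simp only: mult_1)
    moreover have "1 / Gamma (1/2 + s) = rGamma (1/2 + s)"
      by (simp only: rGamma_inverse_Gamma inverse_eq_divide)
    ultimately show ?thesis by (simp only:)
  qed
  have X: "of_real (x\<^sup>2) powr s = of_real x powr (2 * s)"
  proof -
    have "of_real (x\<^sup>2) powr s = exp (s * of_real (ln (x\<^sup>2)))"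
      using assms(2) unfolding powr_def by (subst Ln_of_real) auto
    also have "ln (x\<^sup>2) = 2 * ln x" using assms(2) by (simp add: ln_realpow)
    also have "exp (s * of_real (2 * ln x)) = exp ((2 * s) * of_real (ln x))"
      by (simp only: of_real_mult of_real_numeral mult_ac)
    also have "\<dots> = of_real x powr (2 * s)"
      using assms(2) unfolding powr_def by (subst Ln_of_real) auto
    finally show ?thesis .
  qed
  obtain m where k: "k = Suc m" using assms(1) by (cases k) auto
  have "Gamma (- s) ^ k * Gamma (1/2 - s) / Gamma (1/2 + s) ^ (k - 1) =
        Gamma (- s) ^ k * Gamma (1/2 - s) * (1 / Gamma (1/2 + s)) ^ m"
    by (simp only: k diff_Suc_1 power_one_over times_divide_eq_right mult_1_right)
  also have "\<dots> = (Gamma (- s) * Gamma (1/2 - s)) ^ k * c ^ m / of_real pi ^ m"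
    unfolding R k power_divide power_mult_distrib power_Suc
    by (simp only: times_divide_eq_left times_divide_eq_right mult_ac)
  also have "\<dots> = 2 ^ k * of_real (sqrt pi) ^ k / of_real pi ^ (k - 1) * mellin_kernel k (- 2 * s)"
  proof -
    have "- (- 2 * s) = 2 * s" by simp
    then show ?thesis
      unfolding G mellin_kernel_def c_def k diff_Suc_1 power_mult_distrib
      by (simp only: times_divide_eq_left times_divide_eq_right mult_ac)
  qed
  finally show ?thesis unfolding X by (simp only: mult.assoc)
qed

lemma meijer_G_eq_vertical_integral:
  assumes "k \<ge> 1" "x > 0" "\<mu> < 0"
  shows "of_real (pi powr (real k / 2 - 1) / 2 ^ (k - 1)) * meijer_G \<mu> k (x\<^sup>2) =
         vertical_integral (\<lambda>w. mellin_kernel k w * of_real x powr (- w)) (- 2 * \<mu>)"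
proof -
  define f where "f = (\<lambda>w. mellin_kernel k w * of_real x powr (- w))"
  define c where "c = (2 ^ k * sqrt pi ^ k / pi ^ (k - 1))"
  have c: "pi powr (real k / 2 - 1) / 2 ^ (k - 1) * c = 2"
  proof -
    have "pi powr (real k / 2) = (pi powr (1 / 2)) powr real k"
      by (subst powr_powr) simp
    also have "\<dots> = sqrt pi ^ k"
      by (simp only: powr_half_sqrt[OF pi_ge_zero] powr_realpow[OF real_sqrt_gt_zero[OF pi_gt_zero]])
    finally have 1: "pi powr (real k / 2 - 1) = sqrt pi ^ k / pi"
      by (simp add: powr_diff)
    have 2: "sqrt pi ^ k * sqrt pi ^ k = pi ^ k"
      by (simp only: power_mult_distrib[symmetric] real_sqrt_mult_self abs_of_pos[OF pi_gt_zero])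
    have 3: "pi * pi ^ (k - 1) = pi ^ k" using assms(1) by (cases k) simp_all
    have "pi powr (real k / 2 - 1) / 2 ^ (k - 1) * c =
        (sqrt pi ^ k * sqrt pi ^ k) * 2 ^ k / (pi * pi ^ (k - 1) * 2 ^ (k - 1))"
      unfolding 1 c_def by (simp only: times_divide_eq_left times_divide_eq_right divide_divide_eq_left mult_ac)
    also have "\<dots> = 2 ^ k / 2 ^ (k - 1)"
      unfolding 2 3 by (simp only: mult_divide_mult_cancel_left[OF power_not_zero[OF pi_neq_zero]])
    also have "\<dots> = 2" using assms(1) by (cases k) simp_all
    finally show ?thesis .
  qed
  have I: "(LBINT t. f (Complex (- 2 * \<mu>) t)) = 2 * (LBINT t. f (Complex (- 2 * \<mu>) (- 2 * t)))"
  proof -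
    have "(LBINT t. g t) = 2 * (LBINT t. g (- 2 * t))" for g :: "real \<Rightarrow> complex"
      using lborel_integral_real_affine[of "-2" g 0] by (simp add: scaleR_conv_of_real)
    then show ?thesis .
  qed
  have "meijer_G \<mu> k (x\<^sup>2) = 1 / (2 * of_real pi) * (LBINT t. of_real c * f (Complex (- 2 * \<mu>) (- 2 * t)))"
  proof -
    have "Gamma (- s) ^ k * Gamma (1/2 - s) / Gamma (1/2 + s) ^ (k - 1) * of_real (x\<^sup>2) powr s =
        of_real c * f (Complex (- 2 * \<mu>) (- 2 * t))" if "s = Complex \<mu> t" for s t
    proof -
      have "Complex (- 2 * \<mu>) (- 2 * t) = - 2 * s" by (simp add: that complex_eq_iff)
      moreover have "Re s < 0" using assms(3) by (simp add: that)
      moreover have "complex_of_real c = 2 ^ k * of_real (sqrt pi) ^ k / of_real pi ^ (k - 1)"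
        by (simp add: c_def)
      moreover have "- (- 2 * s) = 2 * s" by simp
      ultimately show ?thesis
        using meijer_G_integrand[OF assms(1,2)] unfolding f_def by (simp only:)
    qed
    then show ?thesis unfolding meijer_G_def Let_def by (simp only:)
  qed
  moreover define J where "J = (LBINT t. f (Complex (- 2 * \<mu>) (- 2 * t)))"
  ultimately have "of_real (pi powr (real k / 2 - 1) / 2 ^ (k - 1)) * meijer_G \<mu> k (x\<^sup>2) =
      of_real (pi powr (real k / 2 - 1) / 2 ^ (k - 1)) * (1 / (2 * of_real pi) * (of_real c * J))"
    by (simp only: integral_mult_right_zero)
  also have "\<dots> = of_real (pi powr (real k / 2 - 1) / 2 ^ (k - 1) * c) * (1 / (2 * of_real pi) * J)"
    unfolding of_real_mult by (simp only: mult_ac)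
  also have "\<dots> = 1 / (2 * of_real pi) * (2 * J)" unfolding c by simp
  also have "2 * J = (LBINT t. f (Complex (- 2 * \<mu>) t))" unfolding J_def by (rule I[symmetric])
  finally show ?thesis unfolding vertical_integral_def f_def .
qed

section \<open>The Dirichlet series of the Piltz function\<close>

text \<open>
  A sum over \<open>k\<close>-tuples of a completely multiplicative function of the product factorises.
\<close>
lemma has_sum_positive_lists:
  fixes f :: "nat \<Rightarrow> complex"
  assumes "(\<lambda>n. norm (f (Suc n))) summable_on UNIV" and "\<And>m n. f (m * n) = f m * f n" and "f 1 = 1"
  defines "L \<equiv> \<lambda>k. {xs :: nat list. length xs = k \<and> (\<forall>x\<in>set xs. x > 0)}"
  shows "((\<lambda>xs. f (prod_list xs)) has_sum (\<Sum>\<^sub>\<infinity>n. f (Suc n)) ^ k) (L k)"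
proof -
  define z where "z = (\<Sum>\<^sub>\<infinity>n. f (Suc n))"
  have "(\<lambda>xs. norm (f (prod_list xs))) summable_on L k \<and> ((\<lambda>xs. f (prod_list xs)) has_sum z ^ k) (L k)"
  proof (induction k)
    case 0
    have "L 0 = {[]}" by (auto simp: L_def)
    then show ?case using assms(3) by (auto simp: has_sum_finite_iff)
  next
    case (Suc k)
    let ?h = "\<lambda>(n, xs). Suc n # xs"
    have bij: "bij_betw ?h (UNIV \<times> L k) (L (Suc k))"
    proof (rule bij_betwI[where g = "\<lambda>xs. (hd xs - 1, tl xs)"])
      show "(\<lambda>xs. (hd xs - 1, tl xs)) \<in> L (Suc k) \<rightarrow> UNIV \<times> L k"
        by (auto simp: L_def length_Suc_conv)
      show "?h (hd xs - 1, tl xs) = xs" if "xs \<in> L (Suc k)" for xs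
        using that by (auto simp: L_def length_Suc_conv)
    qed (auto simp: L_def)
    have eq: "f (prod_list (?h p)) = f (Suc (fst p)) * f (prod_list (snd p))" for p
      by (cases p) (simp add: assms(2) del: mult_Suc)
    have sn: "(\<lambda>p. norm (f (Suc (fst p)) * f (prod_list (snd p)))) summable_on UNIV \<times> L k"
    proof (subst Infinite_Sum.abs_summable_on_Sigma_iff, intro conjI ballI)
      show "(\<lambda>xs. norm (f (Suc (fst (n, xs))) * f (prod_list (snd (n, xs))))) summable_on L k" for n
        using summable_on_cmult_right[OF conjunct1[OF Suc.IH]] by (simp add: norm_mult)
      have "(\<Sum>\<^sub>\<infinity>xs\<in>L k. norm (f (Suc n) * f (prod_list xs))) =
          norm (f (Suc n)) * (\<Sum>\<^sub>\<infinity>xs\<in>L k. norm (f (prod_list xs)))" for n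
        by (simp add: norm_mult infsum_cmult_right')
      then show "(\<lambda>n. norm (\<Sum>\<^sub>\<infinity>xs\<in>L k. norm (f (Suc (fst (n, xs))) * f (prod_list (snd (n, xs)))))) summable_on UNIV"
        using summable_on_cmult_left[OF assms(1)] by (simp add: norm_mult infsum_nonneg)
    qed
    have "((\<lambda>p. f (Suc (fst p)) * f (prod_list (snd p))) has_sum (z * z ^ k)) (UNIV \<times> L k)"
    proof (rule has_sum_SigmaI[where g = "\<lambda>n. f (Suc n) * z ^ k"])
      show "((\<lambda>y. f (Suc (fst (n, y))) * f (prod_list (snd (n, y)))) has_sum f (Suc n) * z ^ k) (L k)" for n
        using Suc.IH by (auto intro: has_sum_cmult_right)
      show "((\<lambda>n. f (Suc n) * z ^ k) has_sum z * z ^ k) UNIV"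
        unfolding z_def using assms(1)
        by (intro has_sum_cmult_left has_sum_infsum) (rule abs_summable_summable)
      show "(\<lambda>p. f (Suc (fst p)) * f (prod_list (snd p))) summable_on UNIV \<times> L k"
        using sn by (rule abs_summable_summable)
    qed
    then have hs: "((\<lambda>p. f (prod_list (?h p))) has_sum (z ^ Suc k)) (UNIV \<times> L k)"
      unfolding eq by simp
    have "(\<lambda>p. norm (f (prod_list (?h p)))) summable_on UNIV \<times> L k"
      unfolding eq by (rule sn)
    then show ?case
      using summable_on_reindex_bij_betw[OF bij, of "\<lambda>xs. norm (f (prod_list xs))"]
        has_sum_reindex_bij_betw[OF bij, of "\<lambda>xs. f (prod_list xs)"] hs by blast
  qed
  then show ?thesis by (simp add: z_def)
qed

text \<open>
  Grouping the \<open>k\<close>-tuples by their product.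
\<close>
lemma has_sum_piltz:
  fixes f :: "nat \<Rightarrow> complex"
  assumes "(\<lambda>n. norm (f (Suc n))) summable_on UNIV" and "\<And>m n. f (m * n) = f m * f n" and "f 1 = 1"
  shows "((\<lambda>n. of_nat (piltz k (Suc n)) * f (Suc n)) has_sum (\<Sum>\<^sub>\<infinity>n. f (Suc n)) ^ k) UNIV"
proof -
  define L where "L = {xs :: nat list. length xs = k \<and> (\<forall>x\<in>set xs. x > 0)}"
  define B where "B = (\<lambda>n. {xs \<in> L. prod_list xs = Suc n})"
  have pos: "prod_list xs > 0" if "\<forall>x\<in>set xs. x > 0" for xs :: "nat list"
    using that by (induction xs) auto
  have bij: "bij_betw snd (Sigma UNIV B) L"
  proof (rule bij_betwI[where g = "\<lambda>xs. (prod_list xs - 1, xs)"])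
    show "(\<lambda>xs. (prod_list xs - 1, xs)) \<in> L \<rightarrow> Sigma UNIV B"
      using pos by (auto simp: B_def L_def)
  qed (auto simp: B_def)
  have fin: "finite (B n)" for n
  proof (rule finite_subset)
    show "B n \<subseteq> {xs. set xs \<subseteq> {..Suc n} \<and> length xs = k}"
    proof (intro subsetI CollectI conjI)
      fix xs x assume "xs \<in> B n" "x \<in> set xs"
      then have "x dvd prod_list xs" "prod_list xs = Suc n"
        using prod_list_dvd[of x xs] by (auto simp: B_def)
      then show "x \<in> {..Suc n}" by (auto dest: dvd_imp_le)
    qed (auto simp: B_def L_def)
  qed (simp add: finite_lists_length_eq)
  have "((\<lambda>xs. f (prod_list xs)) has_sum (\<Sum>\<^sub>\<infinity>n. f (Suc n)) ^ k) L"
    unfolding L_def by (rule has_sum_positive_lists[OF assms])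
  then have "((\<lambda>p. f (prod_list (snd p))) has_sum (\<Sum>\<^sub>\<infinity>n. f (Suc n)) ^ k) (Sigma UNIV B)"
    by (subst has_sum_reindex_bij_betw[OF bij])
  then show ?thesis
  proof (rule has_sum_Sigma')
    fix n
    have "piltz k (Suc n) = card (B n)"
      by (simp add: piltz_def B_def L_def conj_assoc)
    moreover have "((\<lambda>xs. f (prod_list (snd (n, xs)))) has_sum (\<Sum>xs\<in>B n. f (prod_list (snd (n, xs))))) (B n)"
      by (rule has_sum_finite[OF fin])
    moreover have "(\<Sum>xs\<in>B n. f (prod_list (snd (n, xs)))) = (\<Sum>xs\<in>B n. f (Suc n))"
      by (intro sum.cong) (auto simp: B_def)
    ultimately show "((\<lambda>xs. f (prod_list (snd (n, xs)))) has_sum of_nat (piltz k (Suc n)) * f (Suc n)) (B n)"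
      by simp
  qed
qed

lemma sums_piltz:
  assumes "Re s > 1"
  shows "(\<lambda>n. of_nat (piltz k (Suc n)) * of_nat (Suc n) powr (- s)) sums (zeta s ^ k)"
proof -
  define f where "f = (\<lambda>n. of_nat n powr (- s) :: complex)"
  have sm: "(\<lambda>n. norm (f (Suc n))) summable_on UNIV"
    unfolding f_def by (subst summable_on_UNIV_nonneg_real_iff) (use summable_dirichlet[OF assms] in auto)
  have "((\<lambda>n. of_nat (piltz k (Suc n)) * f (Suc n)) has_sum (\<Sum>\<^sub>\<infinity>n. f (Suc n)) ^ k) UNIV"
  proof (rule has_sum_piltz[OF sm])
    show "f (m * n) = f m * f n" for m n
      unfolding f_def of_nat_mult by (rule powr_times_real) auto
  qed (simp add: f_def)
  moreover have "(\<Sum>\<^sub>\<infinity>n. f (Suc n)) = (\<Sum>n. f (Suc n))"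
    by (rule sums_unique[OF has_sum_imp_sums[OF has_sum_infsum[OF abs_summable_summable[OF sm]]]])
  moreover have "\<dots> = zeta s"
    unfolding zeta_conditions(3)[OF assms] f_def by (simp only: powr_minus_divide)
  ultimately show ?thesis
    using has_sum_imp_sums unfolding f_def by metis
qed

lemma summable_piltz:
  assumes "r > 1"
  shows "summable (\<lambda>n. real (piltz k (Suc n)) * real (Suc n) powr (- r))"
proof -
  have "(of_nat (Suc n) :: complex) powr (- of_real r) = of_real (real (Suc n) powr (- r))" for n
    using powr_of_real[of "real (Suc n)" "- r"] by (simp del: of_nat_Suc)
  then have "(\<lambda>n. of_nat (piltz k (Suc n)) * (of_nat (Suc n) :: complex) powr (- of_real r)) =
      (\<lambda>n. of_real (real (piltz k (Suc n)) * real (Suc n) powr (- r)))"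
    by (simp only: of_real_mult of_real_of_nat_eq)
  then have "summable (\<lambda>n. complex_of_real (real (piltz k (Suc n)) * real (Suc n) powr (- r)))"
    using sums_summable[OF sums_piltz[of "of_real r" k]] assms by (simp only:) simp
  then show ?thesis by (simp only: summable_of_real_iff)
qed

section \<open>The double series as a contour integral\<close>

definition contour_integrand :: "nat \<Rightarrow> real \<Rightarrow> complex \<Rightarrow> complex" where
  "contour_integrand k \<gamma> w =
     (zeta w * zeta (w - 1)) ^ k * mellin_kernel k w * of_real \<gamma> powr (- (of_nat k * (w - 1)))"

lemma integrable_kernel_line:
  assumes "k \<ge> 1" "c > 0"
    and f: "continuous_on {s. Re s = c} f" and bounded: "\<And>s. Re s = c \<Longrightarrow> norm (f s) \<le> B"
  shows "integrable lborel (\<lambda>t. mellin_kernel k (Complex c t) * f (Complex c t))"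
proof -
  have "strip_growth c c (- (pi / 2) + 0) (\<lambda>w. mellin_kernel k w * f w)"
    using bounded by (intro strip_growth_mult strip_growth_mellin_kernel[OF assms(1)] strip_growth_bounded) auto
  then obtain C where C: "\<And>s. c \<le> Re s \<Longrightarrow> Re s \<le> c \<Longrightarrow> 1 \<le> \<bar>Im s\<bar> \<Longrightarrow>
      norm (mellin_kernel k s * f s) \<le> C / (1 + (Im s)\<^sup>2)"
    by (rule strip_growth_quadratic_decay) auto
  have "continuous_on {s. Re s = c} (mellin_kernel k)"
    using assms(2) by (intro continuous_on_subset[OF holomorphic_on_imp_continuous_on[OF holomorphic_mellin_kernel]]) auto
  then have cont: "continuous_on {s. Re s = c} (\<lambda>w. mellin_kernel k w * f w)"
    using f by (intro continuous_on_mult)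
  show ?thesis
    by (rule integrable_vertical_line[OF cont]) (use C[of "Complex c t" for t] in auto)
qed

lemma norm_powr_line:
  assumes "x > 0" "Re s = c"
  shows "norm (of_real x powr (- (of_nat k * s)) :: complex) = x powr (- (real k * c))"
  using assms by (subst norm_powr_real_powr) auto

lemma norm_zeta_line_le:
  assumes "c > 1"
  obtains B where "\<And>s. Re s = c \<Longrightarrow> norm (zeta s) \<le> B"
proof
  fix s :: complex assume s: "Re s = c"
  have "norm (zeta s) = norm (\<Sum>n. of_nat (Suc n) powr (- s) :: complex)"
    using s assms by (subst zeta_conditions(3)) (auto simp: powr_minus_divide)
  also have "\<dots> \<le> (\<Sum>n. norm (of_nat (Suc n) powr (- s) :: complex))"
    using s assms by (intro summable_norm summable_dirichlet) auto
  also have "\<dots> = (\<Sum>n. real (Suc n) powr (- c))"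
    using s by (intro suminf_cong) (subst norm_powr_real_powr, auto)
  finally show "norm (zeta s) \<le> (\<Sum>n. real (Suc n) powr (- c))" .
qed

lemma of_real_mult_powr:
  assumes "x > 0" "y > 0"
  shows "(of_real (x * y) :: complex) powr s = of_real x powr s * of_real y powr s"
  using assms unfolding of_real_mult by (intro powr_times_real) auto

lemma Psi_eq_vertical_integral:
  assumes "k \<ge> 1" "\<gamma> > 0" "x > 0" "\<mu> < 0" "c > 1"
  shows "Psi \<mu> ((2 * \<gamma>) ^ k) k x =
    vertical_integral (\<lambda>w. mellin_kernel k w * of_real \<gamma> powr (- (of_nat k * w)) * of_real x powr (- w) * zeta w ^ k) c"
proof -
  define K where "K = pi powr (real k / 2 - 1) / 2 ^ (k - 1)"
  define g where "g = (\<lambda>w. mellin_kernel k w * (of_real \<gamma> powr (- (of_nat k * w)) * of_real x powr (- w)))"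
  have g: "integrable lborel (\<lambda>t. g (Complex c t))"
    unfolding g_def
  proof (rule integrable_kernel_line[OF assms(1)])
    show "continuous_on {s. Re s = c} (\<lambda>w. of_real \<gamma> powr (- (of_nat k * w)) * of_real x powr (- w) :: complex)"
      using assms by (intro continuous_intros) auto
    show "norm (of_real \<gamma> powr (- (of_nat k * s)) * of_real x powr (- s) :: complex) \<le>
        \<gamma> powr (- (real k * c)) * x powr (- c)" if "Re s = c" for s
      using norm_powr_line[OF assms(2) that, of k] norm_powr_line[OF assms(3) that, of 1] by (simp add: norm_mult)
  qed (use assms in auto)
  have trm: "of_real K * meijer_G \<mu> k (((2 * \<gamma>) ^ k)\<^sup>2 * (real (Suc j))\<^sup>2 * x\<^sup>2 / 2 ^ (2 * k)) =
      vertical_integral (\<lambda>w. g w * of_real (real (Suc j)) powr (- w)) c" for j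
  proof -
    \<comment> \<open>The argument of the Meijer function is the square of \<open>X\<close>.\<close>
    define X where "X = \<gamma> ^ k * (x * real (Suc j))"
    have X: "X > 0" using assms by (simp add: X_def)
    have "((2 * \<gamma>) ^ k)\<^sup>2 * (real (Suc j))\<^sup>2 * x\<^sup>2 / 2 ^ (2 * k) = X\<^sup>2"
    proof -
      have "(2::real) ^ (2 * k) = (2 ^ k)\<^sup>2" by (simp add: power_mult[symmetric] mult.commute)
      then show ?thesis unfolding X_def power_mult_distrib by simp
    qed
    then have "of_real K * meijer_G \<mu> k (((2 * \<gamma>) ^ k)\<^sup>2 * (real (Suc j))\<^sup>2 * x\<^sup>2 / 2 ^ (2 * k)) =
        vertical_integral (\<lambda>w. mellin_kernel k w * of_real X powr (- w)) (- 2 * \<mu>)"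
      unfolding K_def using meijer_G_eq_vertical_integral[OF assms(1) X assms(4)] by simp
    also have "\<dots> = vertical_integral (\<lambda>w. mellin_kernel k w * of_real X powr (- w)) c"
      using assms X by (intro mellin_kernel_integral_indep) auto
    also have "(\<lambda>w. mellin_kernel k w * of_real X powr (- w)) = (\<lambda>w. g w * of_real (real (Suc j)) powr (- w))"
    proof
      fix w :: complex
      have "of_real X powr (- w) = of_real (\<gamma> ^ k) powr (- w) * (of_real x powr (- w) * of_real (real (Suc j)) powr (- w))"
        unfolding X_def using assms by (subst of_real_mult_powr, simp, simp, subst of_real_mult_powr, simp, simp) simp
      also have "(of_real (\<gamma> ^ k) :: complex) powr (- w) = of_real \<gamma> powr (- (of_nat k * w))"
      proof -
        have "ln (complex_of_real (\<gamma> ^ k)) = of_real (real k * ln \<gamma>)"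
          using assms(2) by (subst Ln_of_real) (auto simp: ln_realpow)
        moreover have "ln (complex_of_real \<gamma>) = of_real (ln \<gamma>)"
          using assms(2) by (subst Ln_of_real) auto
        ultimately show ?thesis using assms(2) unfolding powr_def by (simp add: mult_ac)
      qed
      finally show "mellin_kernel k w * of_real X powr (- w) = g w * of_real (real (Suc j)) powr (- w)"
        by (simp only: g_def mult_ac)
    qed
    finally show ?thesis .
  qed
  have sums: "(\<lambda>j. of_nat (piltz k (Suc j)) * vertical_integral (\<lambda>w. g w * of_real (real (Suc j)) powr (- w)) c) sums
      vertical_integral (\<lambda>w. g w * (\<Sum>j. of_nat (piltz k (Suc j)) * of_real (real (Suc j)) powr (- w))) c"
    using summable_piltz[of c k] assms by (intro sums_vertical_integral[OF g]) auto
  have "vertical_integral (\<lambda>w. g w * (\<Sum>j. of_nat (piltz k (Suc j)) * of_real (real (Suc j)) powr (- w))) c =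
      vertical_integral (\<lambda>w. g w * zeta w ^ k) c"
  proof -
    have "(\<Sum>j. of_nat (piltz k (Suc j)) * of_real (real (Suc j)) powr (- w)) = zeta w ^ k" if "Re w = c" for w
      using sums_unique[OF sums_piltz[of w k]] assms that by simp
    then show ?thesis unfolding vertical_integral_def by simp
  qed
  note sums = sums[unfolded this]
  define a where "a = (\<lambda>j. of_nat (piltz k (Suc j)) *
      meijer_G \<mu> k (((2 * \<gamma>) ^ k)\<^sup>2 * (real (Suc j))\<^sup>2 * x\<^sup>2 / 2 ^ (2 * k)))"
  have K0: "complex_of_real K \<noteq> 0" by (simp add: K_def)
  have "(\<lambda>j. of_real K * a j) sums vertical_integral (\<lambda>w. g w * zeta w ^ k) c"
    using sums unfolding trm[symmetric] a_def by (simp only: mult_ac)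
  moreover from this have "summable a"
    using K0 sums_summable summable_cmult_iff by blast
  ultimately have "of_real K * (\<Sum>j. a j) = vertical_integral (\<lambda>w. g w * zeta w ^ k) c"
    using suminf_mult[of a "of_real K"] sums_unique by metis
  then show ?thesis
    unfolding Psi_def Let_def a_def K_def g_def by (simp only: mult.assoc)
qed

lemma sums_Psi:
  assumes "k \<ge> 1" "\<gamma> > 0" "\<mu> < 0" "c > 2"
  shows "(\<lambda>m. of_nat (Suc m) * of_nat (piltz k (Suc m)) * Psi \<mu> ((2 * \<gamma>) ^ k) k (real (Suc m))) sums
    vertical_integral (\<lambda>w. mellin_kernel k w * of_real \<gamma> powr (- (of_nat k * w)) * zeta w ^ k * zeta (w - 1) ^ k) c"
proof -
  define g where "g = (\<lambda>w. mellin_kernel k w * (of_real \<gamma> powr (- (of_nat k * w)) * zeta w ^ k))"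
  have c1: "c > 1" using assms by simp
  obtain B where B: "\<And>s. Re s = c \<Longrightarrow> norm (zeta s) \<le> B" using norm_zeta_line_le[OF c1] by blast
  have g: "integrable lborel (\<lambda>t. g (Complex c t))"
    unfolding g_def
  proof (rule integrable_kernel_line[OF assms(1)])
    have "continuous_on {s. Re s = c} zeta"
      using c1 by (intro continuous_on_subset[OF holomorphic_on_imp_continuous_on[OF zeta_conditions(1)]]) auto
    then show "continuous_on {s. Re s = c} (\<lambda>w. of_real \<gamma> powr (- (of_nat k * w)) * zeta w ^ k)"
      using assms by (intro continuous_intros) auto
    show "norm (of_real \<gamma> powr (- (of_nat k * s)) * zeta s ^ k) \<le> \<gamma> powr (- (real k * c)) * B ^ k" if "Re s = c" for s
      unfolding norm_mult norm_power norm_powr_line[OF assms(2) that]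
      using B[OF that] by (intro mult_left_mono power_mono) auto
  qed (use assms in auto)
  have "summable (\<lambda>n. norm (of_nat (Suc n) * of_nat (piltz k (Suc n)) :: complex) * real (Suc n) powr (- c))"
  proof -
    have "norm (of_nat (Suc n) * of_nat (piltz k (Suc n)) :: complex) * real (Suc n) powr (- c) =
        real (piltz k (Suc n)) * real (Suc n) powr (- (c - 1))" for n
    proof -
      have "real (Suc n) powr (- (c - 1)) = real (Suc n) powr (1 + (- c))" by simp
      also have "\<dots> = real (Suc n) * real (Suc n) powr (- c)" by (subst powr_add) simp
      finally show ?thesis by (simp add: norm_mult del: of_nat_Suc)
    qed
    then show ?thesis using summable_piltz[of "c - 1" k] assms by simp
  qed
  then have "(\<lambda>n. of_nat (Suc n) * of_nat (piltz k (Suc n)) * vertical_integral (\<lambda>w. g w * of_real (real (Suc n)) powr (- w)) c) sums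
      vertical_integral (\<lambda>w. g w * (\<Sum>n. of_nat (Suc n) * of_nat (piltz k (Suc n)) * of_real (real (Suc n)) powr (- w))) c"
    by (intro sums_vertical_integral[OF g]) auto
  moreover have "vertical_integral (\<lambda>w. g w * of_real (real (Suc n)) powr (- w)) c = Psi \<mu> ((2 * \<gamma>) ^ k) k (real (Suc n))" for n
    unfolding g_def using Psi_eq_vertical_integral[OF assms(1,2) _ assms(3) c1, of "real (Suc n)"]
    by (simp only: mult_ac of_nat_0_less_iff zero_less_Suc simp_thms)
  moreover have "vertical_integral (\<lambda>w. g w * (\<Sum>n. of_nat (Suc n) * of_nat (piltz k (Suc n)) * of_real (real (Suc n)) powr (- w))) c =
      vertical_integral (\<lambda>w. g w * zeta (w - 1) ^ k) c"
  proof -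
    have "(\<Sum>n. of_nat (Suc n) * of_nat (piltz k (Suc n)) * of_real (real (Suc n)) powr (- w)) = zeta (w - 1) ^ k" if "Re w = c" for w
    proof -
      have "(\<lambda>n. of_nat (piltz k (Suc n)) * (of_nat (Suc n) :: complex) powr (- (w - 1))) sums (zeta (w - 1) ^ k)"
        using assms that by (intro sums_piltz) auto
      moreover have "(of_nat (Suc n) :: complex) powr (- (w - 1)) = of_nat (Suc n) * of_real (real (Suc n)) powr (- w)" for n
      proof -
        have "(of_nat (Suc n) :: complex) powr (- (w - 1)) = of_nat (Suc n) powr (1 + (- w))" by simp
        also have "\<dots> = of_nat (Suc n) * of_nat (Suc n) powr (- w)" by (subst powr_add) (simp del: of_nat_Suc)
        finally show ?thesis by simp
      qed
      ultimately show ?thesis by (simp only: sums_iff mult_ac)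
    qed
    then show ?thesis unfolding vertical_integral_def by simp
  qed
  ultimately show ?thesis unfolding g_def by (simp only: mult.assoc)
qed

lemma sums_Psi_contour:
  assumes "k \<ge> 1" "\<gamma> > 0" "\<mu> < 0" "c > 2"
  shows "(\<lambda>m. of_real \<gamma> ^ k * (of_nat (Suc m) * of_nat (piltz k (Suc m)) * Psi \<mu> ((2 * \<gamma>) ^ k) k (real (Suc m)))) sums
    vertical_integral (contour_integrand k \<gamma>) c"
proof -
  have "contour_integrand k \<gamma> w =
      of_real \<gamma> ^ k * (mellin_kernel k w * of_real \<gamma> powr (- (of_nat k * w)) * zeta w ^ k * zeta (w - 1) ^ k)" for w
  proof -
    have "- (of_nat k * (w - 1)) = of_nat k + - (of_nat k * w)" by (simp add: algebra_simps)
    then have "of_real \<gamma> powr (- (of_nat k * (w - 1))) = of_real \<gamma> ^ k * of_real \<gamma> powr (- (of_nat k * w))"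
      using assms(2) by (simp only: powr_add) (simp add: powr_nat)
    then show ?thesis unfolding contour_integrand_def by (simp only: power_mult_distrib mult_ac)
  qed
  then have "vertical_integral (contour_integrand k \<gamma>) c = of_real \<gamma> ^ k *
      vertical_integral (\<lambda>w. mellin_kernel k w * of_real \<gamma> powr (- (of_nat k * w)) * zeta w ^ k * zeta (w - 1) ^ k) c"
    unfolding vertical_integral_def by simp
  then show ?thesis using sums_mult[OF sums_Psi[OF assms]] by simp
qed

section \<open>Reflection and residues\<close>

text \<open>
  The functional equation at \<open>w\<close> and at \<open>w-1\<close> produces \<open>sin(\<pi>w/2) cos(\<pi>w/2) \<Gamma>(w-1) \<Gamma>(2-w)\<close>, which is
  the constant \<open>-\<pi>/2\<close> by the reflection formula.  Integers are excluded because the sine or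
  the cosine vanishes there.
\<close>
lemma contour_integrand_reflect_base:
  assumes "Re w > 1" "w \<notin> \<int>"
  shows "zeta (2 - w) * zeta (1 - w) * (Gamma (2 - w) * 2 powr (- (2 - w))) =
         - (of_real (pi\<^sup>2) powr (1 - w) * (zeta w * zeta (w - 1) * (Gamma w * 2 powr (- w))))"
proof -
  define s c where "s = sin (of_real pi * w / 2)" and "c = cos (of_real pi * w / 2)"
  have w: "w \<noteq> 1" "w - 1 \<noteq> 1" using assms(2) by (auto simp: algebra_simps)
  have z1: "zeta (1 - w) = 2 * (2 * of_real pi) powr (- w) * c * Gamma w * zeta w"
    unfolding c_def using assms w by (intro zeta_functional_equation) auto
  have z2: "zeta (2 - w) = 2 * (2 * of_real pi) powr (- (w - 1)) * s * Gamma (w - 1) * zeta (w - 1)"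
  proof -
    have "of_real pi * (w - 1) / 2 = of_real pi * w / 2 - of_real pi / 2"
      by (simp add: algebra_simps diff_divide_distrib)
    then have "cos (of_real pi * (w - 1) / 2) = s" by (simp only: cos_diff s_def) simp
    moreover have "zeta (1 - (w - 1)) = 2 * (2 * of_real pi) powr (- (w - 1)) * cos (of_real pi * (w - 1) / 2) * Gamma (w - 1) * zeta (w - 1)"
      using assms w by (intro zeta_functional_equation) auto
    moreover have "1 - (w - 1) = 2 - w" by simp
    ultimately show ?thesis by (simp only:)
  qed
  have G: "s * c * (Gamma (w - 1) * Gamma (2 - w)) = - of_real pi / 2"
  proof -
    have "sin (of_real pi * w) = 2 * s * c"
      using sin_double[of "of_real pi * w / 2"] by (simp add: s_def c_def)
    moreover have "sin (of_real pi * (w - 1)) = - sin (of_real pi * w)"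
      by (simp add: sin_diff right_diff_distrib)
    moreover have "1 - (w - 1) = 2 - w" by simp
    ultimately have *: "Gamma (w - 1) * Gamma (2 - w) = of_real pi / (- (2 * s * c))"
      using Gamma_reflection_complex[of "w - 1"] by (simp only:)
    have "Gamma (w - 1) * Gamma (2 - w) \<noteq> 0"
    proof -
      have "w - 1 \<notin> \<int>" "2 - w \<notin> \<int>"
        using assms(2) Ints_add[of "w - 1" 1] Ints_diff[of 2 "2 - w"] by auto
      then show ?thesis using nonpos_Ints_Int by (auto simp: Gamma_eq_zero_iff)
    qed
    then have "s * c \<noteq> 0" using * by auto
    then show ?thesis unfolding * by (simp add: field_simps)
  qed
  have P: "2 * of_real pi * ((2 * of_real pi) powr (- (w - 1)) * (2 * of_real pi) powr (- w) * 2 powr (- (2 - w))) =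
      of_real (pi\<^sup>2) powr (1 - w) * 2 powr (- w)"
  proof -
    define a b where "a = complex_of_real (ln 2)" and "b = complex_of_real (ln pi)"
    have l2: "ln (2 :: complex) = a" using Ln_of_real[of 2] by (simp add: a_def)
    have l2p: "ln (2 * complex_of_real pi) = a + b"
      using Ln_of_real[of "2 * pi"] by (simp add: a_def b_def ln_mult)
    have lp: "ln (complex_of_real (pi\<^sup>2)) = 2 * b"
      by (subst Ln_of_real) (simp_all add: b_def ln_realpow)
    have e: "2 * complex_of_real pi = exp (a + b)"
      using exp_Ln[of "2 * complex_of_real pi"] by (simp add: l2p)
    have "(2 * complex_of_real pi) powr z = exp (z * (a + b))" "(2::complex) powr z = exp (z * a)"
      "complex_of_real (pi\<^sup>2) powr z = exp (z * (2 * b))" for z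
      unfolding powr_def l2 l2p lp by simp_all
    then have "2 * of_real pi * ((2 * of_real pi) powr (- (w - 1)) * (2 * of_real pi) powr (- w) * 2 powr (- (2 - w))) =
        exp ((a + b) + (- (w - 1) * (a + b) + - w * (a + b) + - (2 - w) * a))"
      "of_real (pi\<^sup>2) powr (1 - w) * 2 powr (- w) = exp ((1 - w) * (2 * b) + - w * a)"
      by (simp_all only: e exp_add)
    moreover have "(a + b) + (- (w - 1) * (a + b) + - w * (a + b) + - (2 - w) * a) = (1 - w) * (2 * b) + - w * a"
      by (simp add: algebra_simps)
    ultimately show ?thesis by (simp only:)
  qed
  have "zeta (2 - w) * zeta (1 - w) * (Gamma (2 - w) * 2 powr (- (2 - w))) =
     4 * ((2 * of_real pi) powr (- (w - 1)) * (2 * of_real pi) powr (- w) * 2 powr (- (2 - w))) *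
       (s * c * (Gamma (w - 1) * Gamma (2 - w))) * (Gamma w * zeta w * zeta (w - 1))"
    unfolding z1 z2 by (simp add: mult_ac)
  also have "\<dots> = - (2 * of_real pi * ((2 * of_real pi) powr (- (w - 1)) * (2 * of_real pi) powr (- w) * 2 powr (- (2 - w)))) *
      (Gamma w * zeta w * zeta (w - 1))"
    unfolding G by (simp add: mult_ac)
  finally show ?thesis unfolding P by (simp add: mult_ac)
qed

text \<open>
  The sign is \<open>(-1)\<^sup>k (-1)\<^bsup>k-1\<^esup> = -1\<close>, from the previous lemma and from
  \<open>cos(\<pi> - \<pi>w/2) = -cos(\<pi>w/2)\<close>; the hypothesis on \<open>\<alpha>\<beta>\<close> converts \<open>\<pi>\<^bsup>2k(1-w)\<^esup>\<close> into powers of \<open>\<alpha>\<close>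
  and \<open>\<beta>\<close>.
\<close>
lemma contour_integrand_reflect:
  assumes "k \<ge> 1" "\<alpha> > 0" "\<beta> > 0" "\<alpha> * \<beta> = pi\<^sup>2" "Re w > 1" "w \<notin> \<int>"
  shows "contour_integrand k \<alpha> (2 - w) = - contour_integrand k \<beta> w"
proof -
  define F where "F = (\<lambda>w. zeta w * zeta (w - 1) * (Gamma w * 2 powr (- w)))"
  define c where "c = (\<lambda>w :: complex. cos (of_real pi * w / 2))"
  have H: "contour_integrand k \<gamma> w = F w ^ k * c w ^ (k - 1) * of_real \<gamma> powr (- (of_nat k * (w - 1)))" for \<gamma> w
    unfolding contour_integrand_def mellin_kernel_def F_def c_def by (simp add: power_mult_distrib)
  have F: "F (2 - w) = - (of_real (pi\<^sup>2) powr (1 - w) * F w)"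
    unfolding F_def using contour_integrand_reflect_base[OF assms(5,6)] by simp
  have "of_real pi * (2 - w) / 2 = of_real pi - of_real pi * w / 2" by (simp add: field_simps)
  then have c: "c (2 - w) = - c w" by (simp only: c_def cos_diff) simp
  have sign: "(- 1) ^ k * (- 1) ^ (k - 1) = (- 1 :: complex)"
    using assms(1) by (cases k) (simp_all flip: power_mult_distrib)
  \<comment> \<open>the only place where \<open>\<alpha>\<beta> = \<pi>\<^sup>2\<close> enters\<close>
  have pw: "(of_real (pi\<^sup>2) powr (1 - w)) ^ k * of_real \<alpha> powr (- (of_nat k * (2 - w - 1))) =
      of_real \<beta> powr (- (of_nat k * (w - 1)))"
  proof -
    have "(of_real (pi\<^sup>2) powr (1 - w)) ^ k = (of_real \<alpha> powr (1 - w)) ^ k * (of_real \<beta> powr (1 - w)) ^ k"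
      unfolding assms(4)[symmetric] of_real_mult_powr[OF assms(2,3)] by (rule power_mult_distrib)
    also have "(of_real \<alpha> powr (1 - w)) ^ k = (of_real \<alpha> powr (of_nat k * (1 - w)))"
      using assms(2) by (simp add: powr_def exp_of_nat_mult[symmetric] mult.assoc)
    also have "(of_real \<beta> powr (1 - w)) ^ k = (of_real \<beta> powr (of_nat k * (1 - w)))"
      using assms(3) by (simp add: powr_def exp_of_nat_mult[symmetric] mult.assoc)
    finally have "(of_real (pi\<^sup>2) powr (1 - w)) ^ k * of_real \<alpha> powr (- (of_nat k * (2 - w - 1))) =
       (of_real \<alpha> powr (of_nat k * (1 - w)) * of_real \<alpha> powr (- (of_nat k * (2 - w - 1)))) * of_real \<beta> powr (of_nat k * (1 - w))"
      by (simp only: mult_ac)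
    also have "of_real \<alpha> powr (of_nat k * (1 - w)) * of_real \<alpha> powr (- (of_nat k * (2 - w - 1))) = (1 :: complex)"
      using assms(2) by (simp add: powr_add[symmetric])
    also have "of_nat k * (1 - w) = - (of_nat k * (w - 1))" by (simp add: algebra_simps)
    finally show ?thesis by simp
  qed
  have "contour_integrand k \<alpha> (2 - w) = ((- 1) ^ k * (- 1) ^ (k - 1)) * (F w ^ k * c w ^ (k - 1)) *
     ((of_real (pi\<^sup>2) powr (1 - w)) ^ k * of_real \<alpha> powr (- (of_nat k * (2 - w - 1))))"
    unfolding H F c power_minus[of "of_real (pi\<^sup>2) powr (1 - w) * F w"] power_minus[of "c w"] power_mult_distrib
    by (simp only: mult_ac)
  also have "\<dots> = - contour_integrand k \<beta> w"
    unfolding sign pw H by simp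
  finally show ?thesis .
qed

text \<open>
  This is \<open>w\<^sup>k H\<^sub>\<gamma>(w)\<close>, extended holomorphically to \<open>w = 0\<close> by \<open>w \<Gamma>(w) = \<Gamma>(w+1)\<close>.
\<close>
definition residue_numer :: "nat \<Rightarrow> real \<Rightarrow> complex \<Rightarrow> complex" where
  "residue_numer k \<gamma> s = zeta (s - 1) ^ k * zeta s ^ k * Gamma (s + 1) ^ k * cos (of_real pi * s / 2) ^ (k - 1) *
     2 powr (- (of_nat k * s)) * of_real \<gamma> powr (- (of_nat k * (s - 1)))"

lemma holomorphic_residue_numer:
  assumes "\<gamma> > 0"
  shows "residue_numer k \<gamma> holomorphic_on ball 0 1"
proof -
  have re: "\<bar>Re s\<bar> < 1" if "s \<in> ball 0 1" for s :: complex
    using that abs_Re_le_cmod[of s] by simp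
  have "zeta \<circ> (\<lambda>s. s - 1) holomorphic_on ball 0 1"
    by (intro holomorphic_on_compose holomorphic_intros holomorphic_on_subset[OF zeta_conditions(1)])
       (use re in fastforce)
  moreover have "zeta holomorphic_on ball 0 1"
    by (rule holomorphic_on_subset[OF zeta_conditions(1)]) auto
  moreover have n: "s + 1 \<notin> \<int>\<^sub>\<le>\<^sub>0" if "s \<in> ball 0 1" for s :: complex
    using nonpos_Ints_complexD(1)[of "s + 1"] re[OF that] by auto
  ultimately show ?thesis
    unfolding residue_numer_def o_def using assms by (intro holomorphic_intros) auto
qed

lemma contour_integrand_eq_quotient:
  assumes "w \<in> ball 0 1 - {0}"
  shows "contour_integrand k \<gamma> w = residue_numer k \<gamma> w / w ^ k"
proof -
  have "w \<notin> \<int>\<^sub>\<le>\<^sub>0"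
  proof
    assume "w \<in> \<int>\<^sub>\<le>\<^sub>0"
    then obtain n :: nat where n: "w = - of_nat n" by (auto elim!: nonpos_Ints_cases')
    then have "n < 1" using assms by (simp add: norm_minus_cancel)
    with n assms show False by simp
  qed
  then have "Gamma (w + 1) = w * Gamma w" by (rule Gamma_plus1)
  moreover have "(2 powr (- w)) ^ k = (2 :: complex) powr (- (of_nat k * w))"
    by (simp add: powr_def exp_of_nat_mult[symmetric] mult.assoc)
  ultimately show ?thesis
    using assms unfolding contour_integrand_def mellin_kernel_def residue_numer_def
    by (simp add: power_mult_distrib mult_ac)
qed

lemma residue_contour_integrand_0:
  assumes "k \<ge> 1" "\<gamma> > 0"
  shows "residue (contour_integrand k \<gamma>) 0 = (deriv ^^ (k - 1)) (residue_numer k \<gamma>) 0 / fact (k - 1)"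
proof -
  have "residue (contour_integrand k \<gamma>) 0 = residue (\<lambda>w. residue_numer k \<gamma> w / w ^ Suc (k - 1)) 0"
  proof (rule residue_cong)
    show "\<forall>\<^sub>F w in at 0. contour_integrand k \<gamma> w = residue_numer k \<gamma> w / w ^ Suc (k - 1)"
      using eventually_at_in_open[of "ball 0 1" "0 :: complex"] assms(1)
      by (auto elim!: eventually_mono simp: contour_integrand_eq_quotient simp del: power_Suc)
  qed auto
  also have "\<dots> = (deriv ^^ (k - 1)) (residue_numer k \<gamma>) 0 / fact (k - 1)"
    using assms by (intro residue_holomorphic_over_power'[of "ball 0 1"] holomorphic_residue_numer) auto
  finally show ?thesis .
qed

text \<open>
  Near \<open>2\<close> the function is \<open>-H\<^sub>\<beta>(2-w)\<close>.  The signs from \<open>(2-w)\<^sup>k\<close> and from the \<open>k-1\<close> derivatives of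
  the reflected argument cancel the minus sign.
\<close>
lemma residue_contour_integrand_2:
  assumes "k \<ge> 1" "\<alpha> > 0" "\<beta> > 0" "\<alpha> * \<beta> = pi\<^sup>2"
  shows "residue (contour_integrand k \<alpha>) 2 = (deriv ^^ (k - 1)) (residue_numer k \<beta>) 0 / fact (k - 1)"
proof -
  define f where "f = (\<lambda>v. - ((- 1) ^ k) * residue_numer k \<beta> v)"
  have f: "f holomorphic_on ball 0 1"
    unfolding f_def by (intro holomorphic_intros holomorphic_residue_numer assms)
  have in_ball: "- 1 * w + 2 \<in> ball (0::complex) 1" if "w \<in> ball 2 1" for w
    using that by (simp add: dist_norm norm_minus_commute)
  have "residue (contour_integrand k \<alpha>) 2 = residue (\<lambda>w. f (- 1 * w + 2) / (w - 2) ^ Suc (k - 1)) 2"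
  proof (rule residue_cong)
    have "contour_integrand k \<alpha> w = f (- 1 * w + 2) / (w - 2) ^ Suc (k - 1)" if w: "w \<in> ball 2 1 - {2}" for w
    proof -
      have nint: "w \<notin> \<int>"
      proof
        assume "w \<in> \<int>"
        then obtain n where n: "w = of_int n" by (auto elim!: Ints_cases)
        have "cmod (of_int (2 - n)) < 1" using w by (simp add: n dist_norm)
        then have "n = 2" unfolding norm_of_int by linarith
        with n w show False by simp
      qed
      have "\<bar>Re (2 - w)\<bar> < 1" using w abs_Re_le_cmod[of "2 - w"] by (simp add: dist_norm)
      then have re: "Re w > 1" by simp
      have "contour_integrand k \<alpha> w = - contour_integrand k \<beta> (2 - w)"
        using contour_integrand_reflect[of k \<beta> \<alpha> w] assms re nint by (simp add: mult.commute)
      also have "contour_integrand k \<beta> (2 - w) = residue_numer k \<beta> (2 - w) / (2 - w) ^ k"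
        using w by (intro contour_integrand_eq_quotient) (auto simp: dist_norm norm_minus_commute)
      also have "(2 - w) ^ k = (- 1) ^ k * (w - 2) ^ k"
        by (simp add: power_mult_distrib[symmetric])
      also have "- (residue_numer k \<beta> (2 - w) / ((- 1) ^ k * (w - 2) ^ k)) = f (2 - w) / (w - 2) ^ k"
        by (cases "even k") (simp_all add: f_def)
      finally show ?thesis using assms(1) by simp
    qed
    then show "\<forall>\<^sub>F w in at 2. contour_integrand k \<alpha> w = f (- 1 * w + 2) / (w - 2) ^ Suc (k - 1)"
      using eventually_at_in_open[of "ball 2 1" "2 :: complex"]
      by (auto elim!: eventually_mono simp del: power_Suc)
  qed auto
  also have "\<dots> = (deriv ^^ (k - 1)) (\<lambda>w. f (- 1 * w + 2)) 2 / fact (k - 1)"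
  proof (rule residue_holomorphic_over_power[of "ball 2 1"])
    have "f \<circ> (\<lambda>w. - 1 * w + 2) holomorphic_on ball 2 1"
      using in_ball by (intro holomorphic_on_compose holomorphic_intros holomorphic_on_subset[OF f]) auto
    then show "(\<lambda>w. f (- 1 * w + 2)) holomorphic_on ball 2 1" by (simp add: o_def)
  qed auto
  also have "(deriv ^^ (k - 1)) (\<lambda>w. f (- 1 * w + 2)) 2 = (- 1) ^ (k - 1) * (deriv ^^ (k - 1)) f (- 1 * 2 + 2)"
    by (rule higher_deriv_compose_linear'[OF f, of "ball 2 1"]) (use in_ball in auto)
  also have "(deriv ^^ (k - 1)) f (- 1 * 2 + 2) = - ((- 1) ^ k) * (deriv ^^ (k - 1)) (residue_numer k \<beta>) 0"
    unfolding f_def using higher_deriv_cmult[OF holomorphic_residue_numer[OF assms(3)], of 0 "k - 1" "- ((- 1) ^ k)"] by simp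
  also have "(- 1) ^ (k - 1) * (- ((- 1) ^ k) * (deriv ^^ (k - 1)) (residue_numer k \<beta>) 0) =
      (deriv ^^ (k - 1)) (residue_numer k \<beta>) 0"
    using assms(1) by (cases k) (simp_all add: mult.assoc[symmetric] flip: power_mult_distrib)
  finally show ?thesis .
qed

lemma holomorphic_contour_integrand:
  assumes "\<gamma> > 0"
  shows "contour_integrand k \<gamma> holomorphic_on {s. - 1 < Re s} - {0, 1, 2}"
proof -
  let ?S = "{s. - 1 < Re s} - {0, 1, 2}"
  have n: "w \<notin> \<int>\<^sub>\<le>\<^sub>0" if "w \<in> ?S" for w
  proof
    assume "w \<in> \<int>\<^sub>\<le>\<^sub>0"
    then obtain n :: nat where n: "w = - of_nat n" by (auto elim!: nonpos_Ints_cases')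
    with that have "real n < 1" by auto
    with n that show False by simp
  qed
  have "zeta \<circ> (\<lambda>s. s - 1) holomorphic_on ?S"
    by (intro holomorphic_on_compose holomorphic_intros holomorphic_on_subset[OF zeta_conditions(1)]) (auto simp: eq_diff_eq)
  moreover have "zeta holomorphic_on ?S"
    by (rule holomorphic_on_subset[OF zeta_conditions(1)]) auto
  ultimately show ?thesis
    unfolding contour_integrand_def mellin_kernel_def o_def using assms n by (intro holomorphic_intros) auto
qed

text \<open>
  Of the pole of order \<open>k\<close> of \<open>\<zeta>\<^sup>k\<close> the cosine power cancels order \<open>k-1\<close>, leaving
  \<open>(-\<pi>/2)\<^bsup>k-1\<^esup> (\<zeta>(0)/2)\<^sup>k\<close> with \<open>\<zeta>(0) = -1/2\<close>.
\<close>
lemma residue_contour_integrand_1: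
  assumes "k \<ge> 1" "\<gamma> > 0"
  shows "residue (contour_integrand k \<gamma>) 1 = - of_real ((pi / 2) ^ (k - 1) / 2 ^ (2 * k))"
proof (rule residue_simple'[of "ball 1 1"])
  have "ball 1 1 - {1} \<subseteq> {s. - 1 < Re s} - {0, 1, 2 :: complex}"
  proof
    fix s :: complex assume s: "s \<in> ball 1 1 - {1}"
    then have "\<bar>Re (1 - s)\<bar> < 1" using abs_Re_le_cmod[of "1 - s"] by (simp add: dist_norm)
    with s show "s \<in> {s. - 1 < Re s} - {0, 1, 2}" by auto
  qed
  then show "contour_integrand k \<gamma> holomorphic_on ball 1 1 - {1}"
    by (rule holomorphic_on_subset[OF holomorphic_contour_integrand[OF assms(2)]])
  define G where "G = (\<lambda>w. zeta_numer w ^ k * (cos (of_real pi * w / 2) / (w - 1)) ^ (k - 1) *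
    (zeta (w - 1) * Gamma w * 2 powr (- w)) ^ k * of_real \<gamma> powr (- (of_nat k * (w - 1))))"
  have contz: "isCont zeta_numer 1"
    by (rule holomorphic_on_imp_continuous_on[OF holomorphic_zeta_numer, THEN continuous_on_interior])
       (simp add: interior_open open_halfspace_Re_gt)
  have contzeta: "isCont zeta 0"
    by (rule holomorphic_on_imp_continuous_on[OF zeta_conditions(1), THEN continuous_on_interior])
       (simp add: interior_open open_Compl)
  have "((\<lambda>w. zeta (w - 1)) \<longlongrightarrow> zeta 0) (at 1)"
  proof (rule isCont_tendsto_compose[OF contzeta])
    show "((\<lambda>w. w - 1) \<longlongrightarrow> 0) (at (1 :: complex))" by (auto intro!: tendsto_eq_intros)
  qed
  moreover have "(zeta_numer \<longlongrightarrow> 1) (at 1)"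
    using contz by (simp add: isCont_def zeta_numer_1)
  moreover have "(Gamma \<longlongrightarrow> 1) (at (1::complex))"
    using isCont_Gamma[of "1 :: complex" "\<lambda>x. x"] by (simp add: isCont_def)
  moreover have "((\<lambda>w::complex. 2 powr (- w)) \<longlongrightarrow> 2 powr (- 1)) (at 1)"
    by (intro tendsto_intros) auto
  moreover have "((\<lambda>w. of_real \<gamma> powr (- (of_nat k * (w - 1)))) \<longlongrightarrow> of_real \<gamma> powr (- (of_nat k * (1 - 1)))) (at (1::complex))"
    using assms(2) by (intro tendsto_intros) auto
  moreover have "((\<lambda>w. cos (of_real pi * w / 2) / (w - 1)) \<longlongrightarrow> - of_real (pi / 2)) (at (1::complex))"
  proof -
    have "((\<lambda>w::complex. cos (of_real pi * w / 2)) has_field_derivative - of_real (pi / 2)) (at 1)"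
      by (auto intro!: derivative_eq_intros)
    then show ?thesis by (simp add: has_field_derivative_iff)
  qed
  ultimately have "(G \<longlongrightarrow> 1 ^ k * (- of_real (pi / 2)) ^ (k - 1) *
      (zeta 0 * 1 * 2 powr (- 1)) ^ k * of_real \<gamma> powr (- (of_nat k * (1 - 1)))) (at 1)"
    unfolding G_def by (intro tendsto_mult tendsto_power)
  also have "1 ^ k * (- of_real (pi / 2)) ^ (k - 1) *
      (zeta 0 * 1 * 2 powr (- 1)) ^ k * of_real \<gamma> powr (- (of_nat k * (1 - 1))) =
      - (of_real ((pi / 2) ^ (k - 1) / 2 ^ (2 * k)) :: complex)"
  proof -
    have "zeta 0 * 1 * 2 powr (- 1) = - (1 / 4)"
      by (simp add: zeta_0 powr_minus)
    moreover obtain m where "k = Suc m" using assms(1) by (cases k) auto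
    moreover have "(- 1) ^ m * (- 1) ^ m = (1 :: complex)" for m
      by (simp flip: power_mult_distrib)
    ultimately show ?thesis
      using assms(2) power_minus[of "of_real pi / 2 :: complex" m] power_minus[of "1 / 4 :: complex" m]
      by (simp add: power_minus[of "of_real pi / 2 :: complex"] power_minus[of "1 / 4 :: complex"] power_mult power_divide)
  qed
  finally show "((\<lambda>w. contour_integrand k \<gamma> w * (w - 1)) \<longlongrightarrow> - of_real ((pi / 2) ^ (k - 1) / 2 ^ (2 * k))) (at 1)"
  proof (rule Lim_transform_eventually)
    show "\<forall>\<^sub>F w in at 1. G w = contour_integrand k \<gamma> w * (w - 1)"
    proof (rule eventually_mono[OF eventually_at_in_open[of "{s. Re s > 0}"]])
      fix w :: complex assume w: "w \<in> {s. Re s > 0} - {1}"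
      obtain m where m: "k = Suc m" using assms(1) by (cases k) auto
      have z: "zeta w = zeta_numer w / (w - 1)" using w by (simp add: zeta_eq)
      show "G w = contour_integrand k \<gamma> w * (w - 1)"
        unfolding G_def contour_integrand_def mellin_kernel_def z m
        using w by (simp add: power_mult_distrib power_divide mult_ac)
    qed (auto simp: open_halfspace_Re_gt)
  qed
qed auto

text \<open>
  The abscissa \<open>5/2\<close> lies in the range of absolute convergence \<open>Re w > 2\<close>, and its mirror image \<open>-1/2\<close>
  stays to the right of the next pole \<open>-1\<close> of \<open>\<Gamma>\<close>, so that exactly \<open>0\<close>, \<open>1\<close>, \<open>2\<close> are enclosed.
\<close>
lemma vertical_integral_contour_integrand:
  assumes "k \<ge> 1" "\<alpha> > 0" "\<beta> > 0" "\<alpha> * \<beta> = pi\<^sup>2"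
  shows "vertical_integral (contour_integrand k \<alpha>) (5/2) + vertical_integral (contour_integrand k \<beta>) (5/2) =
    (deriv ^^ (k - 1)) (residue_numer k \<alpha>) 0 / fact (k - 1) + (deriv ^^ (k - 1)) (residue_numer k \<beta>) 0 / fact (k - 1)
      - of_real ((pi / 2) ^ (k - 1) / 2 ^ (2 * k))"
proof -
  let ?H = "contour_integrand k \<alpha>"
  have "vertical_integral (contour_integrand k \<beta>) (5/2) = - vertical_integral (\<lambda>w. ?H (2 - w)) (5/2)"
  proof -
    have "contour_integrand k \<beta> (Complex (5/2) t) = - ?H (2 - Complex (5/2) t)" for t
    proof -
      have "Complex (5/2) t \<notin> \<int>"
      proof
        assume "Complex (5/2) t \<in> \<int>"
        then obtain n where "Complex (5/2) t = of_int n" by (auto elim!: Ints_cases)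
        then have "5 / 2 = real_of_int n" by (metis Re_complex_of_real complex.sel(1) of_real_of_int_eq)
        then have "real_of_int 5 = real_of_int (2 * n)" by simp
        then have "5 = 2 * n" by (simp only: of_int_eq_iff)
        then show False by presburger
      qed
      then show ?thesis using contour_integrand_reflect[OF assms, of "Complex (5/2) t"] by simp
    qed
    then show ?thesis unfolding vertical_integral_def by simp
  qed
  also have "vertical_integral (\<lambda>w. ?H (2 - w)) (5/2) = vertical_integral ?H (- 1 / 2)"
    by (simp add: vertical_integral_reflect)
  finally have refl: "vertical_integral (contour_integrand k \<beta>) (5/2) = - vertical_integral ?H (- 1 / 2)" .
  have growth: "strip_growth (- 1 / 2) (5 / 2) (real k * (0 + 0) + (- (pi / 2)) + 0) ?H"
  proof -
    have s: "strip_growth (- 1 / 2) (5 / 2) 0 (\<lambda>w. zeta (w - 1))"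
      by (rule strip_growth_compose[OF strip_growth_zeta[of "- 3 / 2" "3 / 2"]]) auto
    have "- (of_nat k * (w - 1)) = of_real (- real k) * w + of_nat k" for w :: complex
      by (simp add: algebra_simps)
    then have p: "strip_growth (- 1 / 2) (5 / 2) 0 (\<lambda>w. of_real \<alpha> powr (- (of_nat k * (w - 1))))"
      using strip_growth_powr[OF assms(2), of _ _ "- real k" "of_nat k"] by (simp only:)
    show ?thesis
      unfolding contour_integrand_def
      by (intro strip_growth_mult strip_growth_power strip_growth_zeta s p strip_growth_mellin_kernel assms)
  qed
  then obtain C where C: "\<And>s. - 1 / 2 \<le> Re s \<Longrightarrow> Re s \<le> 5 / 2 \<Longrightarrow> 1 \<le> \<bar>Im s\<bar> \<Longrightarrow> norm (?H s) \<le> C / (1 + (Im s)\<^sup>2)"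
    by (rule strip_growth_quadratic_decay) auto
  have "vertical_integral ?H (5/2) - vertical_integral ?H (- 1 / 2) = (\<Sum>p\<in>{0, 1, 2}. residue ?H p)"
  proof (rule vertical_integral_diff_residues[where a' = "-1" and b' = 3, OF _ _ _ _ _ _ C])
    show "?H holomorphic_on {s. - 1 < Re s \<and> Re s < 3} - {0, 1, 2}"
      by (rule holomorphic_on_subset[OF holomorphic_contour_integrand[OF assms(2)]]) auto
  qed auto
  then show ?thesis
    unfolding refl using residue_contour_integrand_0[OF assms(1,2)] residue_contour_integrand_1[OF assms(1,2)]
      residue_contour_integrand_2[OF assms] by (simp add: algebra_simps)
qed

theorem corollary1p5:
  fixes k :: nat and \<alpha> \<beta> \<mu> :: real
  assumes "k \<ge> 1" and "\<alpha> > 0" and "\<beta> > 0" and "\<alpha> * \<beta> = pi\<^sup>2" and "\<mu> < 0"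
  defines "S \<equiv> \<lambda>\<gamma> :: real. \<lambda>m. let n = Suc m in
             of_nat n * of_nat (piltz k n) * Psi \<mu> ((2 * \<gamma>) ^ k) k (real n)"
  shows "summable (S \<alpha>) \<and> summable (S \<beta>) \<and>
    of_real \<alpha> ^ k * (\<Sum>m. S \<alpha> m) + of_real \<beta> ^ k * (\<Sum>m. S \<beta> m) =
      1 / fact (k - 1) *
        (deriv ^^ (k - 1)) (\<lambda>s :: complex.
           zeta (s - 1) ^ k * zeta s ^ k * Gamma (s + 1) ^ k * cos (of_real pi * s / 2) ^ (k - 1) *
           2 powr (- (of_nat k * s)) *
           (of_real \<alpha> powr (- (of_nat k * (s - 1))) + of_real \<beta> powr (- (of_nat k * (s - 1))))) 0
      - of_real ((pi / 2) ^ (k - 1) / 2 ^ (2 * k))"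
proof -
  have S: "summable (S \<gamma>) \<and> of_real \<gamma> ^ k * (\<Sum>m. S \<gamma> m) = vertical_integral (contour_integrand k \<gamma>) (5/2)"
    if "\<gamma> > 0" for \<gamma>
  proof -
    have "(\<lambda>m. of_real \<gamma> ^ k * S \<gamma> m) sums vertical_integral (contour_integrand k \<gamma>) (5/2)"
      unfolding S_def Let_def using sums_Psi_contour[OF assms(1) that assms(5), of "5/2"] by simp
    moreover from this have "summable (S \<gamma>)"
      using that sums_summable summable_cmult_iff[of "of_real \<gamma> ^ k" "S \<gamma>"] by fastforce
    ultimately show ?thesis using suminf_mult[of "S \<gamma>" "of_real \<gamma> ^ k"] sums_unique by metis
  qed
  have "(deriv ^^ (k - 1)) (residue_numer k \<alpha>) 0 + (deriv ^^ (k - 1)) (residue_numer k \<beta>) 0 =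
      (deriv ^^ (k - 1)) (\<lambda>s. residue_numer k \<alpha> s + residue_numer k \<beta> s) 0"
    by (rule higher_deriv_add[OF holomorphic_residue_numer[OF assms(2)] holomorphic_residue_numer[OF assms(3)], symmetric]) auto
  also have "(\<lambda>s. residue_numer k \<alpha> s + residue_numer k \<beta> s) = (\<lambda>s.
           zeta (s - 1) ^ k * zeta s ^ k * Gamma (s + 1) ^ k * cos (of_real pi * s / 2) ^ (k - 1) *
           2 powr (- (of_nat k * s)) *
           (of_real \<alpha> powr (- (of_nat k * (s - 1))) + of_real \<beta> powr (- (of_nat k * (s - 1)))))"
    unfolding residue_numer_def by (simp only: distrib_left)
  finally show ?thesis
    using S[OF assms(2)] S[OF assms(3)] vertical_integral_contour_integrand[OF assms(1-4)]
    by (simp add: add_divide_distrib[symmetric])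
qed

end
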